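(* Let $\nu$ be a Borel probability measure on $\mathbb{R}$ with compact support $\mathrm{supp}\,\nu$ which has a (non-trivial) absolutely continuous component with respect to Lebesgue measure, that is, $\nu_{\mathrm{ac}} \neq 0$. Let $\Omega = (\mathrm{supp}\,\nu)^{\mathbb{Z}}$, $\mu = \nu^{\mathbb{Z}}$, and for $\omega \in \Omega$ let $H_\omega$ be the operator in $\ell^2(\mathbb{Z})$ given by $[H_\omega\psi](n) = \psi(n+1)+\psi(n-1)+\omega_n\psi(n)$. Then, for $\mu$-almost every $\omega \in \Omega$, the operator $H_\omega$ is spectrally localized.
   Context: Here $\nu_{\mathrm{ac}}$ is the absolutely continuous part of $\nu$ in its Lebesgue decomposition. The operator $H_\omega$ is called spectrally localized if it has pure point spectrum with exponentially decaying eigenvectors, that is, there are $E_k(\omega)\in\mathbb{R}$ and $\psi_k(\omega)\in\ell^2(\mathbb{Z})$, $k \in \mathbb{Z}_+$, such that $H_\omega\psi_k(\omega) = E_k(\omega)\psi_k(\omega)$ for every $k$, the finite linear combinations of the $\psi_k(\omega)$ are dense in $\ell^2(\mathbb{Z})$, and $|\psi_k(\omega,n)| \le C_k(\omega)e^{-\gamma_k(\omega)|n-n_k(\omega)|}$ for all $n \in \mathbb{Z}$, with suitable $C_k(\omega),\gamma_k(\omega)\in(0,\infty)$ and $n_k(\omega)\in\mathbb{Z}$. *)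

theory Defs
  imports "HOL-Probability.Probability"
begin

definition measure_support :: "'a::topological_space measure \<Rightarrow> 'a set" where
  "measure_support M = {x. \<forall>U. open U \<and> x \<in> U \<longrightarrow> emeasure M U > 0}"

text \<open>The two components are unique, so a hypothesis on \<open>M_ac\<close> is a hypothesis on the
  measure \<open>M\<close> alone.\<close>

definition lebesgue_decomposition ::
    "real measure \<Rightarrow> real measure \<Rightarrow> real measure \<Rightarrow> bool" where
  "lebesgue_decomposition M M_ac M_s \<longleftrightarrow>
     sets M_ac = sets borel \<and> sets M_s = sets borel \<and>
     (\<forall>A\<in>sets borel. emeasure M A = emeasure M_ac A + emeasure M_s A) \<and>
     absolutely_continuous lborel M_ac \<and>
     (\<exists>N\<in>sets borel. emeasure lborel N = 0 \<and> emeasure M_s (UNIV - N) = 0)"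

text \<open>The space underlying this product measure is exactly the set of all
  \<open>\<omega> :: int \<Rightarrow> real\<close> with values in the support of \<open>\<nu>\<close>.\<close>

definition disorder_measure :: "real measure \<Rightarrow> (int \<Rightarrow> real) measure" where
  "disorder_measure \<nu> = (\<Pi>\<^sub>M n\<in>(UNIV :: int set). restrict_space \<nu> (measure_support \<nu>))"

definition ell2 :: "(int \<Rightarrow> complex) set" where
  "ell2 = {\<psi>. (\<lambda>n. (norm (\<psi> n))\<^sup>2) summable_on UNIV}"

definition ell2_norm :: "(int \<Rightarrow> complex) \<Rightarrow> real" where
  "ell2_norm \<psi> = sqrt (\<Sum>\<^sub>\<infinity>n. (norm (\<psi> n))\<^sup>2)"

text \<open>For bounded \<open>\<omega>\<close> the following map sends \<^const>\<open>ell2\<close> to itself.\<close>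

definition anderson :: "(int \<Rightarrow> real) \<Rightarrow> (int \<Rightarrow> complex) \<Rightarrow> (int \<Rightarrow> complex)" where
  "anderson \<omega> \<psi> = (\<lambda>n. \<psi> (n + 1) + \<psi> (n - 1) + complex_of_real (\<omega> n) * \<psi> n)"

text \<open>Meaningful only when all \<open>\<psi> k\<close> lie in \<^const>\<open>ell2\<close>, as the infinite sum in
  \<^const>\<open>ell2_norm\<close> is \<open>0\<close> for non-summable families.\<close>

definition finite_combinations_dense :: "(nat \<Rightarrow> int \<Rightarrow> complex) \<Rightarrow> bool" where
  "finite_combinations_dense \<psi> \<longleftrightarrow>
     (\<forall>\<phi>\<in>ell2. \<forall>\<epsilon>>0. \<exists>(m::nat) (c :: nat \<Rightarrow> complex).
        ell2_norm (\<lambda>n. \<phi> n - (\<Sum>k<m. c k * \<psi> k n)) < \<epsilon>)"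

definition exponentially_decaying :: "(int \<Rightarrow> complex) \<Rightarrow> bool" where
  "exponentially_decaying \<psi> \<longleftrightarrow>
     (\<exists>(C::real) (\<gamma>::real) (n0::int). C > 0 \<and> \<gamma> > 0 \<and>
        (\<forall>n. norm (\<psi> n) \<le> C * exp (- \<gamma> * of_int \<bar>n - n0\<bar>)))"

text \<open>The \<open>\<psi> k\<close> are eigenvectors and hence nonzero.\<close>

definition spectrally_localized :: "((int \<Rightarrow> complex) \<Rightarrow> (int \<Rightarrow> complex)) \<Rightarrow> bool" where
  "spectrally_localized H \<longleftrightarrow>
     (\<exists>(E :: nat \<Rightarrow> real) (\<psi> :: nat \<Rightarrow> int \<Rightarrow> complex).
        (\<forall>k. \<psi> k \<in> ell2 \<and> \<psi> k \<noteq> (\<lambda>_. 0) \<and>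
             H (\<psi> k) = (\<lambda>n. complex_of_real (E k) * \<psi> k n)) \<and>
        finite_combinations_dense \<psi> \<and>
        (\<forall>k. exponentially_decaying (\<psi> k)))"

end

theory Submission
  imports Defs "HOL-Computational_Algebra.Fundamental_Theorem_Algebra"
begin

text \<open>Fix a Borel set \<open>A\<close> with \<open>\<nu> A > 0\<close> on which \<open>\<nu>\<close> has density at most \<open>K\<close>. The one-step transfer operator,
  acting on functions on the plane that are homogeneous of degree \<open>-1\<close>, is a convolution with \<open>\<nu>\<close> composed with the
  unitary map induced by \<open>x \<mapsto> -1 / x\<close> on \<open>L\<^sup>2(\<real>)\<close>. Two consecutive steps contract strictly, uniformly in the energy: a
  function that is nearly invariant under the convolution is spread out over the line, and the inversion then
  concentrates it. Smoothing at the sites with value in \<open>A\<close> turns this into exponential decay of small fractional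
  moments of solutions, uniformly in the initial direction.

  For the restrictions to finite boxes around a site \<open>a\<close>, averaging over the potential at \<open>a\<close> (where only the
  event \<open>\<omega> a \<in> A\<close> is used) converts these fixed-energy bounds into a bound on an eigenfunction correlator: up to a
  small part of the norm, the unit vector at \<open>a\<close> is a combination of uniformly exponentially decaying box
  eigenvectors. By compactness these are close to exponentially decaying eigenvectors of the infinite operator,
  whose closed span thus contains the unit vector at \<open>a\<close>. Almost surely there are two adjacent sites with values in
  \<open>A\<close>, and the closed span is invariant under the operator, so it is everything. No spectral theorem for the
  infinite operator is needed.\<close>

section \<open>Averaging over translations in the square integrable functions\<close>

text \<open>Two obstacles shape the proof. First, \<nu> may have a singular part, even atoms, so a
  bounded density is available only on the event that a site takes its value in \<open>A\<close>;
  the complementary event enters only through its probability. Second, the decay estimates hold at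
  each deterministic energy, whereas the eigenvalues are random. A sum over the eigenvalues of a
  box, taken with the spectral weights of the unit vector at \<open>a\<close>, becomes after
  averaging over the potential at \<open>a\<close> an integral over deterministic energies. This is
  why decay is measured from \<open>a\<close> and weighted by the spectral measure there. Degree -1
  is the degree at which functions on the plane are half-densities on the projective line, whose L2
  norm is preserved by maps of determinant 1. A single step cannot contract uniformly, because
  convolution hardly changes a function that varies slowly; the inversion in the next step destroys
  that slowness.\<close>

lemma nn_integral_neg_inverse:
  fixes g :: "real \<Rightarrow> ennreal"
  assumes [measurable]: "g \<in> borel_measurable borel"
  shows "(\<integral>\<^sup>+x. ennreal (1 / x\<^sup>2) * g (- 1 / x) \<partial>lborel) = (\<integral>\<^sup>+x. g x \<partial>lborel)"
proof -
  define h where "h x = ennreal (1 / x\<^sup>2) * g (- 1 / x)" for x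
  have [measurable]: "h \<in> borel_measurable borel" unfolding h_def by measurable
  \<comment> \<open>Each \<open>I n\<close> is invariant under \<open>x \<mapsto> - 1 / x\<close>,
    which exchanges its two halves and is smooth and increasing on each of them. The truncated
    identities therefore have the same truncation on both sides.\<close>
  define I where "I n = {- real (Suc n)..- (1 / real (Suc n))} \<union> {1 / real (Suc n)..real (Suc n)}" for n
  have Im[measurable]: "I n \<in> sets borel" for n by (simp add: I_def)
  have aux: "(\<integral>\<^sup>+x. h x * indicator {a..b} x \<partial>lborel)
        = (\<integral>\<^sup>+x. g x * indicator {- 1 / a..- 1 / b} x \<partial>lborel)"
    if "a \<le> b" "0 < a \<or> b < 0" for a b :: real
  proof (cases "a = b")
    \<comment> \<open>This occurs for \<open>n = 0\<close>, where each half of \<open>I n\<close> is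
      a single point and the substitution rule does not apply.\<close>
    case True
    then show ?thesis
      by (auto intro!: trans[OF nn_integral_0_iff_AE[THEN iffD2] nn_integral_0_iff_AE[THEN iffD2, symmetric]]
          AE_I[where N="{a}"] AE_I[where N="{-1/a}"] split: split_indicator)
  next
    case False
    have "(\<integral>\<^sup>+x. g x * indicator {- 1 / a..- 1 / b} x \<partial>lborel)
      = (\<integral>\<^sup>+x. g (- 1 / x) * ennreal (1 / x\<^sup>2) * indicator {a..b} x \<partial>lborel)"
    proof (rule nn_integral_substitution_aux[where g = "\<lambda>x. - 1 / x"])
      fix x :: real assume "x \<in> {a..b}"
      then have "x \<noteq> 0" using that by auto
      then show "((\<lambda>x. - 1 / x) has_real_derivative 1 / x\<^sup>2) (at x)"
        by (auto intro!: derivative_eq_intros simp: power2_eq_square)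
    next
      show "continuous_on {a..b} (\<lambda>x. 1 / x\<^sup>2)"
        using that by (intro continuous_intros) auto
    qed (use that False in auto)
    then show ?thesis by (simp add: h_def mult_ac)
  qed
  have disj: "indicator (I n) x = (indicator {- real (Suc n)..- (1 / real (Suc n))} x
     + indicator {1 / real (Suc n)..real (Suc n)} x :: ennreal)" for n x
  proof -
    have "1 / real (Suc n) > 0" by simp
    then have "\<not> (1 / real (Suc n) \<le> x \<and> x \<le> - (1 / real (Suc n)))" by linarith
    then show ?thesis by (auto simp: I_def split: split_indicator simp del: of_nat_Suc)
  qed
  have step: "(\<integral>\<^sup>+x. h x * indicator (I n) x \<partial>lborel)
      = (\<integral>\<^sup>+x. g x * indicator (I n) x \<partial>lborel)" for n
  proof -
    have le: "1 / real (Suc n) \<le> real (Suc n)"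
      by (rule order_trans[of _ 1]) simp_all
    have A: "(\<integral>\<^sup>+x. h x * indicator {1 / real (Suc n)..real (Suc n)} x \<partial>lborel)
       = (\<integral>\<^sup>+x. g x * indicator {- real (Suc n)..- (1 / real (Suc n))} x \<partial>lborel)"
      using aux[OF le] by simp
    have B: "(\<integral>\<^sup>+x. h x * indicator {- real (Suc n)..- (1 / real (Suc n))} x \<partial>lborel)
       = (\<integral>\<^sup>+x. g x * indicator {1 / real (Suc n)..real (Suc n)} x \<partial>lborel)"
    proof -
      have "- 1 / - real (Suc n) = 1 / real (Suc n)" "- 1 / - (1 / real (Suc n)) = real (Suc n)"
        by (simp_all del: of_nat_Suc)
      then show ?thesis
        using aux[of "- real (Suc n)" "- (1 / real (Suc n))"] le by (simp del: of_nat_Suc)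
    qed
    show ?thesis unfolding disj distrib_left
      by (subst (1 2) nn_integral_add) (auto simp: A B add.commute simp del: of_nat_Suc)
  qed
  have inc: "incseq I"
  proof (rule incseq_SucI)
    fix n
    have "1 / real (Suc (Suc n)) \<le> 1 / real (Suc n)" by (simp add: divide_simps)
    then show "I n \<le> I (Suc n)" unfolding I_def by (auto simp del: of_nat_Suc)
  qed
  have un: "(\<Union>n. I n) = - {0}"
  proof (intro equalityI subsetI)
    fix x :: real assume "x \<in> - {0}"
    then have "x \<noteq> 0" by simp
    obtain n where n: "real n > max \<bar>x\<bar> (1 / \<bar>x\<bar>)" using reals_Archimedean2 by blast
    then have 1: "\<bar>x\<bar> \<le> real (Suc n)" and "1 / \<bar>x\<bar> \<le> real (Suc n)" by auto
    then have "1 / real (Suc n) \<le> \<bar>x\<bar>" using \<open>x \<noteq> 0\<close> by (simp add: divide_simps mult.commute)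
    then have "x \<in> I n" using 1 unfolding I_def by (auto simp: abs_real_def split: if_splits)
    then show "x \<in> (\<Union>n. I n)" by auto
  next
    fix x :: real assume "x \<in> (\<Union>n. I n)"
    then obtain n where n: "x \<in> I n" by auto
    have "1 / real (Suc n) > 0" by simp
    then show "x \<in> - {0}" using n unfolding I_def by (auto simp del: of_nat_Suc)
  qed
  have mono: "(\<integral>\<^sup>+x. h x \<partial>lborel) = (SUP n. \<integral>\<^sup>+x. h x * indicator (I n) x \<partial>lborel)"
    if [measurable]: "h \<in> borel_measurable borel" for h :: "real \<Rightarrow> ennreal"
  proof -
    have "(SUP n. \<integral>\<^sup>+x. h x * indicator (I n) x \<partial>lborel) = (\<integral>\<^sup>+x. (SUP n. h x * indicator (I n) x) \<partial>lborel)"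
      by (rule nn_integral_monotone_convergence_SUP[symmetric])
        (use inc in \<open>auto simp: incseq_def le_fun_def split: split_indicator\<close>)
    also have "\<dots> = (\<integral>\<^sup>+x. h x \<partial>lborel)"
    proof (rule nn_integral_cong_AE, rule AE_I[where N="{0}"])
      show "{x \<in> space lborel. (SUP n. h x * indicator (I n) x) \<noteq> h x} \<subseteq> {0}"
      proof safe
        fix x :: real assume "(SUP n. h x * indicator (I n) x) \<noteq> h x"
        then show "x = 0"
        proof (rule contrapos_np)
          assume "x \<noteq> 0"
          then obtain n where n: "x \<in> I n" using un by auto
          show "(SUP n. h x * indicator (I n) x) = h x"
            by (rule antisym) (auto intro!: SUP_least SUP_upper2[of n] simp: n split: split_indicator)
        qed
      qed
    qed auto
    finally show ?thesis by simp
  qed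
  show ?thesis unfolding h_def[symmetric]
    by (subst (1 2) mono) (simp_all add: step)
qed

section \<open>Translation invariance and the variance identity\<close>

lemma nn_integral_lborel_shift:
  fixes f :: "real \<Rightarrow> ennreal"
  assumes [measurable]: "f \<in> borel_measurable borel"
  shows "(\<integral>\<^sup>+x. f (x - t) \<partial>lborel) = (\<integral>\<^sup>+x. f x \<partial>lborel)"
  using nn_integral_real_affine[of f 1 "- t"] by (simp add: algebra_simps)

lemma nn_integral_lborel_reflect:
  fixes f :: "real \<Rightarrow> ennreal"
  assumes [measurable]: "f \<in> borel_measurable borel"
  shows "(\<integral>\<^sup>+x. f (t - x) \<partial>lborel) = (\<integral>\<^sup>+x. f x \<partial>lborel)"
  using nn_integral_real_affine[of f "-1" t] by (simp add: algebra_simps)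

text \<open>The double integral is twice the variance. The squared mean stands on the left because
  subtraction in \<open>ennreal\<close> is truncated.\<close>

lemma (in prob_space) variance_nn_integral:
  fixes X :: "'a \<Rightarrow> real"
  assumes [measurable]: "X \<in> borel_measurable M" and bd: "\<And>x. \<bar>X x\<bar> \<le> B"
  shows "(\<integral>\<^sup>+x. \<integral>\<^sup>+y. ennreal ((X x - X y)\<^sup>2) \<partial>M \<partial>M) + 2 * ennreal ((\<integral>x. X x \<partial>M)\<^sup>2)
     = 2 * (\<integral>\<^sup>+x. ennreal ((X x)\<^sup>2) \<partial>M)"
proof -
  have i1: "integrable M X" by (rule integrable_const_bound[where B=B]) (use bd in auto)
  have "(X x)\<^sup>2 \<le> B\<^sup>2" for x using bd[of x] by (metis abs_le_square_iff abs_of_nonneg abs_ge_zero order_trans)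
  then have i2: "integrable M (\<lambda>x. (X x)\<^sup>2)"
    by (intro integrable_const_bound[where B="B\<^sup>2"]) auto
  define m where "m = (\<integral>x. X x \<partial>M)"
  define s where "s = (\<integral>x. (X x)\<^sup>2 \<partial>M)"
  have eq: "(X x - X y)\<^sup>2 = (X x)\<^sup>2 - 2 * X x * X y + (X y)\<^sup>2" for x y
    by (simp add: power2_eq_square algebra_simps)
  have inner: "(\<integral>\<^sup>+y. ennreal ((X x - X y)\<^sup>2) \<partial>M) = ennreal ((X x)\<^sup>2 - 2 * m * X x + s)" for x
  proof -
    have "has_bochner_integral M (\<lambda>y. (X x - X y)\<^sup>2) ((X x)\<^sup>2 - 2 * X x * m + s)"
      unfolding eq m_def s_def
      by (intro has_bochner_integral_add has_bochner_integral_diff has_bochner_integral_mult_right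
          has_bochner_integral_integrable i1 i2)
        (simp add: has_bochner_integral_iff prob_space)
    then have "(\<integral>\<^sup>+y. ennreal ((X x - X y)\<^sup>2) \<partial>M) = ennreal ((X x)\<^sup>2 - 2 * X x * m + s)"
      by (subst nn_integral_eq_integral) (auto simp: has_bochner_integral_iff)
    then show ?thesis by (simp add: mult_ac)
  qed
  have nn: "(X x)\<^sup>2 - 2 * m * X x + s \<ge> 0" for x
  proof -
    have "0 \<le> (\<integral>y. (X x - X y)\<^sup>2 \<partial>M)" by (rule integral_nonneg_AE) auto
    also have "(\<integral>y. (X x - X y)\<^sup>2 \<partial>M) = (X x)\<^sup>2 - 2 * X x * m + s"
      unfolding eq m_def s_def using i1 i2 by (simp add: prob_space)
    finally show ?thesis by (simp add: mult_ac)
  qed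
  have hb: "has_bochner_integral M (\<lambda>x. (X x)\<^sup>2 - 2 * m * X x + s) (s - 2 * m * m + s)"
    unfolding m_def s_def
    by (intro has_bochner_integral_add has_bochner_integral_diff has_bochner_integral_mult_right
          has_bochner_integral_integrable i1 i2)
        (simp add: has_bochner_integral_iff prob_space)
  have D: "(\<integral>\<^sup>+x. \<integral>\<^sup>+y. ennreal ((X x - X y)\<^sup>2) \<partial>M \<partial>M) = ennreal (2 * s - 2 * m\<^sup>2)"
  proof -
    have "(\<integral>\<^sup>+x. ennreal ((X x)\<^sup>2 - 2 * m * X x + s) \<partial>M) = ennreal (s - 2 * m * m + s)"
      using hb nn by (subst nn_integral_eq_integral) (auto simp: has_bochner_integral_iff)
    then show ?thesis unfolding inner by (simp add: power2_eq_square algebra_simps)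
  qed
  have "0 \<le> (\<integral>x. ((X x)\<^sup>2 - 2 * m * X x + s) \<partial>M)" by (intro integral_nonneg_AE AE_I2 nn)
  then have "0 \<le> s - 2 * m * m + s" using hb by (simp add: has_bochner_integral_iff)
  then have nn2: "0 \<le> 2 * s - 2 * m\<^sup>2" by (simp add: power2_eq_square mult_ac)
  have S: "(\<integral>\<^sup>+x. ennreal ((X x)\<^sup>2) \<partial>M) = ennreal s"
    unfolding s_def by (subst nn_integral_eq_integral) (auto simp: i2)
  have s0: "s \<ge> 0" unfolding s_def by (rule integral_nonneg_AE) auto
  have "2 * ennreal (m\<^sup>2) = ennreal (2 * m\<^sup>2)" by (simp add: ennreal_mult')
  moreover have "2 * ennreal s = ennreal (2 * s)" by (simp add: ennreal_mult')
  ultimately show ?thesis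
    unfolding D S m_def[symmetric] using nn2 by (simp flip: ennreal_plus)
qed

definition sq_norm :: "(real \<Rightarrow> real) \<Rightarrow> ennreal" where
  "sq_norm f = (\<integral>\<^sup>+x. ennreal ((f x)\<^sup>2) \<partial>lborel)"

definition shift_dist :: "(real \<Rightarrow> real) \<Rightarrow> real \<Rightarrow> ennreal" where
  "shift_dist f t = (\<integral>\<^sup>+x. ennreal ((f x - f (x - t))\<^sup>2) \<partial>lborel)"

text \<open>Telescoping into \<open>q\<close> translations by \<open>t\<close>, followed by
  Cauchy-Schwarz. A short translation that hardly moves \<open>f\<close> can thus be amplified to a
  long one at the price of a fixed factor.\<close>

lemma shift_dist_mult:
  assumes [measurable]: "f \<in> borel_measurable borel"
  shows "shift_dist f (real q * t) \<le> ennreal ((real q)\<^sup>2) * shift_dist f t"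
proof -
  have tel: "f x - f (x - real q * t) = (\<Sum>i<q. f (x - real i * t) - f (x - real i * t - t))" for x
    by (induction q) (simp_all add: algebra_simps)
  have pt: "ennreal ((f x - f (x - real q * t))\<^sup>2)
      \<le> ennreal (real q) * (\<Sum>i<q. ennreal ((f (x - real i * t) - f (x - real i * t - t))\<^sup>2))" for x
  proof -
    have "(f x - f (x - real q * t))\<^sup>2 \<le> (\<Sum>i<q. (f (x - real i * t) - f (x - real i * t - t))\<^sup>2) * real (card {..<q})"
      unfolding tel by (rule sum_squared_le_sum_of_squares)
    then show ?thesis by (simp add: sum_ennreal ennreal_mult[symmetric] sum_nonneg mult.commute)
  qed
  have "shift_dist f (real q * t)
     \<le> (\<integral>\<^sup>+x. ennreal (real q) * (\<Sum>i<q. ennreal ((f (x - real i * t) - f (x - real i * t - t))\<^sup>2)) \<partial>lborel)"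
    unfolding shift_dist_def by (rule nn_integral_mono) (use pt in auto)
  also have "\<dots> = ennreal (real q) * (\<Sum>i<q. \<integral>\<^sup>+x. ennreal ((f (x - real i * t) - f (x - real i * t - t))\<^sup>2) \<partial>lborel)"
    by (simp add: nn_integral_cmult nn_integral_sum del: sum_ennreal)
  also have "\<dots> = ennreal (real q) * (\<Sum>i<q. shift_dist f t)"
    unfolding shift_dist_def
    by (subst nn_integral_lborel_shift[of "\<lambda>x. ennreal ((f x - f (x - t))\<^sup>2)"]) simp_all
  also have "\<dots> = ennreal ((real q)\<^sup>2) * shift_dist f t"
    by (simp add: power2_eq_square ennreal_mult mult.assoc ennreal_of_nat_eq_real_of_nat)
  finally show ?thesis .
qed

lemma shift_dist_uminus:
  assumes [measurable]: "f \<in> borel_measurable borel"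
  shows "shift_dist f (- t) = shift_dist f t"
proof -
  have "shift_dist f (- t) = (\<integral>\<^sup>+x. ennreal ((f (x - t) - f (x - t - (- t)))\<^sup>2) \<partial>lborel)"
    unfolding shift_dist_def
    by (subst nn_integral_lborel_shift[of "\<lambda>x. ennreal ((f x - f (x - - t))\<^sup>2)"]) simp_all
  also have "\<dots> = shift_dist f t"
    unfolding shift_dist_def by (simp add: power2_commute)
  finally show ?thesis .
qed

lemma mass_shift_le:
  assumes [measurable]: "f \<in> borel_measurable borel"
  shows "(\<integral>\<^sup>+x\<in>{c-1..c+1}. ennreal ((f x)\<^sup>2) \<partial>lborel)
    \<le> ennreal (9/8) * (\<integral>\<^sup>+x\<in>{c-t-1..c-t+1}. ennreal ((f x)\<^sup>2) \<partial>lborel) + 9 * shift_dist f t"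
proof -
  \<comment> \<open>Young's inequality
    \<open>(u + v)^2 \<le> (1 + 1/8) * u^2 + (1 + 8) * v^2\<close> with
    \<open>u = f (x - t)\<close>; the first factor has to be close to 1 for the mass comparison on
    three intervals.\<close>
  have pt: "(f x)\<^sup>2 \<le> 9/8 * (f (x - t))\<^sup>2 + 9 * (f x - f (x - t))\<^sup>2" for x
  proof -
    have "0 \<le> (f (x-t) - 8 * (f x - f (x - t)))\<^sup>2" by simp
    then show ?thesis by (simp add: power2_eq_square algebra_simps)
  qed
  have "(\<integral>\<^sup>+x\<in>{c-1..c+1}. ennreal ((f x)\<^sup>2) \<partial>lborel)
    \<le> (\<integral>\<^sup>+x. (ennreal (9/8) * (ennreal ((f (x - t))\<^sup>2) * indicator {c-t-1..c-t+1} (x - t)) + 9 * ennreal ((f x - f (x - t))\<^sup>2)) \<partial>lborel)"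
  proof (rule nn_integral_mono)
    fix x
    have "ennreal ((f x)\<^sup>2) \<le> ennreal (9/8 * (f (x - t))\<^sup>2 + 9 * (f x - f (x - t))\<^sup>2)"
      using pt[of x] by (rule ennreal_leI)
    also have "\<dots> = ennreal (9/8) * ennreal ((f (x - t))\<^sup>2) + 9 * ennreal ((f x - f (x - t))\<^sup>2)"
    proof -
      have "ennreal (9/8 * (f (x - t))\<^sup>2) = ennreal (9/8) * ennreal ((f (x - t))\<^sup>2)"
        "ennreal (9 * (f x - f (x - t))\<^sup>2) = 9 * ennreal ((f x - f (x - t))\<^sup>2)"
        by (subst ennreal_mult; simp)+
      then show ?thesis by (subst ennreal_plus) simp_all
    qed
    finally show "ennreal ((f x)\<^sup>2) * indicator {c-1..c+1} x
       \<le> ennreal (9/8) * (ennreal ((f (x - t))\<^sup>2) * indicator {c-t-1..c-t+1} (x - t)) + 9 * ennreal ((f x - f (x - t))\<^sup>2)"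
      by (auto split: split_indicator)
  qed
  also have "\<dots> = ennreal (9/8) * (\<integral>\<^sup>+x. ennreal ((f (x - t))\<^sup>2) * indicator {c-t-1..c-t+1} (x - t) \<partial>lborel) + 9 * shift_dist f t"
    unfolding shift_dist_def
    by (subst nn_integral_add) (simp_all add: nn_integral_cmult)
  also have "(\<integral>\<^sup>+x. ennreal ((f (x - t))\<^sup>2) * indicator {c-t-1..c-t+1} (x - t) \<partial>lborel)
     = (\<integral>\<^sup>+x\<in>{c-t-1..c-t+1}. ennreal ((f x)\<^sup>2) \<partial>lborel)"
    by (rule nn_integral_lborel_shift[of "\<lambda>x. ennreal ((f x)\<^sup>2) * indicator {c-t-1..c-t+1} x"]) simp
  finally show ?thesis .
qed

locale single_site = prob_space \<nu> for \<nu> :: "real measure" +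
  fixes R K :: real and A :: "real set"
  assumes sets_nu [measurable_cong]: "sets \<nu> = sets borel"
    and bounded_nu: "AE V in \<nu>. \<bar>V\<bar> \<le> R"
    and A_sets [measurable]: "A \<in> sets borel"
    and dominated: "\<And>B. B \<in> sets borel \<Longrightarrow> B \<subseteq> A \<Longrightarrow> emeasure \<nu> B \<le> ennreal K * emeasure lborel B"
    and A_pos: "measure \<nu> A > 0"
    and K_pos: "K > 0" and R_pos: "R > 0"
begin

section \<open>Convolution with the single-site distribution\<close>

sublocale pair_sigma_finite \<nu> lborel ..

text \<open>With \<open>p = measure \<nu> A\<close> and \<open>d = p / (4 * K)\<close>, an interval
  of length \<open>2 * d\<close> catches at most \<open>K * 2 * d = p / 2\<close> of the mass on
  \<open>A\<close>. So wherever \<open>V\<close> lies, at least \<open>p / 2\<close> of the mass is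
  at distance \<open>d\<close> or more from it.\<close>

lemma separated_pairs:
  obtains \<beta> d where "\<beta> > 0" "d > 0"
    "ennreal \<beta> \<le> (\<integral>\<^sup>+V. \<integral>\<^sup>+V'. indicator {t. \<bar>t\<bar> \<ge> d} (V' - V) \<partial>\<nu> \<partial>\<nu>)"
proof -
  define p where "p = measure \<nu> A"
  define d where "d = p / (4 * K)"
  have p: "p > 0" and d: "d > 0" using A_pos K_pos by (auto simp: p_def d_def)
  have Kd: "K * (2 * d) = p / 2" using K_pos by (simp add: d_def)
  have inner: "ennreal (p / 2) \<le> (\<integral>\<^sup>+V'. indicator {t. \<bar>t\<bar> \<ge> d} (V' - V) \<partial>\<nu>)" for V
  proof -
    have sub: "A \<subseteq> (A \<inter> {V-d..V+d}) \<union> {V'. \<bar>V' - V\<bar> \<ge> d}" by auto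
    have m[measurable]: "{V'. \<bar>V' - V\<bar> \<ge> d} \<in> sets borel" by measurable
    have "ennreal p = emeasure \<nu> A" by (simp add: p_def emeasure_eq_measure)
    also have "\<dots> \<le> emeasure \<nu> ((A \<inter> {V-d..V+d}) \<union> {V'. \<bar>V' - V\<bar> \<ge> d})"
      by (rule emeasure_mono[OF sub]) (simp add: sets_nu)
    also have "\<dots> \<le> emeasure \<nu> (A \<inter> {V-d..V+d}) + emeasure \<nu> {V'. \<bar>V' - V\<bar> \<ge> d}"
      by (rule emeasure_subadditive) (simp_all add: sets_nu)
    also have "emeasure \<nu> (A \<inter> {V-d..V+d}) \<le> ennreal K * emeasure lborel (A \<inter> {V-d..V+d})"
      by (rule dominated) auto
    also have "emeasure lborel (A \<inter> {V-d..V+d}) \<le> emeasure lborel {V-d..V+d}"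
      by (rule emeasure_mono) auto
    also have "ennreal K * emeasure lborel {V-d..V+d} = ennreal (p / 2)"
      using d K_pos unfolding Kd[symmetric] by (simp add: ennreal_mult)
    finally have "ennreal p \<le> ennreal (p / 2) + emeasure \<nu> {V'. \<bar>V' - V\<bar> \<ge> d}"
      by (simp add: mult_left_mono add_right_mono)
    then have "p \<le> p / 2 + measure \<nu> {V'. \<bar>V' - V\<bar> \<ge> d}"
      using p by (simp add: emeasure_eq_measure flip: ennreal_plus)
    then have "ennreal (p / 2) \<le> emeasure \<nu> {V'. \<bar>V' - V\<bar> \<ge> d}"
      by (simp add: emeasure_eq_measure)
    also have "\<dots> = (\<integral>\<^sup>+V'. indicator {V'. \<bar>V' - V\<bar> \<ge> d} V' \<partial>\<nu>)"
      by (simp add: sets_nu)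
    also have "\<dots> = (\<integral>\<^sup>+V'. indicator {t. \<bar>t\<bar> \<ge> d} (V' - V) \<partial>\<nu>)"
      by (intro nn_integral_cong) (auto split: split_indicator)
    finally show ?thesis .
  qed
  have "ennreal (p / 2) = (\<integral>\<^sup>+V. ennreal (p / 2) \<partial>\<nu>)" by (simp add: emeasure_space_1)
  also have "\<dots> \<le> (\<integral>\<^sup>+V. \<integral>\<^sup>+V'. indicator {t. \<bar>t\<bar> \<ge> d} (V' - V) \<partial>\<nu> \<partial>\<nu>)"
    by (intro nn_integral_mono inner)
  finally show thesis using that[of "p / 2" d] p d by auto
qed

definition avg :: "(real \<Rightarrow> real) \<Rightarrow> real \<Rightarrow> real" where
  "avg f y = (\<integral>V. f (y - V) \<partial>\<nu>)"

lemma avg_measurable [measurable]: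
  assumes [measurable]: "f \<in> borel_measurable borel"
  shows "avg f \<in> borel_measurable borel"
  unfolding avg_def by measurable

text \<open>The norm lost by averaging, in exact form: the variance identity for
  \<open>V \<mapsto> f (y - V)\<close>, integrated over \<open>y\<close>. By translation invariance
  the integrand depends on \<open>V\<close> and \<open>V'\<close> only through their
  difference.\<close>

lemma sq_norm_avg:
  assumes [measurable]: "f \<in> borel_measurable borel" and bd: "\<And>x. \<bar>f x\<bar> \<le> B"
  shows "(\<integral>\<^sup>+V. \<integral>\<^sup>+V'. shift_dist f (V' - V) \<partial>\<nu> \<partial>\<nu>) + 2 * sq_norm (avg f) = 2 * sq_norm f"
proof -
  have pt: "(\<integral>\<^sup>+V. \<integral>\<^sup>+V'. ennreal ((f (y - V) - f (y - V'))\<^sup>2) \<partial>\<nu> \<partial>\<nu>) + 2 * ennreal ((avg f y)\<^sup>2)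
     = 2 * (\<integral>\<^sup>+V. ennreal ((f (y - V))\<^sup>2) \<partial>\<nu>)" for y
    unfolding avg_def by (rule variance_nn_integral[where B=B]) (use bd in auto)
  have shift: "(\<integral>\<^sup>+y. ennreal ((f (y - V) - f (y - V'))\<^sup>2) \<partial>lborel) = shift_dist f (V' - V)" for V V'
    unfolding shift_dist_def
    using nn_integral_lborel_shift[of "\<lambda>y. ennreal ((f y - f (y - (V' - V)))\<^sup>2)" V] by simp
  have 1: "(\<integral>\<^sup>+y. \<integral>\<^sup>+V. \<integral>\<^sup>+V'. ennreal ((f (y - V) - f (y - V'))\<^sup>2) \<partial>\<nu> \<partial>\<nu> \<partial>lborel)
     = (\<integral>\<^sup>+V. \<integral>\<^sup>+V'. shift_dist f (V' - V) \<partial>\<nu> \<partial>\<nu>)"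
  proof -
    have "(\<integral>\<^sup>+y. \<integral>\<^sup>+V. \<integral>\<^sup>+V'. ennreal ((f (y - V) - f (y - V'))\<^sup>2) \<partial>\<nu> \<partial>\<nu> \<partial>lborel)
      = (\<integral>\<^sup>+V. \<integral>\<^sup>+y. \<integral>\<^sup>+V'. ennreal ((f (y - V) - f (y - V'))\<^sup>2) \<partial>\<nu> \<partial>lborel \<partial>\<nu>)"
      by (rule Fubini') measurable
    also have "\<dots> = (\<integral>\<^sup>+V. \<integral>\<^sup>+V'. \<integral>\<^sup>+y. ennreal ((f (y - V) - f (y - V'))\<^sup>2) \<partial>lborel \<partial>\<nu> \<partial>\<nu>)"
      by (intro nn_integral_cong Fubini') measurable
    finally show ?thesis by (simp add: shift)
  qed
  have 2: "(\<integral>\<^sup>+y. \<integral>\<^sup>+V. ennreal ((f (y - V))\<^sup>2) \<partial>\<nu> \<partial>lborel) = sq_norm f"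
  proof -
    have "(\<integral>\<^sup>+y. \<integral>\<^sup>+V. ennreal ((f (y - V))\<^sup>2) \<partial>\<nu> \<partial>lborel) = (\<integral>\<^sup>+V. \<integral>\<^sup>+y. ennreal ((f (y - V))\<^sup>2) \<partial>lborel \<partial>\<nu>)"
      by (rule Fubini') measurable
    also have "\<dots> = (\<integral>\<^sup>+V. sq_norm f \<partial>\<nu>)"
      unfolding sq_norm_def by (intro nn_integral_cong nn_integral_lborel_shift[of "\<lambda>x. ennreal ((f x)\<^sup>2)"]) simp
    finally show ?thesis by (simp add: emeasure_space_1)
  qed
  have "(\<integral>\<^sup>+y. ((\<integral>\<^sup>+V. \<integral>\<^sup>+V'. ennreal ((f (y - V) - f (y - V'))\<^sup>2) \<partial>\<nu> \<partial>\<nu>) + 2 * ennreal ((avg f y)\<^sup>2)) \<partial>lborel)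
    = (\<integral>\<^sup>+V. \<integral>\<^sup>+V'. shift_dist f (V' - V) \<partial>\<nu> \<partial>\<nu>) + 2 * sq_norm (avg f)"
    unfolding sq_norm_def 1[symmetric] by (subst nn_integral_add) (simp_all add: nn_integral_cmult)
  moreover have "(\<integral>\<^sup>+y. 2 * (\<integral>\<^sup>+V. ennreal ((f (y - V))\<^sup>2) \<partial>\<nu>) \<partial>lborel) = 2 * sq_norm f"
    unfolding 2[symmetric] by (rule nn_integral_cmult) measurable
  ultimately show ?thesis unfolding pt by simp
qed

lemma sq_norm_avg_le:
  assumes "f \<in> borel_measurable borel" and "\<And>x. \<bar>f x\<bar> \<le> B"
  shows "sq_norm (avg f) \<le> sq_norm f"
proof -
  have "2 * sq_norm (avg f) \<le> 2 * sq_norm f"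
    unfolding sq_norm_avg[OF assms, symmetric] by simp
  then show ?thesis by (simp add: ennreal_mult_le_mult_iff)
qed

text \<open>If averaging hardly decreases the norm of \<open>f\<close>, then some translation by at least \<open>d\<close> hardly
  moves \<open>f\<close>, and after iteration \<open>f\<close> has nearly equal mass on three disjoint intervals.\<close>

lemma spread_of_nearly_invariant:
  obtains \<epsilon> where "0 < \<epsilon>" "\<epsilon> \<le> 1/10"
    "\<And>f B c. f \<in> borel_measurable borel \<Longrightarrow> (\<And>x. \<bar>f x\<bar> \<le> B) \<Longrightarrow> sq_norm f < \<infinity> \<Longrightarrow>
       ennreal (1 - \<epsilon>) * sq_norm f \<le> sq_norm (avg f) \<Longrightarrow>
       (\<integral>\<^sup>+x\<in>{c-1..c+1}. ennreal ((f x)\<^sup>2) \<partial>lborel) \<le> ennreal (2/5) * sq_norm f"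
proof -
  obtain \<beta> d where \<beta>: "\<beta> > 0" and d: "d > 0" and sep:
    "ennreal \<beta> \<le> (\<integral>\<^sup>+V. \<integral>\<^sup>+V'. indicator {t. \<bar>t\<bar> \<ge> d} (V' - V) \<partial>\<nu> \<partial>\<nu>)"
    by (rule separated_pairs)
  \<comment> \<open>A translation by at least \<open>d\<close>, repeated \<open>q\<close> times,
    exceeds 2; the intervals of radius 1 about \<open>c\<close>, \<open>c - T\<close> and
    \<open>c + T\<close> are then disjoint.\<close>
  obtain q :: nat where q: "real q > 2 / d" using reals_Archimedean2 by blast
  then have q0: "real q > 0" using d by (meson divide_pos_pos less_trans zero_less_numeral)
  \<comment> \<open>After amplification by \<open>q^2\<close> the displacement is at most
    \<open>n / 160\<close>, so the error \<open>9 * e\<close> in the mass comparison is at most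
    \<open>9 * n / 160\<close>.\<close>
  define \<eta> where "\<eta> = 1 / (160 * (real q)\<^sup>2)"
  have \<eta>: "\<eta> > 0" and q\<eta>: "(real q)\<^sup>2 * \<eta> = 1/160" using q0 by (auto simp: \<eta>_def)
  \<comment> \<open>If all translations by at least \<open>d\<close> displaced \<open>f\<close> by
    more than \<eta>, averaging would lose at least \<open>\<eta> * \<beta> / 2\<close> of the
    squared norm, twice what the second bound allows. The bound \<open>1/10\<close> serves the
    two-step contraction.\<close>
  define \<epsilon> where "\<epsilon> = min (1/10) (\<eta> * \<beta> / 4)"
  have \<epsilon>: "\<epsilon> > 0" "\<epsilon> \<le> 1/10" "\<epsilon> \<le> \<eta> * \<beta> / 4" using \<eta> \<beta> by (auto simp: \<epsilon>_def)
  show thesis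
  proof (rule that[OF \<epsilon>(1,2)])
    fix f B c
    assume [measurable]: "f \<in> borel_measurable borel" and bd: "\<And>x. \<bar>f x\<bar> \<le> B"
      and fin: "sq_norm f < \<infinity>" and near: "ennreal (1 - \<epsilon>) * sq_norm f \<le> sq_norm (avg f)"
    define m where "m c = (\<integral>\<^sup>+x\<in>{c-1..c+1}. ennreal ((f x)\<^sup>2) \<partial>lborel)" for c
    obtain n where n: "sq_norm f = ennreal n" "n \<ge> 0" using fin by (cases "sq_norm f") auto
    have m_le: "m c \<le> sq_norm f" for c
      unfolding m_def sq_norm_def by (rule nn_integral_mono) (auto split: split_indicator)
    show "m c \<le> ennreal (2/5) * sq_norm f"
    proof (cases "n = 0")
      case True
      then show ?thesis using m_le[of c] n by simp
    next
      case False
      then have n0: "n > 0" using n by simp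
      obtain a where a: "sq_norm (avg f) = ennreal a" "a \<ge> 0"
        using sq_norm_avg_le[of f B] bd n by (cases "sq_norm (avg f)") (auto simp: top_unique)
      have a_ge: "(1 - \<epsilon>) * n \<le> a"
        using near \<epsilon> a n by (simp add: ennreal_mult[symmetric])
      have tot: "(\<integral>\<^sup>+V. \<integral>\<^sup>+V'. shift_dist f (V' - V) \<partial>\<nu> \<partial>\<nu>) + ennreal (2 * a) = ennreal (2 * n)"
        using sq_norm_avg[of f B] bd a n by (simp add: ennreal_mult)
      have ex: "\<exists>t. \<bar>t\<bar> \<ge> d \<and> shift_dist f t \<le> ennreal (\<eta> * n)"
      proof (rule ccontr)
        assume "\<not> ?thesis"
        then have big: "\<bar>t\<bar> \<ge> d \<Longrightarrow> ennreal (\<eta> * n) \<le> shift_dist f t" for t by (meson not_le less_imp_le)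
        have "ennreal (\<eta> * n) * ennreal \<beta> \<le> ennreal (\<eta> * n) * (\<integral>\<^sup>+V. \<integral>\<^sup>+V'. indicator {t. \<bar>t\<bar> \<ge> d} (V' - V) \<partial>\<nu> \<partial>\<nu>)"
          by (rule mult_left_mono[OF sep]) simp
        also have "\<dots> = (\<integral>\<^sup>+V. \<integral>\<^sup>+V'. ennreal (\<eta> * n) * indicator {t. \<bar>t\<bar> \<ge> d} (V' - V) \<partial>\<nu> \<partial>\<nu>)"
          by (simp add: nn_integral_cmult)
        also have "\<dots> \<le> (\<integral>\<^sup>+V. \<integral>\<^sup>+V'. shift_dist f (V' - V) \<partial>\<nu> \<partial>\<nu>)"
          by (intro nn_integral_mono) (auto split: split_indicator simp: big)
        finally have "ennreal (\<eta> * n * \<beta>) + ennreal (2 * a) \<le> ennreal (2 * n)"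
          unfolding tot[symmetric] using \<eta> n0 \<beta> by (simp add: ennreal_mult)
        then have "\<eta> * n * \<beta> + 2 * a \<le> 2 * n"
          using \<eta> n0 \<beta> a by (simp flip: ennreal_plus)
        then have "\<eta> * n * \<beta> \<le> 2 * (\<epsilon> * n)" using a_ge by (simp add: algebra_simps)
        also have "\<dots> \<le> 2 * (\<eta> * \<beta> / 4 * n)" using \<epsilon> n0 by (intro mult_left_mono mult_right_mono) auto
        finally show False using \<eta> n0 \<beta> by simp
      qed
      then obtain t where t: "\<bar>t\<bar> \<ge> d" "shift_dist f t \<le> ennreal (\<eta> * n)" by blast
      define T where "T = real q * t"
      have T: "\<bar>T\<bar> > 2"
      proof -
        have "2 < real q * d" using q d by (simp add: field_simps)
        also have "\<dots> \<le> \<bar>T\<bar>" using t q0 by (simp add: T_def abs_mult)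
        finally show ?thesis .
      qed
      have sT: "shift_dist f T \<le> ennreal (n / 160)"
      proof -
        have "shift_dist f T \<le> ennreal ((real q)\<^sup>2) * ennreal (\<eta> * n)"
          unfolding T_def by (rule order_trans[OF shift_dist_mult mult_left_mono]) (use t in auto)
        also have "\<dots> = ennreal ((real q)\<^sup>2 * \<eta> * n)" using \<eta> n0 by (simp add: ennreal_mult[symmetric] mult.assoc)
        finally show ?thesis unfolding q\<eta> by simp
      qed
      obtain m0 where m0: "m c = ennreal m0" "m0 \<ge> 0" using m_le[of c] n by (cases "m c") (auto simp: top_unique)
      obtain m1 where m1: "m (c - T) = ennreal m1" "m1 \<ge> 0" using m_le[of "c-T"] n by (cases "m (c-T)") (auto simp: top_unique)
      obtain m2 where m2: "m (c + T) = ennreal m2" "m2 \<ge> 0" using m_le[of "c+T"] n by (cases "m (c+T)") (auto simp: top_unique)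
      obtain e where e: "shift_dist f T = ennreal e" "e \<ge> 0" "e \<le> n / 160"
        using sT n0 by (cases "shift_dist f T") (auto simp: top_unique)
      have le1: "m0 \<le> 9/8 * m1 + 9 * e"
        using mass_shift_le[of f c T] unfolding m_def[symmetric] m0 m1 e
        using m0 m1 e by (simp add: ennreal_mult[symmetric] ennreal_mult'[symmetric] flip: ennreal_plus ennreal_numeral)
      have le2: "m0 \<le> 9/8 * m2 + 9 * e"
        using mass_shift_le[of f c "- T"] unfolding shift_dist_uminus[of f, simplified]
        using m0 m2 e unfolding m_def by (simp add: ennreal_mult[symmetric] ennreal_mult'[symmetric] flip: ennreal_plus ennreal_numeral)
      have "m c + m (c - T) + m (c + T) = (\<integral>\<^sup>+x. ennreal ((f x)\<^sup>2) * indicator {c-1..c+1} x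
          + ennreal ((f x)\<^sup>2) * indicator {c-T-1..c-T+1} x + ennreal ((f x)\<^sup>2) * indicator {c+T-1..c+T+1} x \<partial>lborel)"
        unfolding m_def by (simp add: nn_integral_add)
      also have "\<dots> \<le> sq_norm f" unfolding sq_norm_def
        by (rule nn_integral_mono) (use T in \<open>auto split: split_indicator\<close>)
      finally have "m0 + m1 + m2 \<le> n" unfolding m0 m1 m2 n using m0 m1 m2 n by (simp flip: ennreal_plus)
      \<comment> \<open>Each neighbouring interval has mass at least
        \<open>8/9 * m0 - n / 20\<close>. Hence \<open>25/9 * m0 \<le> 11/10 * n\<close>, and
        \<open>99/250 < 2/5\<close>.\<close>
      then have "m0 \<le> 2/5 * n" using le1 le2 e by linarith
      then show ?thesis unfolding m0 n using n by (simp add: ennreal_mult[symmetric])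
    qed
  qed
qed

end

section \<open>The transfer operator on homogeneous functions\<close>

text \<open>The transfer matrix, of determinant 1, which takes
  \<open>(\<psi> n, \<psi> (n - 1))\<close> to \<open>(\<psi> (n + 1), \<psi> n)\<close>.\<close>

definition tm :: "real \<Rightarrow> real \<Rightarrow> real \<times> real \<Rightarrow> real \<times> real" where
  "tm E V v = ((E - V) * fst v - snd v, fst v)"

lemma borel_measurable_fst_snd [measurable (raw)]:
  fixes h :: "'a \<Rightarrow> real \<times> real"
  assumes "h \<in> borel_measurable M"
  shows "(\<lambda>x. fst (h x)) \<in> borel_measurable M" "(\<lambda>x. snd (h x)) \<in> borel_measurable M"
  by (rule measurable_compose[OF assms borel_measurable_continuous_onI]; intro continuous_intros)+

lemma tm_measurable [measurable (raw)]:
  assumes [measurable]: "f \<in> borel_measurable M" "g \<in> borel_measurable M" "h \<in> borel_measurable M"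
  shows "(\<lambda>x. tm (f x) (g x) (h x)) \<in> borel_measurable M"
  unfolding tm_def by (intro borel_measurable_Pair) measurable

lemma tm_scaleR: "tm E V (c *\<^sub>R v) = c *\<^sub>R tm E V v"
  by (simp add: tm_def algebra_simps)

lemma tm_eq_0_iff [simp]: "tm E V v = 0 \<longleftrightarrow> v = 0"
  by (auto simp: tm_def zero_prod_def prod_eq_iff)

lemma norm_le_norm_tm: "norm v \<le> (2 + \<bar>E - V\<bar>) * norm (tm E V v)"
proof -
  define w where "w = tm E V v"
  have v: "v = (snd w, (E - V) * snd w - fst w)"
    by (cases v) (simp add: w_def tm_def)
  have "norm v \<le> norm (snd w) + norm ((E - V) * snd w - fst w)"
    by (subst v) (rule norm_Pair_le)
  also have "\<dots> \<le> \<bar>snd w\<bar> + (\<bar>E - V\<bar> * \<bar>snd w\<bar> + \<bar>fst w\<bar>)"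
    by (simp add: abs_mult[symmetric])
  also have "\<dots> \<le> norm w + (\<bar>E - V\<bar> * norm w + norm w)"
    using norm_fst_le[of "fst w" "snd w"] norm_snd_le[of "snd w" "fst w"]
    by (intro add_mono mult_left_mono) auto
  finally show ?thesis by (simp add: w_def algebra_simps)
qed

context single_site
begin

definition transfer :: "real \<Rightarrow> (real \<times> real \<Rightarrow> ennreal) \<Rightarrow> real \<times> real \<Rightarrow> ennreal" where
  "transfer E F v = (\<integral>\<^sup>+V. F (tm E V v) \<partial>\<nu>)"

lemma transfer_measurable [measurable]:
  assumes [measurable]: "F \<in> borel_measurable borel"
  shows "transfer E F \<in> borel_measurable borel"
  unfolding transfer_def by measurable

text \<open>On functions that are homogeneous of degree \<open>-1\<close>, \<open>F \<mapsto> F (x, 1)\<close> is the projective coordinate in which area-preserving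
  linear maps act isometrically on \<open>L\<^sup>2(\<real>)\<close>.\<close>

definition hom1 :: "(real \<times> real \<Rightarrow> ennreal) \<Rightarrow> bool" where
  "hom1 F \<longleftrightarrow> F \<in> borel_measurable borel \<and> (\<forall>c v. c \<noteq> 0 \<longrightarrow> F (c *\<^sub>R v) = ennreal (1 / \<bar>c\<bar>) * F v)
     \<and> (\<exists>C\<ge>0. \<forall>v. v \<noteq> 0 \<longrightarrow> F v \<le> ennreal (C / norm v))"

definition hom_sq :: "(real \<times> real \<Rightarrow> ennreal) \<Rightarrow> ennreal" where
  "hom_sq F = (\<integral>\<^sup>+x. (F (x, 1))\<^sup>2 \<partial>lborel)"

lemma hom1_transfer:
  assumes "hom1 F"
  shows "hom1 (transfer E F)"
proof -
  obtain C where [measurable]: "F \<in> borel_measurable borel"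
    and h: "\<And>c v. c \<noteq> 0 \<Longrightarrow> F (c *\<^sub>R v) = ennreal (1 / \<bar>c\<bar>) * F v"
    and C: "C \<ge> 0" "\<And>v. v \<noteq> 0 \<Longrightarrow> F v \<le> ennreal (C / norm v)"
    using assms unfolding hom1_def by blast
  have "transfer E F (c *\<^sub>R v) = ennreal (1 / \<bar>c\<bar>) * transfer E F v" if "c \<noteq> 0" for c v
    unfolding transfer_def tm_scaleR h[OF that] by (rule nn_integral_cmult) measurable
  moreover have "transfer E F v \<le> ennreal (C * (2 + \<bar>E\<bar> + R) / norm v)" if v: "v \<noteq> 0" for v
  proof -
    have "transfer E F v \<le> (\<integral>\<^sup>+V. ennreal (C * (2 + \<bar>E\<bar> + R) / norm v) \<partial>\<nu>)"
      unfolding transfer_def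
    proof (rule nn_integral_mono_AE)
      show "AE V in \<nu>. F (tm E V v) \<le> ennreal (C * (2 + \<bar>E\<bar> + R) / norm v)"
        using bounded_nu
      proof eventually_elim
        fix V assume V: "\<bar>V\<bar> \<le> R"
        have n0: "norm v > 0" "norm (tm E V v) > 0" using v by auto
        have "norm v \<le> (2 + \<bar>E - V\<bar>) * norm (tm E V v)" by (rule norm_le_norm_tm)
        also have "\<dots> \<le> (2 + \<bar>E\<bar> + R) * norm (tm E V v)" using V by (intro mult_right_mono) auto
        finally have "1 / norm (tm E V v) \<le> (2 + \<bar>E\<bar> + R) / norm v"
          using n0 by (simp add: field_simps)
        then have "C * (1 / norm (tm E V v)) \<le> C * ((2 + \<bar>E\<bar> + R) / norm v)"
          using C(1) by (rule mult_left_mono)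
        then have "ennreal (C / norm (tm E V v)) \<le> ennreal (C * (2 + \<bar>E\<bar> + R) / norm v)"
          by (intro ennreal_leI) simp
        then show "F (tm E V v) \<le> ennreal (C * (2 + \<bar>E\<bar> + R) / norm v)"
          using C(2)[of "tm E V v"] v by (auto intro: order_trans)
      qed
    qed
    then show ?thesis by (simp add: emeasure_space_1)
  qed
  moreover have "C * (2 + \<bar>E\<bar> + R) \<ge> 0" using C R_pos by simp
  ultimately show ?thesis unfolding hom1_def by (intro conjI) (measurable, blast+)
qed

lemma hom1_section:
  assumes "hom1 F"
  obtains f B where "f \<in> borel_measurable borel" "\<And>x. \<bar>f x\<bar> \<le> B" "\<And>x. f x \<ge> 0" "\<And>x. F (x, 1) = ennreal (f x)"
proof -
  obtain C where [measurable]: "F \<in> borel_measurable borel"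
    and C: "C \<ge> 0" "\<And>v. v \<noteq> 0 \<Longrightarrow> F v \<le> ennreal (C / norm v)"
    using assms unfolding hom1_def by blast
  have le: "F (x, 1) \<le> ennreal C" for x
  proof -
    have nz: "(x, 1) \<noteq> (0 :: real \<times> real)" by (simp add: zero_prod_def)
    have "1 \<le> norm (x, 1 :: real)" using norm_snd_le[of "1::real" x] by simp
    then have "C / norm (x, 1 :: real) \<le> C / 1" using C by (intro divide_left_mono) auto
    then have "C / norm (x, 1 :: real) \<le> C" by simp
    then show ?thesis using C(2)[OF nz] by (meson ennreal_leI order_trans)
  qed
  then have fin: "F (x, 1) < \<infinity>" for x by (metis ennreal_less_top infinity_ennreal_def le_less_trans)
  show thesis
  proof (rule that[of "\<lambda>x. enn2real (F (x, 1))" C])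
    show "\<bar>enn2real (F (x, 1))\<bar> \<le> C" for x using le[of x] C fin[of x]
      by (simp add: enn2real_leI)
    have [measurable]: "(\<lambda>x::real. (x, 1::real)) \<in> borel_measurable borel"
      by (intro borel_measurable_Pair) auto
    show "(\<lambda>x. enn2real (F (x, 1))) \<in> borel_measurable borel" by measurable
  qed (use fin in auto)
qed

lemma hom_sq_section:
  assumes "\<And>x. F (x, 1) = ennreal (f x)" "\<And>x. f x \<ge> 0"
  shows "hom_sq F = sq_norm f"
  unfolding hom_sq_def sq_norm_def using assms by (simp add: ennreal_power)

text \<open>In the coordinate \<open>x\<close> the step acts as
  \<open>x \<mapsto> E - V - 1 / x\<close>, and homogeneity contributes
  \<open>1 / \<bar>x\<bar>\<close>, the square root of the Jacobian of
  \<open>x \<mapsto> - 1 / x\<close>. The set \<open>S\<close> allows mass, and not only the total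
  norm, to be followed through the inversion.\<close>

lemma transfer_section:
  assumes hF: "hom1 F" and [measurable]: "f \<in> borel_measurable borel" and bd: "\<And>x. \<bar>f x\<bar> \<le> B"
    and f0: "\<And>x. f x \<ge> 0" and f: "\<And>x. F (x, 1) = ennreal (f x)" and [measurable]: "S \<in> sets borel"
  shows "(\<integral>\<^sup>+x. (transfer E F (x, 1))\<^sup>2 * indicator S (- 1 / x) \<partial>lborel)
     = (\<integral>\<^sup>+y. ennreal ((avg f (E + y))\<^sup>2) * indicator S y \<partial>lborel)"
proof -
  have h: "F (c *\<^sub>R v) = ennreal (1 / \<bar>c\<bar>) * F v" if "c \<noteq> 0" for c v
    using hF that unfolding hom1_def by blast
  have tr: "transfer E F (x, 1) = ennreal (1 / \<bar>x\<bar>) * ennreal (avg f (E + - 1 / x))" if x: "x \<noteq> 0" for x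
  proof -
    have "F (tm E V (x, 1)) = ennreal (1 / \<bar>x\<bar>) * ennreal (f (E + - 1 / x - V))" for V
    proof -
      have "tm E V (x, 1) = x *\<^sub>R (E + - 1 / x - V, 1)" using x by (simp add: tm_def field_simps)
      then show ?thesis using h[OF x, of "(E + - 1 / x - V, 1)"] f by simp
    qed
    then have "transfer E F (x, 1) = ennreal (1 / \<bar>x\<bar>) * (\<integral>\<^sup>+V. ennreal (f (E + - 1 / x - V)) \<partial>\<nu>)"
      unfolding transfer_def by (simp add: nn_integral_cmult)
    also have "(\<integral>\<^sup>+V. ennreal (f (E + - 1 / x - V)) \<partial>\<nu>) = ennreal (avg f (E + - 1 / x))"
      unfolding avg_def
      by (intro nn_integral_eq_integral integrable_const_bound[where B=B]) (use bd f0 in auto)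
    finally show ?thesis .
  qed
  have av0: "avg f y \<ge> 0" for y unfolding avg_def by (intro integral_nonneg_AE AE_I2 f0)
  have "(\<integral>\<^sup>+x. (transfer E F (x, 1))\<^sup>2 * indicator S (- 1 / x) \<partial>lborel)
     = (\<integral>\<^sup>+x. ennreal (1 / x\<^sup>2) * (ennreal ((avg f (E + - 1 / x))\<^sup>2) * indicator S (- 1 / x)) \<partial>lborel)"
  proof (rule nn_integral_cong_AE, rule AE_I[where N="{0}"])
    show "{x \<in> space lborel. (transfer E F (x, 1))\<^sup>2 * indicator S (- 1 / x) \<noteq>
       ennreal (1 / x\<^sup>2) * (ennreal ((avg f (E + - 1 / x))\<^sup>2) * indicator S (- 1 / x))} \<subseteq> {0}"
    proof safe
      fix x assume "(transfer E F (x, 1))\<^sup>2 * indicator S (- 1 / x) \<noteq>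
         ennreal (1 / x\<^sup>2) * (ennreal ((avg f (E + - 1 / x))\<^sup>2) * indicator S (- 1 / x))"
      then show "x = 0"
      proof (rule contrapos_np)
        assume x: "x \<noteq> 0"
        have "(transfer E F (x, 1))\<^sup>2 = ennreal ((1 / \<bar>x\<bar> * avg f (E + - 1 / x))\<^sup>2)"
          unfolding tr[OF x] using av0 by (simp add: ennreal_mult[symmetric] ennreal_power)
        also have "(1 / \<bar>x\<bar> * avg f (E + - 1 / x))\<^sup>2 = 1 / x\<^sup>2 * (avg f (E + - 1 / x))\<^sup>2"
          unfolding power_mult_distrib power_divide by simp
        finally have e: "(transfer E F (x, 1))\<^sup>2 = ennreal (1 / x\<^sup>2 * (avg f (E + - 1 / x))\<^sup>2)" .
        show "(transfer E F (x, 1))\<^sup>2 * indicator S (- 1 / x) =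
         ennreal (1 / x\<^sup>2) * (ennreal ((avg f (E + - 1 / x))\<^sup>2) * indicator S (- 1 / x))"
          unfolding e by (subst ennreal_mult) (simp_all only: mult.assoc zero_le_power2 zero_le_divide_1_iff)
      qed
    qed
  qed auto
  also have "\<dots> = (\<integral>\<^sup>+y. ennreal ((avg f (E + y))\<^sup>2) * indicator S y \<partial>lborel)"
    by (rule nn_integral_neg_inverse[of "\<lambda>y. ennreal ((avg f (E + y))\<^sup>2) * indicator S y"]) measurable
  finally show ?thesis .
qed

lemma hom_sq_transfer:
  assumes "hom1 F" and [measurable]: "f \<in> borel_measurable borel" and "\<And>x. \<bar>f x\<bar> \<le> B"
    and "\<And>x. f x \<ge> 0" and "\<And>x. F (x, 1) = ennreal (f x)"
  shows "hom_sq (transfer E F) = sq_norm (avg f)"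
proof -
  have "hom_sq (transfer E F) = (\<integral>\<^sup>+y. ennreal ((avg f (E + y))\<^sup>2) \<partial>lborel)"
    using transfer_section[OF assms, of UNIV E] by (simp add: hom_sq_def)
  also have "\<dots> = sq_norm (avg f)"
    unfolding sq_norm_def using nn_integral_lborel_shift[of "\<lambda>y. ennreal ((avg f y)\<^sup>2)" "- E"]
    by (simp add: add.commute)
  finally show ?thesis .
qed

lemma hom_sq_transfer_le:
  assumes "hom1 F"
  shows "hom_sq (transfer E F) \<le> hom_sq F"
proof -
  obtain f B where f: "f \<in> borel_measurable borel" "\<And>x. \<bar>f x\<bar> \<le> B" "\<And>x. f x \<ge> 0"
    "\<And>x. F (x, 1) = ennreal (f x)"
    using hom1_section[OF assms] by metis
  have "hom_sq (transfer E F) = sq_norm (avg f)" by (rule hom_sq_transfer[OF assms f])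
  moreover have "hom_sq F = sq_norm f" using f(4,3) by (rule hom_sq_section)
  ultimately show ?thesis using sq_norm_avg_le[OF f(1,2)] by simp
qed

text \<open>By Jensen's inequality, the mass of the average in a window is at most the \<nu>-mean of
  the masses of \<open>f\<close> in translated windows; this is why the hypothesis ranges over all
  centres.\<close>

lemma mass_avg_le:
  assumes [measurable]: "f \<in> borel_measurable borel" and bd: "\<And>x. \<bar>f x\<bar> \<le> B"
    and m: "\<And>c. (\<integral>\<^sup>+x\<in>{c-1..c+1}. ennreal ((f x)\<^sup>2) \<partial>lborel) \<le> m"
  shows "(\<integral>\<^sup>+x\<in>{c-1..c+1}. ennreal ((avg f x)\<^sup>2) \<partial>lborel) \<le> m"
proof -
  have jensen: "ennreal ((avg f y)\<^sup>2) \<le> (\<integral>\<^sup>+V. ennreal ((f (y - V))\<^sup>2) \<partial>\<nu>)" for y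
  proof -
    have "(\<integral>\<^sup>+V. \<integral>\<^sup>+V'. ennreal ((f (y - V) - f (y - V'))\<^sup>2) \<partial>\<nu> \<partial>\<nu>) + 2 * ennreal ((avg f y)\<^sup>2)
      = 2 * (\<integral>\<^sup>+V. ennreal ((f (y - V))\<^sup>2) \<partial>\<nu>)"
      unfolding avg_def by (rule variance_nn_integral[where B=B]) (use bd in auto)
    from this[symmetric] have "2 * ennreal ((avg f y)\<^sup>2) \<le> 2 * (\<integral>\<^sup>+V. ennreal ((f (y - V))\<^sup>2) \<partial>\<nu>)"
      by (simp add: add_increasing)
    then show ?thesis by (simp add: ennreal_mult_le_mult_iff)
  qed
  have "(\<integral>\<^sup>+x\<in>{c-1..c+1}. ennreal ((avg f x)\<^sup>2) \<partial>lborel)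
     \<le> (\<integral>\<^sup>+x. (\<integral>\<^sup>+V. ennreal ((f (x - V))\<^sup>2) * indicator {c-V-1..c-V+1} (x - V) \<partial>\<nu>) \<partial>lborel)"
  proof (rule nn_integral_mono)
    fix x
    have "(\<integral>\<^sup>+V. ennreal ((f (x - V))\<^sup>2) * indicator {c-V-1..c-V+1} (x - V) \<partial>\<nu>)
       = (\<integral>\<^sup>+V. ennreal ((f (x - V))\<^sup>2) * indicator {c-1..c+1} x \<partial>\<nu>)"
      by (intro nn_integral_cong) (auto split: split_indicator)
    also have "\<dots> = (\<integral>\<^sup>+V. ennreal ((f (x - V))\<^sup>2) \<partial>\<nu>) * indicator {c-1..c+1} x"
      by (rule nn_integral_multc) measurable
    finally show "ennreal ((avg f x)\<^sup>2) * indicator {c-1..c+1} x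
      \<le> (\<integral>\<^sup>+V. ennreal ((f (x - V))\<^sup>2) * indicator {c-V-1..c-V+1} (x - V) \<partial>\<nu>)"
      using mult_right_mono[OF jensen[of x]] by simp
  qed
  also have "\<dots> = (\<integral>\<^sup>+V. (\<integral>\<^sup>+x. ennreal ((f (x - V))\<^sup>2) * indicator {c-V-1..c-V+1} (x - V) \<partial>lborel) \<partial>\<nu>)"
  proof (rule Fubini')
    have "(\<lambda>(V, x). ennreal ((f (x - V))\<^sup>2) * indicator {c-1..c+1} x) \<in> borel_measurable (\<nu> \<Otimes>\<^sub>M lborel)"
      by measurable
    also have "(\<lambda>(V, x). ennreal ((f (x - V))\<^sup>2) * indicator {c-1..c+1} x)
       = (\<lambda>(V, x). ennreal ((f (x - V))\<^sup>2) * indicator {c-V-1..c-V+1} (x - V))"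
      by (auto split: split_indicator)
    finally show "(\<lambda>(V, x). ennreal ((f (x - V))\<^sup>2) * indicator {c-V-1..c-V+1} (x - V)) \<in> borel_measurable (\<nu> \<Otimes>\<^sub>M lborel)" .
  qed
  also have "\<dots> \<le> (\<integral>\<^sup>+V. m \<partial>\<nu>)"
  proof (rule nn_integral_mono)
    fix V
    have "(\<integral>\<^sup>+x. ennreal ((f (x - V))\<^sup>2) * indicator {c-V-1..c-V+1} (x - V) \<partial>lborel)
      = (\<integral>\<^sup>+x\<in>{c-V-1..c-V+1}. ennreal ((f x)\<^sup>2) \<partial>lborel)"
      by (rule nn_integral_lborel_shift[of "\<lambda>x. ennreal ((f x)\<^sup>2) * indicator {c-V-1..c-V+1} x"]) measurable
    then show "(\<integral>\<^sup>+x. ennreal ((f (x - V))\<^sup>2) * indicator {c-V-1..c-V+1} (x - V) \<partial>lborel) \<le> m"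
      using m[of "c - V"] by simp
  qed
  also have "\<dots> = m" by (simp add: emeasure_space_1)
  finally show ?thesis .
qed

text \<open>Two consecutive steps cannot both be nearly isometric: the first one forces \<open>F\<close> to have little mass
  near any point, so that after the inversion most of the mass sits in \<open>[-1, 1]\<close>.\<close>

lemma two_step_contraction:
  obtains \<epsilon> where "0 < \<epsilon>" "\<epsilon> < 1"
    "\<And>F E. hom1 F \<Longrightarrow> hom_sq F < \<infinity> \<Longrightarrow> hom_sq (transfer E (transfer E F)) \<le> ennreal (1 - \<epsilon>) * hom_sq F"
proof -
  obtain \<epsilon> where \<epsilon>: "0 < \<epsilon>" "\<epsilon> \<le> 1/10" and spread:
    "\<And>f B c. f \<in> borel_measurable borel \<Longrightarrow> (\<And>x. \<bar>f x\<bar> \<le> B) \<Longrightarrow> sq_norm f < \<infinity> \<Longrightarrow>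
       ennreal (1 - \<epsilon>) * sq_norm f \<le> sq_norm (avg f) \<Longrightarrow>
       (\<integral>\<^sup>+x\<in>{c-1..c+1}. ennreal ((f x)\<^sup>2) \<partial>lborel) \<le> ennreal (2/5) * sq_norm f"
    by (rule spread_of_nearly_invariant) blast
  show thesis
  proof (rule that[of \<epsilon>])
    fix F E assume F: "hom1 F" and fin: "hom_sq F < \<infinity>"
    obtain f B where f[measurable]: "f \<in> borel_measurable borel" and fB: "\<And>x. \<bar>f x\<bar> \<le> B"
      and f0: "\<And>x. f x \<ge> 0" and fF: "\<And>x. F (x, 1) = ennreal (f x)"
      using hom1_section[OF F] by metis
    define G where "G = transfer E F"
    have G: "hom1 G" unfolding G_def by (rule hom1_transfer[OF F])
    obtain g B' where g[measurable]: "g \<in> borel_measurable borel" and gB: "\<And>x. \<bar>g x\<bar> \<le> B'"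
      and g0: "\<And>x. g x \<ge> 0" and gG: "\<And>x. G (x, 1) = ennreal (g x)"
      using hom1_section[OF G] by metis
    have F_f: "hom_sq F = sq_norm f" using fF f0 by (rule hom_sq_section)
    have G_g: "hom_sq G = sq_norm g" using gG g0 by (rule hom_sq_section)
    have G_f: "sq_norm g = sq_norm (avg f)"
      using hom_sq_transfer[OF F f fB f0 fF, of E] G_g by (simp add: G_def)
    have P_g: "hom_sq (transfer E G) = sq_norm (avg g)"
      by (rule hom_sq_transfer[OF G g gB g0 gG])
    have gle: "sq_norm (avg g) \<le> sq_norm g" by (rule sq_norm_avg_le[OF g gB])
    have fle: "sq_norm g \<le> sq_norm f" unfolding G_f by (rule sq_norm_avg_le[OF f fB])
    show "hom_sq (transfer E (transfer E F)) \<le> ennreal (1 - \<epsilon>) * hom_sq F"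
    proof (rule ccontr)
      assume "\<not> ?thesis"
      then have big: "ennreal (1 - \<epsilon>) * sq_norm f < sq_norm (avg g)"
        by (simp add: G_def[symmetric] P_g F_f)
      have fin_f: "sq_norm f < \<infinity>" using fin F_f by simp
      have fin_g: "sq_norm g < \<infinity>" using fle fin_f by (rule le_less_trans)
      \<comment> \<open>A loss below \<epsilon> over two steps is a loss below \<epsilon> in each of
        them, so both \<open>f\<close> and \<open>g\<close> are nearly invariant under
        averaging.\<close>
      have near_f: "ennreal (1 - \<epsilon>) * sq_norm f \<le> sq_norm (avg f)"
        using big gle G_f by (metis less_imp_le order_trans)
      have "ennreal (1 - \<epsilon>) * sq_norm g \<le> ennreal (1 - \<epsilon>) * sq_norm f"
        by (rule mult_left_mono[OF fle]) simp
      then have near_g: "ennreal (1 - \<epsilon>) * sq_norm g \<le> sq_norm (avg g)"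
        using big by (metis less_imp_le order_trans)
      \<comment> \<open>Inside \<open>[-1, 1]\<close> the mass of \<open>g\<close> is bounded by its
        own spreading. Outside, the inversion identifies it with the mass of \<open>avg f\<close>
        within distance 1 of \<open>E\<close>, which is bounded by the spreading of
        \<open>f\<close>.\<close>
      have in_g: "(\<integral>\<^sup>+x\<in>{0-1..0+1}. ennreal ((g x)\<^sup>2) \<partial>lborel) \<le> ennreal (2/5) * sq_norm g"
        by (rule spread[OF g gB fin_g near_g])
      have "(\<integral>\<^sup>+x\<in>{E-1..E+1}. ennreal ((avg f x)\<^sup>2) \<partial>lborel) \<le> ennreal (2/5) * sq_norm f"
        by (rule mass_avg_le[OF f fB]) (rule spread[OF f fB fin_f near_f])
      also have "(\<integral>\<^sup>+x\<in>{E-1..E+1}. ennreal ((avg f x)\<^sup>2) \<partial>lborel)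
         = (\<integral>\<^sup>+y. ennreal ((avg f (E + y))\<^sup>2) * indicator {-1..1} y \<partial>lborel)"
      proof -
        have "(\<integral>\<^sup>+x\<in>{E-1..E+1}. ennreal ((avg f x)\<^sup>2) \<partial>lborel)
          = (\<integral>\<^sup>+y. ennreal ((avg f (y - - E))\<^sup>2) * indicator {E-1..E+1} (y - - E) \<partial>lborel)"
          by (rule nn_integral_lborel_shift[of "\<lambda>x. ennreal ((avg f x)\<^sup>2) * indicator {E-1..E+1} x", symmetric]) measurable
        also have "\<dots> = (\<integral>\<^sup>+y. ennreal ((avg f (E + y))\<^sup>2) * indicator {-1..1} y \<partial>lborel)"
          by (intro nn_integral_cong) (auto split: split_indicator simp: add.commute)
        finally show ?thesis .
      qed
      also have "\<dots> = (\<integral>\<^sup>+x. (G (x, 1))\<^sup>2 * indicator {-1..1} (- 1 / x) \<partial>lborel)"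
        unfolding G_def by (rule transfer_section[OF F f fB f0 fF, symmetric]) simp
      finally have out_g: "(\<integral>\<^sup>+x. ennreal ((g x)\<^sup>2) * indicator {-1..1} (- 1 / x) \<partial>lborel) \<le> ennreal (2/5) * sq_norm f"
        using gG g0 by (simp add: ennreal_power)
      have "sq_norm g \<le> (\<integral>\<^sup>+x. (ennreal ((g x)\<^sup>2) * indicator {0-1..0+1} x + ennreal ((g x)\<^sup>2) * indicator {-1..1} (- 1 / x)) \<partial>lborel)"
        unfolding sq_norm_def
      proof (rule nn_integral_mono)
        fix x :: real
        have "x \<in> {0-1..0+1} \<or> - 1 / x \<in> {-1..1}"
        proof (cases "\<bar>x\<bar> \<le> 1")
          case False
          then have "\<bar>- 1 / x\<bar> \<le> 1" by (simp add: abs_divide divide_le_eq)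
          then show ?thesis unfolding atLeastAtMost_iff abs_le_iff by linarith
        qed auto
        then show "ennreal ((g x)\<^sup>2) \<le> ennreal ((g x)\<^sup>2) * indicator {0-1..0+1} x + ennreal ((g x)\<^sup>2) * indicator {-1..1} (- 1 / x)"
          by (auto split: split_indicator)
      qed
      also have "\<dots> = (\<integral>\<^sup>+x\<in>{0-1..0+1}. ennreal ((g x)\<^sup>2) \<partial>lborel)
          + (\<integral>\<^sup>+x. ennreal ((g x)\<^sup>2) * indicator {-1..1} (- 1 / x) \<partial>lborel)"
        by (rule nn_integral_add) measurable
      also have "\<dots> \<le> ennreal (2/5) * sq_norm g + ennreal (2/5) * sq_norm f"
        by (rule add_mono[OF in_g out_g])
      finally have le: "sq_norm g \<le> ennreal (2/5) * sq_norm g + ennreal (2/5) * sq_norm f" .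
      obtain n where n: "sq_norm f = ennreal n" "n \<ge> 0" using fin_f by (cases "sq_norm f") auto
      obtain m where m: "sq_norm g = ennreal m" "m \<ge> 0" using fin_g by (cases "sq_norm g") auto
      \<comment> \<open>This gives \<open>m \<le> 2/3 * n\<close>, against
        \<open>m > 9/10 * n\<close> from near-isometry.\<close>
      have "m \<le> 2/5 * m + 2/5 * n" using le m n by (simp add: ennreal_mult[symmetric] flip: ennreal_plus)
      moreover have "(1 - \<epsilon>) * n < m"
        using less_le_trans[OF big gle] m n \<epsilon> by (simp add: ennreal_mult[symmetric] ennreal_less_iff)
      moreover have "9/10 * n \<le> (1 - \<epsilon>) * n" using \<epsilon> n by (intro mult_right_mono) auto
      ultimately show False using n by linarith
    qed
  qed (use \<epsilon> in auto)
qed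

section \<open>Geometric decay of the iterates in L2\<close>

lemma hom1_inverse_norm: "hom1 (\<lambda>v. ennreal (1 / norm v))"
  unfolding hom1_def
  by (auto intro!: exI[of _ 1] simp: ennreal_mult[symmetric] )

text \<open>The exact value is the number pi; cutting at \<open>\<bar>x\<bar> = 1\<close> and
  inverting the outer part gives a bound without an antiderivative.\<close>

lemma hom_sq_inverse_norm: "hom_sq (\<lambda>v. ennreal (1 / norm v)) \<le> 4"
proof -
  have "hom_sq (\<lambda>v. ennreal (1 / norm v))
     \<le> (\<integral>\<^sup>+x. indicator {-1..1} x + ennreal (1 / x\<^sup>2) * indicator {-1..1} (- 1 / x :: real) \<partial>lborel)"
    unfolding hom_sq_def
  proof (rule nn_integral_mono)
    fix x :: real
    have eq: "(ennreal (1 / norm (x, 1::real)))\<^sup>2 = ennreal (1 / (x\<^sup>2 + 1))"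
      by (simp add: ennreal_power norm_Pair power_divide)
    show "(ennreal (1 / norm (x, 1::real)))\<^sup>2 \<le> indicator {-1..1} x + ennreal (1 / x\<^sup>2) * indicator {-1..1} (- 1 / x)"
    proof (cases "\<bar>x\<bar> \<le> 1")
      case True
      have i: "indicator {-1..1} x = (1 :: ennreal)" using True by (auto simp: abs_le_iff)
      have "ennreal (1 / (x\<^sup>2 + 1)) \<le> ennreal 1" by (intro ennreal_leI, subst divide_le_eq_1_pos) (auto intro: add_nonneg_pos)
      then show ?thesis unfolding eq i by (simp add: add_increasing2)
    next
      case False
      then have "\<bar>- 1 / x\<bar> \<le> 1" by (simp add: abs_divide divide_le_eq)
      then have i: "- 1 / x \<in> {-1..1}" unfolding atLeastAtMost_iff abs_le_iff by linarith
      have "ennreal (1 / (x\<^sup>2 + 1)) \<le> ennreal (1 / x\<^sup>2)"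
        using False by (intro ennreal_leI divide_left_mono mult_pos_pos) (auto intro: add_nonneg_pos)
      then show ?thesis unfolding eq using i by (simp add: add_increasing)
    qed
  qed
  also have "\<dots> = 2 + (\<integral>\<^sup>+x. indicator {-1..1::real} x \<partial>lborel)"
    using nn_integral_neg_inverse[of "indicator {-1..1}"] by (subst nn_integral_add) simp_all
  also have "\<dots> = 4" by simp
  finally show ?thesis .
qed

lemma hom_sq_iterate:
  obtains \<kappa> where "0 < \<kappa>" "\<kappa> < 1"
    "\<And>E m. hom_sq ((transfer E ^^ m) (\<lambda>v. ennreal (1 / norm v))) \<le> ennreal (8 * \<kappa> ^ m)"
proof -
  obtain \<epsilon> where \<epsilon>: "0 < \<epsilon>" "\<epsilon> < 1" and contr:
    "\<And>F E. hom1 F \<Longrightarrow> hom_sq F < \<infinity> \<Longrightarrow> hom_sq (transfer E (transfer E F)) \<le> ennreal (1 - \<epsilon>) * hom_sq F"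
    by (rule two_step_contraction) blast
  \<comment> \<open>The lower bound \<open>1/4\<close> makes \<open>\<kappa> \<ge> 1/2\<close>, so
    that the bound 4 on the first iterate fits under \<open>8 * \<kappa>\<close>. The contraction
    covers two steps, hence the square root and the induction on pairs.\<close>
  define \<kappa>' where "\<kappa>' = max (1 - \<epsilon>) (1/4)"
  have \<kappa>': "0 < \<kappa>'" "\<kappa>' < 1" "1 - \<epsilon> \<le> \<kappa>'" "1/4 \<le> \<kappa>'" using \<epsilon> by (auto simp: \<kappa>'_def)
  define \<kappa> where "\<kappa> = sqrt \<kappa>'"
  have \<kappa>: "0 < \<kappa>" "\<kappa> < 1" "\<kappa>\<^sup>2 = \<kappa>'" using \<kappa>' by (auto simp: \<kappa>_def)
  have \<kappa>h: "1/2 \<le> \<kappa>" unfolding \<kappa>_def using \<kappa>' by (intro real_le_rsqrt) (simp add: power_divide)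
  let ?F = "\<lambda>E m. (transfer E ^^ m) (\<lambda>v. ennreal (1 / norm v))"
  have h: "hom1 (?F E m)" for E m
    by (induction m) (simp_all add: hom1_inverse_norm hom1_transfer)
  have "hom_sq (?F E m) \<le> ennreal (8 * \<kappa> ^ m) \<and> hom_sq (?F E (Suc m)) \<le> ennreal (8 * \<kappa> ^ Suc m)" for E m
  proof (induction m)
    case 0
    have a: "hom_sq (?F E 0) \<le> 4" using hom_sq_inverse_norm by simp
    have b: "hom_sq (?F E (Suc 0)) \<le> 4"
      using hom_sq_transfer_le[OF h[of 0 E], of E] a by (simp add: order_trans)
    have "ennreal 4 \<le> ennreal (8 * \<kappa>)" using \<kappa>h by (intro ennreal_leI) simp
    moreover have "ennreal 4 \<le> ennreal 8" by (intro ennreal_leI) simp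
    ultimately show ?case using a b by (auto intro: order_trans)
  next
    case (Suc m)
    have fin: "hom_sq (?F E m) < \<infinity>" using Suc by (auto intro: le_less_trans)
    have "hom_sq (?F E (Suc (Suc m))) \<le> ennreal (1 - \<epsilon>) * hom_sq (?F E m)"
      using contr[OF h[of m E] fin, of E] by simp
    also have "\<dots> \<le> ennreal \<kappa>' * ennreal (8 * \<kappa> ^ m)"
      using Suc \<kappa>' by (intro mult_mono ennreal_leI) auto
    also have "\<dots> = ennreal (8 * \<kappa> ^ Suc (Suc m))"
    proof -
      have e: "8 * \<kappa> ^ Suc (Suc m) = \<kappa>' * (8 * \<kappa> ^ m)"
        unfolding \<kappa>(3)[symmetric] by (simp add: power2_eq_square)
      show ?thesis unfolding e by (rule ennreal_mult[symmetric]) (use \<kappa> \<kappa>' in auto)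
    qed
    finally show ?case using Suc by blast
  qed
  then show thesis using that[OF \<kappa>(1,2)] by blast
qed

end

section \<open>Decay of fractional moments\<close>

text \<open>The first term dominates if \<open>1 / r \<le> t\<close>, the second otherwise. The
  threshold \<open>t\<close> trades a fractional moment for the first inverse power, which has the
  homogeneity that the L2 bound requires.\<close>

lemma inverse_powr_le:
  fixes r t s :: real
  assumes "0 < s" "s \<le> 1" "0 < t" "0 \<le> r"
  shows "r powr - s \<le> t powr s + t powr (s - 1) * (1 / r)"
proof (cases "r = 0")
  case False
  then have r: "r > 0" using assms by simp
  have eq: "r powr - s = (1 / r) powr s" using r by (simp add: powr_minus_divide powr_divide)
  show ?thesis
  proof (cases "1 / r \<le> t")
    case True
    then have "(1 / r) powr s \<le> t powr s" using r assms by (intro powr_mono2) auto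
    moreover have "0 \<le> t powr (s - 1) * (1 / r)" using r by simp
    ultimately show ?thesis unfolding eq by linarith
  next
    case False
    have "(1 / r) powr s = (1 / r) powr (s - 1) * (1 / r)"
      using r by (simp add: powr_diff)
    also have "\<dots> \<le> t powr (s - 1) * (1 / r)"
      using False r assms by (intro mult_right_mono powr_mono2') auto
    finally have "(1 / r) powr s \<le> t powr (s - 1) * (1 / r)" .
    moreover have "0 \<le> t powr s" by simp
    ultimately show ?thesis unfolding eq by linarith
  qed
qed simp

context single_site
begin

lemma dominated_nn_integral:
  assumes [measurable]: "g \<in> borel_measurable borel"
  shows "(\<integral>\<^sup>+V. g V * indicator A V \<partial>\<nu>) \<le> ennreal K * (\<integral>\<^sup>+V. g V * indicator A V \<partial>lborel)"
proof -
  define M1 where "M1 = density \<nu> (indicator A)"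
  define M2 where "M2 = density lborel (\<lambda>x. ennreal K * indicator A x)"
  have s: "sets M1 = sets borel" "sets M2 = sets borel" by (simp_all add: M1_def M2_def sets_nu)
  have "M1 \<le> M2"
  proof (subst le_measure)
    show "sets M1 = sets M2" using s by simp
    show "\<forall>B\<in>sets M1. emeasure M1 B \<le> emeasure M2 B"
    proof
      fix B assume "B \<in> sets M1"
      then have [measurable]: "B \<in> sets borel" using s by simp
      have "emeasure M1 B = emeasure \<nu> (A \<inter> B)"
        unfolding M1_def by (subst emeasure_density) (auto simp: sets_nu indicator_inter_arith[symmetric])
      also have "\<dots> \<le> ennreal K * emeasure lborel (A \<inter> B)" by (rule dominated) auto
      also have "\<dots> = emeasure M2 B"
        unfolding M2_def by (subst emeasure_density)
          (auto simp: nn_integral_cmult mult.assoc indicator_inter_arith[symmetric])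
      finally show "emeasure M1 B \<le> emeasure M2 B" .
    qed
  qed
  then have "(\<integral>\<^sup>+V. g V \<partial>M1) \<le> (\<integral>\<^sup>+V. g V \<partial>M2)"
    by (intro nn_integral_mono_measure) (simp_all add: s)
  moreover have "(\<integral>\<^sup>+V. g V \<partial>M1) = (\<integral>\<^sup>+V. g V * indicator A V \<partial>\<nu>)"
    unfolding M1_def by (subst nn_integral_density) (auto simp: mult.commute)
  moreover have "(\<integral>\<^sup>+V. g V \<partial>M2) = ennreal K * (\<integral>\<^sup>+V. g V * indicator A V \<partial>lborel)"
    unfolding M2_def by (subst nn_integral_density) (auto simp: mult_ac nn_integral_cmult[symmetric])
  ultimately show ?thesis by simp
qed

lemma transfer_iterate_measurable [measurable]:
  "F \<in> borel_measurable borel \<Longrightarrow> (transfer E ^^ m) F \<in> borel_measurable borel"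
  by (induction m) (simp_all add: transfer_measurable)

text \<open>The transfer operator is monotone and fixes constants, as \<nu> has mass 1; so the
  pointwise bound by an affine function of \<open>G\<close> survives iteration.\<close>

lemma transfer_iterate_affine_le:
  assumes [measurable]: "F \<in> borel_measurable borel" "G \<in> borel_measurable borel"
    and le: "\<And>v. F v \<le> a + b * G v"
  shows "(transfer E ^^ m) F v \<le> a + b * (transfer E ^^ m) G v"
proof (induction m arbitrary: v)
  case (Suc m)
  have "(transfer E ^^ Suc m) F v \<le> (\<integral>\<^sup>+V. a + b * (transfer E ^^ m) G (tm E V v) \<partial>\<nu>)"
    by (simp add: transfer_def[of E "(transfer E ^^ m) F"]) (intro nn_integral_mono Suc)
  also have "\<dots> = a + b * (transfer E ^^ Suc m) G v"
    by (subst nn_integral_add) (auto simp: nn_integral_cmult emeasure_space_1 transfer_def[of E "(transfer E ^^ m) G"])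
  finally show ?case .
qed (simp add: le)

text \<open>On \<open>A\<close> the point \<open>y - V\<close> has density at most \<open>K\<close>,
  so an L2 bound on the section controls an expectation from one fixed \<open>v\<close>. The
  inequality \<open>f \<le> \<tau> + f^2 / \<tau>\<close> on a bounded range does the work of
  Cauchy-Schwarz, with \<tau> left free. If \<open>fst v\<close> were 0, then
  \<open>tm E V v\<close> would not depend on \<open>V\<close> and nothing would be
  smoothed.\<close>

lemma transfer_smoothing:
  assumes F: "hom1 F" and a: "fst v \<noteq> 0" and \<tau>: "\<tau> > 0"
  shows "(\<integral>\<^sup>+V. F (tm E V v) * indicator A V \<partial>\<nu>)
    \<le> ennreal (K / \<bar>fst v\<bar>) * (ennreal (2 * R * \<tau>) + ennreal (1 / \<tau>) * hom_sq F)"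
proof -
  have [measurable]: "F \<in> borel_measurable borel" and h: "F (c *\<^sub>R w) = ennreal (1 / \<bar>c\<bar>) * F w" if "c \<noteq> 0" for c w
    using F that unfolding hom1_def by blast+
  obtain f B where f[measurable]: "f \<in> borel_measurable borel" and fB: "\<And>x. \<bar>f x\<bar> \<le> B"
      and f0: "\<And>x. f x \<ge> 0" and fF: "\<And>x. F (x, 1) = ennreal (f x)"
    using hom1_section[OF F] by metis
  define y where "y = E - snd v / fst v"
  have sect: "F (tm E V v) = ennreal (1 / \<bar>fst v\<bar>) * ennreal (f (y - V))" for V
  proof -
    have "tm E V v = fst v *\<^sub>R (y - V, 1)" using a by (simp add: tm_def y_def field_simps)
    then show ?thesis using h[OF a, of "(y - V, 1)"] fF by simp
  qed
  have pt: "ennreal (f x) \<le> ennreal \<tau> + ennreal (1 / \<tau>) * ennreal ((f x)\<^sup>2)" for x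
  proof -
    have "f x \<le> \<tau> + 1 / \<tau> * (f x)\<^sup>2"
    proof (cases "f x \<le> \<tau>")
      case False
      then have "f x * \<tau> \<le> f x * f x" using f0[of x] by (intro mult_left_mono) auto
      then have "f x \<le> 1 / \<tau> * (f x)\<^sup>2" using \<tau> by (simp add: field_simps power2_eq_square)
      then show ?thesis using \<tau> by simp
    qed (use \<tau> in \<open>simp add: add_increasing2\<close>)
    then have "ennreal (f x) \<le> ennreal (\<tau> + 1 / \<tau> * (f x)\<^sup>2)" by (rule ennreal_leI)
    also have "\<dots> = ennreal \<tau> + ennreal (1 / \<tau>) * ennreal ((f x)\<^sup>2)"
      using \<tau> by (subst ennreal_plus) (auto simp: ennreal_mult[symmetric])
    finally show ?thesis .
  qed
  have "(\<integral>\<^sup>+V. F (tm E V v) * indicator A V \<partial>\<nu>)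
     = (\<integral>\<^sup>+V. ennreal (1 / \<bar>fst v\<bar>) * (ennreal (f (y - V)) * indicator {-R..R} V * indicator A V) \<partial>\<nu>)"
    using bounded_nu by (intro nn_integral_cong_AE, eventually_elim)
      (auto simp: sect mult.assoc abs_le_iff split: split_indicator)
  also have "\<dots> = ennreal (1 / \<bar>fst v\<bar>) * (\<integral>\<^sup>+V. ennreal (f (y - V)) * indicator {-R..R} V * indicator A V \<partial>\<nu>)"
    by (rule nn_integral_cmult) measurable
  also have "(\<integral>\<^sup>+V. ennreal (f (y - V)) * indicator {-R..R} V * indicator A V \<partial>\<nu>)
      \<le> ennreal K * (\<integral>\<^sup>+V. ennreal (f (y - V)) * indicator {-R..R} V * indicator A V \<partial>lborel)"
    by (rule dominated_nn_integral) measurable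
  also have "(\<integral>\<^sup>+V. ennreal (f (y - V)) * indicator {-R..R} V * indicator A V \<partial>lborel)
      \<le> (\<integral>\<^sup>+V. ennreal \<tau> * indicator {-R..R} V + ennreal (1 / \<tau>) * ennreal ((f (y - V))\<^sup>2) \<partial>lborel)"
  proof (rule nn_integral_mono)
    fix V
    show "ennreal (f (y - V)) * indicator {-R..R} V * indicator A V
       \<le> ennreal \<tau> * indicator {-R..R} V + ennreal (1 / \<tau>) * ennreal ((f (y - V))\<^sup>2)"
      using pt[of "y - V"] by (auto split: split_indicator)
  qed
  also have "\<dots> = ennreal (2 * R * \<tau>) + ennreal (1 / \<tau>) * hom_sq F"
  proof -
    have "(\<integral>\<^sup>+V. ennreal ((f (y - V))\<^sup>2) \<partial>lborel) = hom_sq F"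
      unfolding hom_sq_section[of F f, OF fF f0] sq_norm_def
      by (rule nn_integral_lborel_reflect[of "\<lambda>x. ennreal ((f x)\<^sup>2)"]) measurable
    moreover have "ennreal \<tau> * ennreal (R + R) = ennreal (2 * R * \<tau>)"
      using \<tau> R_pos by (simp add: ennreal_mult[symmetric] mult_ac)
    ultimately show ?thesis
      using R_pos by (subst nn_integral_add) (auto simp: nn_integral_cmult)
  qed
  finally have "(\<integral>\<^sup>+V. F (tm E V v) * indicator A V \<partial>\<nu>)
     \<le> ennreal (1 / \<bar>fst v\<bar>) * (ennreal K * (ennreal (2 * R * \<tau>) + ennreal (1 / \<tau>) * hom_sq F))"
    by (simp add: mult_left_mono)
  also have "\<dots> = ennreal (K / \<bar>fst v\<bar>) * (ennreal (2 * R * \<tau>) + ennreal (1 / \<tau>) * hom_sq F)"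
    using K_pos by (simp add: mult.assoc[symmetric] ennreal_mult[symmetric])
  finally show ?thesis .
qed

section \<open>Decay from every initial direction\<close>

abbreviation pow_norm :: "real \<Rightarrow> real \<times> real \<Rightarrow> ennreal" where
  "pow_norm s \<equiv> \<lambda>v. ennreal (norm v powr - s)"

lemma transfer_iterate_pow_norm_scaleR:
  "(transfer E ^^ m) (pow_norm s) (c *\<^sub>R v) = ennreal (\<bar>c\<bar> powr - s) * (transfer E ^^ m) (pow_norm s) v"
proof (induction m arbitrary: v)
  case 0
  then show ?case by (simp add: powr_mult ennreal_mult)
next
  case (Suc m)
  have "(transfer E ^^ Suc m) (pow_norm s) (c *\<^sub>R v)
     = (\<integral>\<^sup>+V. ennreal (\<bar>c\<bar> powr - s) * (transfer E ^^ m) (pow_norm s) (tm E V v) \<partial>\<nu>)"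
    by (simp add: transfer_def[of E "(transfer E ^^ m) (pow_norm s)"] tm_scaleR Suc)
  also have "\<dots> = ennreal (\<bar>c\<bar> powr - s) * (transfer E ^^ Suc m) (pow_norm s) v"
    by (simp add: nn_integral_cmult transfer_def[of E "(transfer E ^^ m) (pow_norm s)"])
  finally show ?case .
qed

text \<open>The \<open>L\<^sup>2\<close> bound says nothing about a fixed initial direction. Within any two steps, with probability at least \<open>\<nu> A\<close>,
  the direction acquires a bounded density and the bound applies. Otherwise one loses only a factor
  \<open>\<Lambda> powr (2 * s)\<close>, which is compensated by the probability \<open>1 - \<nu> A\<close> once \<open>s\<close> is small.\<close>

theorem fractional_moment_decay:
  assumes Q: "Q \<ge> 0"
  obtains s C c where "0 < s" "0 \<le> C" "0 < c" "c < 1"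
    "\<And>E m v. \<bar>E\<bar> \<le> Q \<Longrightarrow> v \<noteq> 0 \<Longrightarrow> (transfer E ^^ m) (pow_norm s) v \<le> ennreal (C * c ^ m * norm v powr - s)"
proof -
  obtain \<kappa> where \<kappa>: "0 < \<kappa>" "\<kappa> < 1" and
    iter: "\<And>E m. hom_sq ((transfer E ^^ m) (\<lambda>v. ennreal (1 / norm v))) \<le> ennreal (8 * \<kappa> ^ m)"
    by (rule hom_sq_iterate) blast
  let ?N = "\<lambda>v :: real \<times> real. ennreal (1 / norm v)"
  define \<theta> where "\<theta> = sqrt \<kappa>"
  have \<theta>: "0 < \<theta>" "\<theta> < 1" "\<theta>\<^sup>2 = \<kappa>" using \<kappa> by (auto simp: \<theta>_def)
  define p where "p = measure \<nu> A"
  have p: "0 < p" "p \<le> 1" using A_pos by (auto simp: p_def)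
  define \<Lambda> where "\<Lambda> = 2 + Q + R"
  have \<Lambda>: "\<Lambda> \<ge> 2" using Q R_pos by (simp add: \<Lambda>_def)
  \<comment> \<open>Chosen so that the loss over two steps is at most \<open>1 + p / 2\<close>; then
    \<open>(1 - p) * (1 + p / 2) \<le> 1 - p / 2\<close>, so the branch without smoothing still
    contracts by \<open>lam\<close>.\<close>
  define s where "s = min 1 (ln (1 + p / 2) / (2 * ln \<Lambda>))"
  have s: "0 < s" "s \<le> 1" using p \<Lambda> by (auto simp: s_def)
  have \<Lambda>s: "\<Lambda> powr s * \<Lambda> powr s \<le> 1 + p / 2"
  proof -
    have "s * (2 * ln \<Lambda>) \<le> ln (1 + p / 2)"
      using \<Lambda> unfolding s_def by (simp add: pos_le_divide_eq[symmetric])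
    then have "exp (s * (2 * ln \<Lambda>)) \<le> exp (ln (1 + p / 2))" by simp
    also have "\<dots> = 1 + p / 2" using p by simp
    finally have "exp (s * (2 * ln \<Lambda>)) \<le> 1 + p / 2" .
    moreover have "\<Lambda> powr s * \<Lambda> powr s = exp (s * (2 * ln \<Lambda>))"
      using \<Lambda> by (simp add: powr_def exp_add[symmetric])
    ultimately show ?thesis by simp
  qed
  let ?T = "\<lambda>E m. (transfer E ^^ m) (pow_norm s)"
  define lam where "lam = 1 - p / 2"
  have lam: "(1 - p) * (\<Lambda> powr s * \<Lambda> powr s) \<le> lam" "lam < 1" "0 < lam"
  proof -
    have "(1 - p) * (\<Lambda> powr s * \<Lambda> powr s) \<le> (1 - p) * (1 + p / 2)"
      using p by (intro mult_left_mono \<Lambda>s) auto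
    also have "\<dots> \<le> lam" using p by (simp add: lam_def algebra_simps)
    finally show "(1 - p) * (\<Lambda> powr s * \<Lambda> powr s) \<le> lam" .
  qed (use p in \<open>auto simp: lam_def\<close>)
  \<comment> \<open>Directions with \<open>\<bar>fst v\<bar> < c0\<close> are too close to the
    vertical axis to be smoothed. A unit vector of this kind has
    \<open>\<bar>snd v\<bar> \<ge> 3/4\<close>, and one step changes the new first component by at
    most \<open>(Q + R) * c0 \<le> 1/4\<close>, leaving it at least \<open>1/2\<close>; the second
    step can then smooth.\<close>
  define c0 where "c0 = 1 / (4 * (Q + R + 1))"
  have c0: "0 < c0" "c0 \<le> 1/4" "(Q + R) * c0 \<le> 1/4"
    using Q R_pos by (auto simp: c0_def divide_le_eq field_simps)
  define D where "D = K / c0 * (2 * R + 8)"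
  have D: "D \<ge> 0" using K_pos R_pos c0 by (simp add: D_def)
  define \<rho> where "\<rho> = \<theta> powr s"
  have \<rho>: "0 < \<rho>" "\<rho> < 1" using \<theta> s powr_less_mono2[of s \<theta> 1] by (auto simp: \<rho>_def)
  have smooth: "(\<integral>\<^sup>+V. ?T E m (tm E V v) * indicator A V \<partial>\<nu>) \<le> ennreal ((1 + D) * \<rho> ^ m)"
    if v: "\<bar>fst v\<bar> \<ge> c0" for E m v
  proof -
    \<comment> \<open>With \<open>\<theta>^2 = \<kappa>\<close> both terms of the smoothing bound
      are of order \<open>t\<close>, since \<open>8 * \<kappa> ^ m / t = 8 * t\<close>.\<close>
    define t where "t = \<theta> ^ m"
    have t: "t > 0" using \<theta> by (simp add: t_def)
    have hN: "hom1 ((transfer E ^^ m) ?N)"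
      by (induction m) (simp_all add: hom1_inverse_norm hom1_transfer)
    have fv: "fst v \<noteq> 0" using v c0 by auto
    have 1: "(\<integral>\<^sup>+V. (transfer E ^^ m) ?N (tm E V v) * indicator A V \<partial>\<nu>) \<le> ennreal (D * t)"
    proof -
      have "(\<integral>\<^sup>+V. (transfer E ^^ m) ?N (tm E V v) * indicator A V \<partial>\<nu>)
        \<le> ennreal (K / \<bar>fst v\<bar>) * (ennreal (2 * R * t) + ennreal (1 / t) * hom_sq ((transfer E ^^ m) ?N))"
        by (rule transfer_smoothing[OF hN fv t])
      also have "\<dots> \<le> ennreal (K / c0) * (ennreal (2 * R * t) + ennreal (1 / t) * ennreal (8 * \<kappa> ^ m))"
        using v c0 K_pos fv
        by (intro mult_mono[OF ennreal_leI[OF divide_left_mono] add_left_mono[OF mult_left_mono[OF iter]]]) auto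
      also have "\<dots> = ennreal (K / c0 * (2 * R * t + 1 / t * (8 * \<kappa> ^ m)))"
      proof -
        have *: "ennreal a * (ennreal x + ennreal b * ennreal y) = ennreal (a * (x + b * y))"
          if "0 \<le> a" "0 \<le> x" "0 \<le> b" "0 \<le> y" for a x b y
          using that by (simp add: ennreal_mult)
        show ?thesis by (rule *) (use t K_pos c0 R_pos \<kappa> in auto)
      qed
      also have "1 / t * (8 * \<kappa> ^ m) = 8 * t"
        using t unfolding \<theta>(3)[symmetric] t_def by (simp add: power2_eq_square power_mult_distrib)
      finally show ?thesis by (simp add: D_def algebra_simps)
    qed
    have "(\<integral>\<^sup>+V. ?T E m (tm E V v) * indicator A V \<partial>\<nu>)
       \<le> (\<integral>\<^sup>+V. ennreal (t powr s) + ennreal (t powr (s - 1)) * ((transfer E ^^ m) ?N (tm E V v) * indicator A V) \<partial>\<nu>)"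
    proof (rule nn_integral_mono)
      fix V
      have "?T E m (tm E V v)
        \<le> ennreal (t powr s) + ennreal (t powr (s - 1)) * (transfer E ^^ m) ?N (tm E V v)"
      proof (rule transfer_iterate_affine_le)
        fix w :: "real \<times> real"
        show "ennreal (norm w powr - s) \<le> ennreal (t powr s) + ennreal (t powr (s - 1)) * ennreal (1 / norm w)"
          using ennreal_leI[OF inverse_powr_le[OF s t norm_ge_zero[of w]]]
          by (simp add: ennreal_mult[symmetric] ennreal_plus[symmetric] del: ennreal_plus)
      qed measurable
      then show "?T E m (tm E V v) * indicator A V
        \<le> ennreal (t powr s) + ennreal (t powr (s - 1)) * ((transfer E ^^ m) ?N (tm E V v) * indicator A V)"
        by (auto split: split_indicator)
    qed
    also have "\<dots> = ennreal (t powr s) + ennreal (t powr (s - 1)) * (\<integral>\<^sup>+V. (transfer E ^^ m) ?N (tm E V v) * indicator A V \<partial>\<nu>)"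
      by (subst nn_integral_add) (auto simp: nn_integral_cmult emeasure_space_1)
    also have "\<dots> \<le> ennreal (t powr s) + ennreal (t powr (s - 1)) * ennreal (D * t)"
      by (intro add_left_mono mult_left_mono 1) simp
    also have "\<dots> = ennreal (t powr s + t powr (s - 1) * (D * t))"
      using t D by (simp add: ennreal_mult[symmetric] ennreal_plus[symmetric] del: ennreal_plus)
    also have "t powr s + t powr (s - 1) * (D * t) = (1 + D) * t powr s"
      using t by (simp add: powr_diff algebra_simps)
    also have "t powr s = \<rho> ^ m"
    proof -
      have "t powr s = (\<theta> powr real m) powr s" unfolding t_def using \<theta> by (simp only: powr_realpow)
      also have "\<dots> = (\<theta> powr s) powr real m" by (simp only: powr_powr mult.commute)
      also have "\<dots> = \<rho> ^ m" unfolding \<rho>_def using \<theta> by (intro powr_realpow) simp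
      finally show ?thesis .
    qed
    finally show ?thesis .
  qed
  \<comment> \<open>The rate must be at least \<rho>, the decay after smoothing, and its square must
    exceed \<open>lam\<close>, the two-step contraction without smoothing.\<close>
  define c where "c = sqrt (max ((1 + lam) / 2) (\<rho>\<^sup>2))"
  have \<rho>2: "\<rho>\<^sup>2 < 1" using \<rho> by (simp add: power_less_one_iff)
  have c2: "c\<^sup>2 = max ((1 + lam) / 2) (\<rho>\<^sup>2)" unfolding c_def by (rule real_sqrt_pow2) (simp add: le_max_iff_disj)
  have c: "0 < c" "c < 1" "\<rho> \<le> c" "lam < c\<^sup>2"
  proof -
    show "0 < c" unfolding c_def using lam by (simp add: less_max_iff_disj)
    show "c < 1" unfolding c_def using lam \<rho>2 by simp
    show "\<rho> \<le> c" unfolding c_def by (rule real_le_rsqrt) simp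
    show "lam < c\<^sup>2" unfolding c2 using lam by (simp add: less_max_iff_disj)
  qed
  \<comment> \<open>The first summand settles the base case at one step. The second closes the
    induction, because \<open>(1 + D) * c ^ m + lam * C * c ^ m \<le> C * c ^ (m + 2)\<close>
    amounts to \<open>1 + D \<le> C * (c^2 - lam)\<close>.\<close>
  define C where "C = \<Lambda> powr s / c + (1 + D) / (c\<^sup>2 - lam)"
  have \<Lambda>s1: "1 \<le> \<Lambda> powr s" using \<Lambda> s by (simp add: ge_one_powr_ge_zero)
  have Cc: "\<Lambda> powr s \<le> C * c" and C1: "1 \<le> C" and C0: "0 \<le> C" and CD: "1 + D \<le> C * (c\<^sup>2 - lam)"
  proof -
    have "0 \<le> (1 + D) / (c\<^sup>2 - lam)" using D c by simp
    then have C': "\<Lambda> powr s / c \<le> C" by (simp add: C_def)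
    then show "\<Lambda> powr s \<le> C * c" using c by (simp add: pos_divide_le_eq)
    have "1 \<le> \<Lambda> powr s / c" using \<Lambda>s1 c by (simp add: pos_le_divide_eq)
    then show "1 \<le> C" using C' by linarith
    then show "0 \<le> C" by simp
    have "0 \<le> \<Lambda> powr s / c" using c by simp
    then have "(1 + D) / (c\<^sup>2 - lam) \<le> C" by (simp add: C_def)
    then show "1 + D \<le> C * (c\<^sup>2 - lam)" using c by (simp add: pos_divide_le_eq)
  qed
  have step: "norm (tm E V v) powr - s \<le> \<Lambda> powr s * norm v powr - s"
    if "\<bar>E\<bar> \<le> Q" "\<bar>V\<bar> \<le> R" "v \<noteq> 0" for E V v
  proof -
    have "norm v \<le> (2 + \<bar>E - V\<bar>) * norm (tm E V v)" by (rule norm_le_norm_tm)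
    also have "\<dots> \<le> \<Lambda> * norm (tm E V v)" unfolding \<Lambda>_def using that by (intro mult_right_mono) auto
    finally have "norm v / \<Lambda> \<le> norm (tm E V v)" using \<Lambda> by (simp add: divide_le_eq mult.commute)
    then have "norm (tm E V v) powr - s \<le> (norm v / \<Lambda>) powr - s"
      using that \<Lambda> s by (intro powr_mono2') auto
    also have "\<dots> = \<Lambda> powr s * norm v powr - s"
      using \<Lambda> that by (simp add: powr_divide powr_minus field_simps)
    finally show ?thesis .
  qed
  have compl: "emeasure \<nu> (- A) = ennreal (1 - p)"
  proof -
    have "space \<nu> = UNIV" using sets_eq_imp_space_eq[OF sets_nu] by simp
    then have "- A = space \<nu> - A" by auto
    then show ?thesis using prob_compl[of A] by (simp add: emeasure_eq_measure sets_nu p_def)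
  qed
  let ?P = "\<lambda>E m. \<forall>v. v \<noteq> 0 \<longrightarrow> ?T E m v \<le> ennreal (C * c ^ m * norm v powr - s)"
  have one: "?T E (Suc m) v \<le> ennreal (C * c ^ m * \<Lambda> powr s * norm v powr - s)"
    and oneA: "(\<integral>\<^sup>+V. ?T E m (tm E V v) * indicator (- A) V \<partial>\<nu>)
        \<le> ennreal ((1 - p) * (C * c ^ m * \<Lambda> powr s * norm v powr - s))"
    if E: "\<bar>E\<bar> \<le> Q" and P: "?P E m" and v: "v \<noteq> 0" for E m v
  proof -
    have ae: "AE V in \<nu>. ?T E m (tm E V v) \<le> ennreal (C * c ^ m * \<Lambda> powr s * norm v powr - s)"
      using bounded_nu
    proof eventually_elim
      fix V assume V: "\<bar>V\<bar> \<le> R"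
      have "?T E m (tm E V v) \<le> ennreal (C * c ^ m * norm (tm E V v) powr - s)"
        using P v tm_eq_0_iff[of E V v] by blast
      also have "\<dots> \<le> ennreal (C * c ^ m * (\<Lambda> powr s * norm v powr - s))"
        using step[OF E V v] C0 c by (intro ennreal_leI mult_left_mono) auto
      finally show "?T E m (tm E V v) \<le> ennreal (C * c ^ m * \<Lambda> powr s * norm v powr - s)"
        by (simp add: mult.assoc)
    qed
    have "?T E (Suc m) v \<le> (\<integral>\<^sup>+V. ennreal (C * c ^ m * \<Lambda> powr s * norm v powr - s) \<partial>\<nu>)"
      unfolding funpow.simps(2)[of m] comp_def transfer_def[of E "?T E m"]
      by (rule nn_integral_mono_AE[OF ae])
    then show "?T E (Suc m) v \<le> ennreal (C * c ^ m * \<Lambda> powr s * norm v powr - s)"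
      by (simp add: emeasure_space_1)
    have "(\<integral>\<^sup>+V. ?T E m (tm E V v) * indicator (- A) V \<partial>\<nu>)
       \<le> (\<integral>\<^sup>+V. ennreal (C * c ^ m * \<Lambda> powr s * norm v powr - s) * indicator (- A) V \<partial>\<nu>)"
      using ae by (intro nn_integral_mono_AE, eventually_elim) (auto split: split_indicator)
    also have "\<dots> = ennreal (C * c ^ m * \<Lambda> powr s * norm v powr - s) * emeasure \<nu> (- A)"
      by (subst nn_integral_cmult_indicator) (auto simp: sets_nu)
    also note compl
    also have "ennreal (C * c ^ m * \<Lambda> powr s * norm v powr - s) * ennreal (1 - p)
       = ennreal ((1 - p) * (C * c ^ m * \<Lambda> powr s * norm v powr - s))"
      using p C0 c by (simp add: ennreal_mult[symmetric] mult.commute)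
    finally show "(\<integral>\<^sup>+V. ?T E m (tm E V v) * indicator (- A) V \<partial>\<nu>)
        \<le> ennreal ((1 - p) * (C * c ^ m * \<Lambda> powr s * norm v powr - s))" .
  qed
  have split: "?T E (Suc m) v
     = (\<integral>\<^sup>+V. ?T E m (tm E V v) * indicator A V \<partial>\<nu>)
     + (\<integral>\<^sup>+V. ?T E m (tm E V v) * indicator (- A) V \<partial>\<nu>)" for E m v
    by (subst nn_integral_add[symmetric])
      (auto simp: transfer_def[of E "?T E m"] intro!: nn_integral_cong split: split_indicator)
  have unit: "?T E (Suc (Suc m)) v \<le> ennreal (C * c ^ Suc (Suc m))"
    if E: "\<bar>E\<bar> \<le> Q" and P: "?P E m" and v: "norm v = 1" for E m v
  proof -
    have v0: "v \<noteq> 0" using v by auto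
    have main: "?T E (Suc (Suc m)) v \<le> ennreal ((1 + D) * \<rho> ^ m) + ennreal (lam * (C * c ^ m))"
    proof (cases "\<bar>fst v\<bar> \<ge> c0")
      case True
      have "(\<integral>\<^sup>+V. ?T E (Suc m) (tm E V v) * indicator (- A) V \<partial>\<nu>)
        \<le> (\<integral>\<^sup>+V. ennreal (C * c ^ m * \<Lambda> powr s * (\<Lambda> powr s)) * indicator (- A) V \<partial>\<nu>)"
        using bounded_nu
      proof (intro nn_integral_mono_AE, eventually_elim)
        fix V assume V: "\<bar>V\<bar> \<le> R"
        have "?T E (Suc m) (tm E V v) \<le> ennreal (C * c ^ m * \<Lambda> powr s * norm (tm E V v) powr - s)"
          using one[OF E P, of "tm E V v"] v0 by simp
        also have "\<dots> \<le> ennreal (C * c ^ m * \<Lambda> powr s * \<Lambda> powr s)"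
          using step[OF E V v0] v C0 c by (intro ennreal_leI mult_left_mono) auto
        finally show "?T E (Suc m) (tm E V v) * indicator (- A) V
            \<le> ennreal (C * c ^ m * \<Lambda> powr s * (\<Lambda> powr s)) * indicator (- A) V"
          by (rule mult_right_mono) simp
      qed
      also have "\<dots> = ennreal (C * c ^ m * \<Lambda> powr s * (\<Lambda> powr s)) * emeasure \<nu> (- A)"
        by (subst nn_integral_cmult_indicator) (auto simp: sets_nu)
      also note compl
      also have "ennreal (C * c ^ m * \<Lambda> powr s * (\<Lambda> powr s)) * ennreal (1 - p)
         = ennreal ((1 - p) * (\<Lambda> powr s * \<Lambda> powr s) * (C * c ^ m))"
        using p C0 c by (simp add: ennreal_mult[symmetric] mult_ac)
      also have "\<dots> \<le> ennreal (lam * (C * c ^ m))"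
        using lam C0 c by (intro ennreal_leI mult_right_mono) auto
      finally have 2: "(\<integral>\<^sup>+V. ?T E (Suc m) (tm E V v) * indicator (- A) V \<partial>\<nu>) \<le> ennreal (lam * (C * c ^ m))" .
      have "(\<integral>\<^sup>+V. ?T E (Suc m) (tm E V v) * indicator A V \<partial>\<nu>) \<le> ennreal ((1 + D) * \<rho> ^ Suc m)"
        by (rule smooth[OF True])
      also have "\<dots> \<le> ennreal ((1 + D) * \<rho> ^ m)"
        using \<rho> D by (intro ennreal_leI mult_left_mono power_decreasing) auto
      finally show ?thesis unfolding split[of "Suc m" E] using 2 by (rule add_mono)
    next
      case False
      have big: "\<bar>snd v\<bar> \<ge> 3/4"
      proof (rule ccontr)
        assume "\<not> ?thesis"
        then have "\<bar>snd v\<bar> \<le> 3/4" "\<bar>fst v\<bar> \<le> 1/4" using False c0 by auto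
        then have "(fst v)\<^sup>2 + (snd v)\<^sup>2 \<le> (1/4)\<^sup>2 + (3/4)\<^sup>2"
          using power_mono[of "\<bar>fst v\<bar>" "1/4" 2] power_mono[of "\<bar>snd v\<bar>" "3/4" 2] by simp
        moreover have "(fst v)\<^sup>2 + (snd v)\<^sup>2 = 1" using v by (simp add: norm_prod_def)
        ultimately show False by (simp add: power2_eq_square)
      qed
      have "?T E (Suc (Suc m)) v
        \<le> (\<integral>\<^sup>+V. ennreal ((1 + D) * \<rho> ^ m) + ennreal (lam * (C * c ^ m)) \<partial>\<nu>)"
        unfolding funpow.simps(2)[of "Suc m"] comp_def transfer_def[of E "?T E (Suc m)"]
        using bounded_nu
      proof (intro nn_integral_mono_AE, eventually_elim)
        fix V assume V: "\<bar>V\<bar> \<le> R"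
        define w where "w = tm E V v"
        have w0: "w \<noteq> 0" using v0 by (simp add: w_def)
        have "\<bar>(E - V) * fst v\<bar> \<le> (Q + R) * c0"
          unfolding abs_mult using False E V Q R_pos by (intro mult_mono) auto
        moreover have "\<bar>fst w\<bar> \<ge> \<bar>snd v\<bar> - \<bar>(E - V) * fst v\<bar>" unfolding w_def tm_def fst_conv by linarith
        ultimately have "\<bar>fst w\<bar> \<ge> 1/2" using big c0 by linarith
        then have w1: "\<bar>fst w\<bar> \<ge> c0" using c0 by linarith
        have "(\<integral>\<^sup>+V. ?T E m (tm E V w) * indicator (- A) V \<partial>\<nu>)
          \<le> ennreal ((1 - p) * (C * c ^ m * \<Lambda> powr s * norm w powr - s))"
          by (rule oneA[OF E P w0])
        also have "\<dots> \<le> ennreal ((1 - p) * (C * c ^ m * \<Lambda> powr s * \<Lambda> powr s))"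
          using step[OF E V v0] v C0 c p by (intro ennreal_leI mult_left_mono) (auto simp: w_def)
        also have "\<dots> = ennreal ((1 - p) * (\<Lambda> powr s * \<Lambda> powr s) * (C * c ^ m))" by (simp add: mult_ac)
        also have "\<dots> \<le> ennreal (lam * (C * c ^ m))"
          using lam C0 c by (intro ennreal_leI mult_right_mono) auto
        finally show "?T E (Suc m) (tm E V v) \<le> ennreal ((1 + D) * \<rho> ^ m) + ennreal (lam * (C * c ^ m))"
          unfolding w_def[symmetric] split[of m E] using smooth[OF w1] by (intro add_mono)
      qed
      then show ?thesis by (simp add: emeasure_space_1)
    qed
    also have "\<dots> = ennreal ((1 + D) * \<rho> ^ m + lam * (C * c ^ m))"
      using D \<rho> lam C0 c by (subst ennreal_plus) auto
    also have "\<dots> \<le> ennreal (C * c ^ Suc (Suc m))"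
    proof (rule ennreal_leI)
      have "(1 + D) * \<rho> ^ m \<le> C * (c\<^sup>2 - lam) * c ^ m"
        using CD c \<rho> D by (intro mult_mono power_mono) auto
      then show "(1 + D) * \<rho> ^ m + lam * (C * c ^ m) \<le> C * c ^ Suc (Suc m)"
        by (simp add: power2_eq_square algebra_simps)
    qed
    finally show ?thesis .
  qed
  have all: "?P E m \<and> ?P E (Suc m)" if E: "\<bar>E\<bar> \<le> Q" for E m
  proof (induction m)
    case 0
    have P0: "?P E 0" using C1 by (auto intro!: ennreal_leI mult_right_mono simp: mult_le_cancel_right1)
    have "?P E (Suc 0)"
    proof (intro allI impI)
      fix v :: "real \<times> real" assume v: "v \<noteq> 0"
      have "?T E (Suc 0) v = (\<integral>\<^sup>+V. pow_norm s (tm E V v) \<partial>\<nu>)"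
        by (simp add: transfer_def)
      also have "\<dots> \<le> (\<integral>\<^sup>+V. ennreal (C * c ^ Suc 0 * norm v powr - s) \<partial>\<nu>)"
        using bounded_nu
      proof (intro nn_integral_mono_AE, eventually_elim)
        fix V assume V: "\<bar>V\<bar> \<le> R"
        have "norm (tm E V v) powr - s \<le> \<Lambda> powr s * norm v powr - s" by (rule step[OF E V v])
        also have "\<dots> \<le> C * c ^ Suc 0 * norm v powr - s" using Cc by (intro mult_right_mono) auto
        finally show "pow_norm s (tm E V v) \<le> ennreal (C * c ^ Suc 0 * norm v powr - s)" by (rule ennreal_leI)
      qed
      finally show "?T E (Suc 0) v \<le> ennreal (C * c ^ Suc 0 * norm v powr - s)"
        by (simp add: emeasure_space_1)
    qed
    then show ?case using P0 by blast
  next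
    case (Suc m)
    have "?P E (Suc (Suc m))"
    proof (intro allI impI)
      fix v :: "real \<times> real" assume v: "v \<noteq> 0"
      define u where "u = (1 / norm v) *\<^sub>R v"
      have u: "norm u = 1" "v = norm v *\<^sub>R u" using v by (auto simp: u_def)
      have "?T E (Suc (Suc m)) v
         = ennreal (norm v powr - s) * ?T E (Suc (Suc m)) u"
        by (subst u(2)) (simp only: transfer_iterate_pow_norm_scaleR abs_norm_cancel)
      also have "\<dots> \<le> ennreal (norm v powr - s) * ennreal (C * c ^ Suc (Suc m))"
        using Suc unit[OF E _ u(1), of m] by (intro mult_left_mono) auto
      also have "\<dots> = ennreal (C * c ^ Suc (Suc m) * norm v powr - s)"
        using C0 c by (simp add: ennreal_mult[symmetric] mult_ac)
      finally show "?T E (Suc (Suc m)) v \<le> ennreal (C * c ^ Suc (Suc m) * norm v powr - s)" .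
    qed
    then show ?case using Suc by blast
  qed
  show thesis by (rule that[OF s(1) C0 c(1,2)]) (use all in blast)
qed

end

section \<open>Finite boxes\<close>

text \<open>The solution of the eigenvalue equation with potential \<open>b 1, b 2, \<dots>\<close> that vanishes at \<open>0\<close>. As a function of \<open>E\<close> its
  value at \<open>N + 1\<close> is the characteristic polynomial of the box with sites \<open>1, \<dots>, N\<close>; the value \<open>b 0\<close> is irrelevant.\<close>

fun jac :: "(nat \<Rightarrow> 'a::comm_ring_1) \<Rightarrow> 'a \<Rightarrow> nat \<Rightarrow> 'a" where
  "jac b E 0 = 0"
| "jac b E (Suc 0) = 1"
| "jac b E (Suc (Suc j)) = (E - b (Suc j)) * jac b E (Suc j) - jac b E j"

text \<open>The same recursion run over the polynomial ring, at the indeterminate; evaluation is a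
  ring homomorphism and returns \<open>jac\<close>.\<close>

definition jac_poly :: "(nat \<Rightarrow> 'a::comm_ring_1) \<Rightarrow> nat \<Rightarrow> 'a poly" where
  "jac_poly b = jac (\<lambda>i. [:b i:]) [:0, 1:]"

lemma poly_jac_poly [simp]: "poly (jac_poly b n) E = jac b E n"
  unfolding jac_poly_def by (induction b E n rule: jac.induct) (simp_all add: algebra_simps)

lemma jac_cong: "(\<And>i. 1 \<le> i \<Longrightarrow> i < n \<Longrightarrow> b i = b' i) \<Longrightarrow> jac b E n = jac b' E n"
proof (induction b E n rule: jac.induct)
  case (3 b E j)
  have "jac b E (Suc j) = jac b' E (Suc j)" "jac b E j = jac b' E j" "b (Suc j) = b' (Suc j)"
    using 3 by auto
  then show ?case by simp
qed auto

lemma degree_jac_poly: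
  fixes b :: "nat \<Rightarrow> 'a::idom"
  shows "degree (jac_poly b (Suc n)) = n \<and> degree (jac_poly b n) \<le> n \<and> lead_coeff (jac_poly b (Suc n)) = 1"
proof (induction n)
  case 0
  then show ?case by (simp add: jac_poly_def)
next
  case (Suc n)
  let ?q = "jac_poly b"
  have rec: "?q (Suc (Suc n)) = [:- b (Suc n), 1:] * ?q (Suc n) + - ?q n"
    by (simp add: jac_poly_def)
  have nz: "?q (Suc n) \<noteq> 0" using Suc by auto
  have c1: "coeff (?q (Suc n)) n = 1" using Suc by metis
  have d1: "degree ([:- b (Suc n), 1:] * ?q (Suc n)) = Suc n"
    using Suc nz by (subst degree_mult_eq) auto
  have d2: "degree (- ?q n) < degree ([:- b (Suc n), 1:] * ?q (Suc n))" using Suc d1 by simp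
  have "degree (?q (Suc (Suc n))) = Suc n" unfolding rec using d1 d2 by (simp only: degree_add_eq_left)
  moreover have "lead_coeff (?q (Suc (Suc n))) = 1"
    unfolding rec using Suc d2 by (simp only: lead_coeff_add_le add.commute lead_coeff_mult) (simp add: c1 Suc)
  ultimately show ?case using Suc by simp
qed

text \<open>Discrete Green's formula: the right-hand side is a Wronskian that vanishes at 0 and
  grows by one summand per site. It gives orthogonality of box eigenvectors and, for conjugate
  energies, reality of the eigenvalues.\<close>

lemma christoffel_darboux:
  "(x - y) * (\<Sum>i=1..n. jac b x i * jac b y i) = jac b x (Suc n) * jac b y n - jac b x n * jac b y (Suc n)"
proof (induction n)
  case (Suc n)
  have "(x - y) * (\<Sum>i=1..Suc n. jac b x i * jac b y i)
    = (x - y) * (\<Sum>i=1..n. jac b x i * jac b y i) + (x - y) * (jac b x (Suc n) * jac b y (Suc n))"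
    by (simp add: algebra_simps)
  also have "\<dots> = jac b x (Suc (Suc n)) * jac b y (Suc n) - jac b x (Suc n) * jac b y (Suc (Suc n))"
    unfolding Suc by (simp add: algebra_simps)
  finally show ?case .
qed simp

text \<open>The confluent case \<open>y \<rightarrow> x\<close>, proved as a polynomial identity. It
  excludes double roots and computes derivatives of quotients of consecutive values.\<close>

lemma christoffel_darboux_pderiv:
  fixes b :: "nat \<Rightarrow> 'a::idom"
  shows "(\<Sum>i=1..n. (jac_poly b i)\<^sup>2) = pderiv (jac_poly b (Suc n)) * jac_poly b n - pderiv (jac_poly b n) * jac_poly b (Suc n)"
proof (induction n)
  case 0
  then show ?case by (simp add: jac_poly_def pderiv_pCons)
next
  case (Suc n)
  define X where "X = [:- b (Suc n), 1:]"
  have rec: "jac_poly b (Suc (Suc n)) = X * jac_poly b (Suc n) - jac_poly b n"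
    by (simp add: jac_poly_def X_def)
  have "pderiv X = 1" by (simp add: X_def pderiv_pCons)
  then have drec: "pderiv (jac_poly b (Suc (Suc n)))
     = X * pderiv (jac_poly b (Suc n)) + jac_poly b (Suc n) - pderiv (jac_poly b n)"
    unfolding rec pderiv_diff pderiv_mult by simp
  have "(\<Sum>i=1..Suc n. (jac_poly b i)\<^sup>2) = (\<Sum>i=1..n. (jac_poly b i)\<^sup>2) + (jac_poly b (Suc n))\<^sup>2" by simp
  then show ?case
    unfolding Suc drec unfolding rec by (simp add: algebra_simps power2_eq_square)
qed

lemma jac_of_real: "jac (\<lambda>i. of_real (b i)) (of_real E) n = (of_real (jac b E n) :: 'a::{real_algebra_1,comm_ring_1})"
  by (induction b E n rule: jac.induct) simp_all

lemma cnj_jac: "jac (\<lambda>i. complex_of_real (b i)) (cnj z) n = cnj (jac (\<lambda>i. of_real (b i)) z n)"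
  by (induction "\<lambda>i. complex_of_real (b i)" z n rule: jac.induct) simp_all

section \<open>Eigenvalues and completeness for a box\<close>

definition box_spectrum :: "(nat \<Rightarrow> real) \<Rightarrow> nat \<Rightarrow> real set" where
  "box_spectrum b N = {E. jac b E (Suc N) = 0}"

definition box_norm :: "(nat \<Rightarrow> real) \<Rightarrow> nat \<Rightarrow> real \<Rightarrow> real" where
  "box_norm b N E = (\<Sum>i=1..N. (jac b E i)\<^sup>2)"

lemma box_norm_pos: "N \<ge> 1 \<Longrightarrow> box_norm b N E > 0"
proof -
  assume "N \<ge> 1"
  then have "(jac b E 1)\<^sup>2 \<le> box_norm b N E"
    unfolding box_norm_def by (intro member_le_sum) auto
  then show ?thesis by simp
qed

lemma complex_jac_root_real:
  assumes N: "N \<ge> 1" and z: "jac (\<lambda>i. complex_of_real (b i)) z (Suc N) = 0"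
  shows "z \<in> \<real>"
proof -
  let ?q = "\<lambda>i. jac (\<lambda>i. complex_of_real (b i)) z i"
  have "(z - cnj z) * (\<Sum>i=1..N. ?q i * cnj (?q i)) = 0"
    using christoffel_darboux[of z "cnj z" "\<lambda>i. complex_of_real (b i)" N] z by (simp add: cnj_jac)
  moreover have "(\<Sum>i=1..N. ?q i * cnj (?q i)) = of_real (\<Sum>i=1..N. (cmod (?q i))\<^sup>2)"
    by (simp only: complex_norm_square of_real_sum)
  moreover have "(\<Sum>i=1..N. (cmod (?q i))\<^sup>2) > 0"
  proof -
    have "(cmod (?q 1))\<^sup>2 \<le> (\<Sum>i=1..N. (cmod (?q i))\<^sup>2)" using N by (intro member_le_sum) auto
    then show ?thesis by simp
  qed
  ultimately have "z = cnj z" by (simp del: of_real_sum)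
  then show ?thesis by (metis Reals_cnj_iff)
qed

text \<open>All complex roots are real, and at a double root the confluent identity would give
  \<open>box_norm b N E = 0\<close>, although \<open>jac b E 1 = 1\<close>. So the characteristic
  polynomial splits into distinct real linear factors.\<close>

lemma card_box_spectrum:
  assumes N: "N \<ge> 1"
  shows "finite (box_spectrum b N)" "card (box_spectrum b N) = N"
proof -
  let ?b = "\<lambda>i. complex_of_real (b i)"
  let ?p = "jac_poly ?b (Suc N)"
  have deg: "degree ?p = N" "lead_coeff ?p = 1" using degree_jac_poly[of ?b N] by auto
  have sf: "rsquarefree ?p"
    unfolding rsquarefree_roots
  proof (intro allI notI)
    fix z assume z: "poly ?p z = 0 \<and> poly (pderiv ?p) z = 0"
    then have "z \<in> \<real>" using complex_jac_root_real[OF N, of b z] by simp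
    then obtain E where E: "z = of_real E" by (elim Reals_cases)
    have "(\<Sum>i=1..N. (jac ?b z i)\<^sup>2) = 0"
      using arg_cong[OF christoffel_darboux_pderiv[of ?b N], of "\<lambda>p. poly p z"] z
      by (simp add: poly_sum)
    then have "complex_of_real (box_norm b N E) = 0"
      unfolding box_norm_def E by (simp add: jac_of_real)
    then show False using box_norm_pos[OF N, of b E] by simp
  qed
  let ?Z = "{z. poly ?p z = 0}"
  have fin: "finite ?Z" using deg N by (intro poly_roots_finite) auto
  have "degree (\<Prod>z\<in>?Z. [:- z, 1:]) = (\<Sum>z\<in>?Z. degree [:- z, 1:])"
    by (rule degree_prod_sum_eq) auto
  moreover have "(\<Prod>z\<in>?Z. [:- z, 1:]) = ?p"
    using complex_poly_decompose_rsquarefree[OF sf] unfolding deg(2) by simp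
  ultimately have card: "card ?Z = N" using deg by simp
  have "?Z = complex_of_real ` box_spectrum b N"
  proof safe
    fix z assume z: "poly ?p z = 0"
    then have "z \<in> \<real>" using complex_jac_root_real[OF N, of b z] by simp
    then obtain E where E: "z = of_real E" by (elim Reals_cases)
    with z have "E \<in> box_spectrum b N" by (simp add: box_spectrum_def jac_of_real del: jac.simps)
    then show "z \<in> complex_of_real ` box_spectrum b N" using E by blast
  next
    fix E assume "E \<in> box_spectrum b N"
    then show "poly ?p (complex_of_real E) = 0" by (simp add: box_spectrum_def jac_of_real del: jac.simps)
  qed
  then have bij: "bij_betw complex_of_real (box_spectrum b N) ?Z"
    by (simp add: bij_betw_def inj_on_def)
  show "finite (box_spectrum b N)" using bij_betw_finite[OF bij] fin by simp
  show "card (box_spectrum b N) = N" using bij_betw_same_card[OF bij] card by simp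
qed

text \<open>By Bessel's inequality the columns have norm at most \<open>1\<close>; as the total of the squared norms is the number of
  columns, equality holds.\<close>

lemma orthonormal_rows_imp_columns:
  fixes u :: "'a \<Rightarrow> 'b \<Rightarrow> real"
  assumes fin: "finite Z" "finite I" and card: "card Z = card I"
    and orth: "\<And>E E'. E \<in> Z \<Longrightarrow> E' \<in> Z \<Longrightarrow> (\<Sum>i\<in>I. u E i * u E' i) = (if E = E' then 1 else 0)"
    and ij: "i \<in> I" "j \<in> I"
  shows "(\<Sum>E\<in>Z. u E i * u E j) = (if i = j then 1 else 0)"
proof -
  define r where "r i j = (if i = j then 1 else 0) - (\<Sum>E\<in>Z. u E i * u E j)" for i j
  \<comment> \<open>\<open>r i\<close> is the part of the \<open>i\<close>-th unit vector orthogonal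
    to the rows, so this is Pythagoras.\<close>
  have sq: "(\<Sum>j\<in>I. (r i j)\<^sup>2) = 1 - (\<Sum>E\<in>Z. (u E i)\<^sup>2)" if i: "i \<in> I" for i
  proof -
    have "(\<Sum>j\<in>I. (\<Sum>E\<in>Z. u E i * u E j)\<^sup>2) = (\<Sum>j\<in>I. \<Sum>E\<in>Z. \<Sum>E'\<in>Z. u E i * u E' i * (u E j * u E' j))"
      by (simp add: power2_eq_square sum_product mult_ac)
    also have "\<dots> = (\<Sum>E\<in>Z. \<Sum>E'\<in>Z. u E i * u E' i * (\<Sum>j\<in>I. u E j * u E' j))"
      by (subst sum.swap, rule sum.cong[OF refl], subst sum.swap) (simp add: sum_distrib_left)
    also have "\<dots> = (\<Sum>E\<in>Z. \<Sum>E'\<in>Z. if E = E' then u E i * u E' i else 0)"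
      by (intro sum.cong refl) (simp add: orth)
    also have "\<dots> = (\<Sum>E\<in>Z. (u E i)\<^sup>2)"
      using fin by (simp add: power2_eq_square)
    finally have 1: "(\<Sum>j\<in>I. (\<Sum>E\<in>Z. u E i * u E j)\<^sup>2) = (\<Sum>E\<in>Z. (u E i)\<^sup>2)" .
    have "(r i j)\<^sup>2 = (if j = i then 1 - 2 * (\<Sum>E\<in>Z. u E i * u E j) else 0) + (\<Sum>E\<in>Z. u E i * u E j)\<^sup>2" for j
      by (auto simp: r_def power2_eq_square algebra_simps)
    then have "(\<Sum>j\<in>I. (r i j)\<^sup>2) = (1 - 2 * (\<Sum>E\<in>Z. u E i * u E i)) + (\<Sum>E\<in>Z. (u E i)\<^sup>2)"
      using i fin by (simp add: sum.distrib 1)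
    then show ?thesis by (simp add: power2_eq_square)
  qed
  have "(\<Sum>i\<in>I. \<Sum>j\<in>I. (r i j)\<^sup>2) = real (card I) - (\<Sum>i\<in>I. \<Sum>E\<in>Z. (u E i)\<^sup>2)"
    by (simp add: sq sum_subtractf)
  also have "(\<Sum>i\<in>I. \<Sum>E\<in>Z. (u E i)\<^sup>2) = (\<Sum>E\<in>Z. \<Sum>i\<in>I. u E i * u E i)"
    by (subst sum.swap) (simp add: power2_eq_square)
  also have "\<dots> = real (card I)" using card by (simp add: orth)
  finally have "(\<Sum>i\<in>I. \<Sum>j\<in>I. (r i j)\<^sup>2) = 0" by simp
  then have "(\<Sum>j\<in>I. (r i j)\<^sup>2) = 0"
    using ij fin by (subst (asm) sum_nonneg_eq_0_iff) (auto intro: sum_nonneg)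
  then have "(r i j)\<^sup>2 = 0"
    using ij fin by (subst (asm) sum_nonneg_eq_0_iff) auto
  then show ?thesis by (simp add: r_def split: if_splits)
qed

lemma box_orthogonal:
  assumes "E \<in> box_spectrum b N" "E' \<in> box_spectrum b N" "E \<noteq> E'"
  shows "(\<Sum>i=1..N. jac b E i * jac b E' i) = 0"
  using christoffel_darboux[of E E' b N] assms by (simp add: box_spectrum_def del: jac.simps)

lemma box_complete:
  assumes N: "N \<ge> 1" and ij: "i \<in> {1..N}" "j \<in> {1..N}"
  shows "(\<Sum>E\<in>box_spectrum b N. jac b E i * jac b E j / box_norm b N E) = (if i = j then 1 else 0)"
proof -
  define u where "u E i = jac b E i / sqrt (box_norm b N E)" for E i
  have pos: "box_norm b N E > 0" for E by (rule box_norm_pos[OF N])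
  have "(\<Sum>E\<in>box_spectrum b N. u E i * u E j) = (if i = j then 1 else 0)"
  proof (rule orthonormal_rows_imp_columns[where I="{1..N}"])
    fix E E' assume E: "E \<in> box_spectrum b N" "E' \<in> box_spectrum b N"
    have "(\<Sum>i=1..N. u E i * u E' i) = (\<Sum>i=1..N. jac b E i * jac b E' i) / (sqrt (box_norm b N E) * sqrt (box_norm b N E'))"
      by (simp add: u_def sum_divide_distrib)
    also have "\<dots> = (if E = E' then 1 else 0)"
      using box_orthogonal[OF E] pos[of E] by (auto simp: box_norm_def power2_eq_square)
    finally show "(\<Sum>i=1..N. u E i * u E' i) = (if E = E' then 1 else 0)" .
  qed (use ij card_box_spectrum[OF N] in auto)
  moreover have "u E i * u E j = jac b E i * jac b E j / box_norm b N E" for E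
    using pos[of E] by (simp add: u_def)
  ultimately show ?thesis by simp
qed

lemma jac_consecutive_nonzero:
  fixes b :: "nat \<Rightarrow> 'a::comm_ring_1"
  shows "\<not> (jac b E n = 0 \<and> jac b E (Suc n) = 0)"
  by (induction n) auto

text \<open>An eigenvector also solves the recursion from the right end, where it vanishes at
  \<open>N + 1\<close>; the two solutions are proportional, and \<open>i = 1\<close> fixes the
  factor.\<close>

lemma jac_reverse:
  fixes b :: "nat \<Rightarrow> real"
  assumes E: "E \<in> box_spectrum b N" and "i \<le> Suc N"
  shows "jac b E (Suc N - i) = jac b E N * jac (\<lambda>i. b (Suc N - i)) E i"
  using assms(2)
proof (induction i rule: less_induct)
  case (less i)
  consider "i = 0" | "i = 1" | k where "i = Suc (Suc k)" by (metis One_nat_def not0_implies_Suc)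
  then show ?case
  proof cases
    case (3 k)
    define m where "m = N - Suc k"
    have m: "Suc N - k = Suc (Suc m)" "Suc N - Suc k = Suc m" "Suc N - Suc (Suc k) = m" "N - k = Suc m"
      using 3 less.prems by (auto simp: m_def)
    have "jac b E m = (E - b (Suc m)) * jac b E (Suc m) - jac b E (Suc (Suc m))" by simp
    then show ?thesis
      using less.IH[of k] less.IH[of "Suc k"] 3 less.prems unfolding 3 m by (simp add: m algebra_simps)
  qed (use E in \<open>auto simp: box_spectrum_def\<close>)
qed

text \<open>The eigenvalue equation is read at a site where the eigenvector has maximal modulus; its
  two neighbours contribute at most 2.\<close>

lemma box_spectrum_bound:
  assumes E: "E \<in> box_spectrum b N" and N: "N \<ge> 1" and b: "\<And>i. i \<in> {1..N} \<Longrightarrow> \<bar>b i\<bar> \<le> R"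
  shows "\<bar>E\<bar> \<le> R + 2"
proof -
  have "Max ((\<lambda>j. \<bar>jac b E j\<bar>) ` {1..N}) \<in> (\<lambda>j. \<bar>jac b E j\<bar>) ` {1..N}"
    using N by (intro Max_in) auto
  then obtain i where i: "i \<in> {1..N}" and m: "Max ((\<lambda>j. \<bar>jac b E j\<bar>) ` {1..N}) = \<bar>jac b E i\<bar>" by blast
  have max: "\<bar>jac b E j\<bar> \<le> \<bar>jac b E i\<bar>" if "j \<in> {1..N}" for j
    unfolding m[symmetric] using that by (intro Max_ge) auto
  have max': "\<bar>jac b E j\<bar> \<le> \<bar>jac b E i\<bar>" if "j \<le> Suc N" for j
    using that E max[of j] by (cases "j = 0"; cases "j = Suc N") (auto simp: box_spectrum_def simp del: jac.simps(3))
  have pos: "\<bar>jac b E i\<bar> > 0" using max[of 1] N by auto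
  obtain k where k: "i = Suc k" using i by (cases i) auto
  have "E * jac b E i = b i * jac b E i + jac b E (Suc i) + jac b E k" unfolding k by (simp add: algebra_simps)
  then have "\<bar>E\<bar> * \<bar>jac b E i\<bar> \<le> \<bar>b i\<bar> * \<bar>jac b E i\<bar> + \<bar>jac b E (Suc i)\<bar> + \<bar>jac b E k\<bar>"
    unfolding abs_mult[symmetric] by linarith
  also have "\<dots> \<le> R * \<bar>jac b E i\<bar> + \<bar>jac b E i\<bar> + \<bar>jac b E i\<bar>"
    using i k by (intro add_mono mult_right_mono b max') auto
  finally have "\<bar>E\<bar> * \<bar>jac b E i\<bar> \<le> (R + 2) * \<bar>jac b E i\<bar>" by (simp add: algebra_simps)
  then show ?thesis using pos by simp
qed

text \<open>The numerator in the quotient rule is minus the confluent Christoffel-Darboux sum, so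
  the quotient decreases and \<open>site_map\<close> increases away from its poles.\<close>

lemma jac_ratio_deriv:
  fixes b :: "nat \<Rightarrow> real"
  assumes "jac b E (Suc n) \<noteq> 0"
  shows "((\<lambda>E. jac b E n / jac b E (Suc n)) has_real_derivative - box_norm b n E / (jac b E (Suc n))\<^sup>2) (at E)"
proof -
  have d: "((\<lambda>E. jac b E n) has_real_derivative poly (pderiv (jac_poly b n)) E) (at E)" for n
    using poly_DERIV[of "jac_poly b n" E] by simp
  have "box_norm b n E = poly (pderiv (jac_poly b (Suc n))) E * jac b E n - poly (pderiv (jac_poly b n)) E * jac b E (Suc n)"
    using arg_cong[OF christoffel_darboux_pderiv[of b n], of "\<lambda>p. poly p E"]
    by (simp add: poly_sum box_norm_def del: jac.simps)
  then have num: "- box_norm b n E = poly (pderiv (jac_poly b n)) E * jac b E (Suc n) - jac b E n * poly (pderiv (jac_poly b (Suc n))) E"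
    by simp
  show ?thesis
    unfolding num power2_eq_square by (rule DERIV_divide[OF d d assms])
qed

text \<open>The value of the potential at the centre \<open>L + 1\<close> for which \<open>E\<close> is an eigenvalue of the box, where \<open>b\<close> and \<open>b'\<close> list the
  potential from the two ends towards the centre. The convention \<open>x / 0 = 0\<close> at the finitely many poles is harmless.\<close>

definition site_map :: "(nat \<Rightarrow> real) \<Rightarrow> (nat \<Rightarrow> real) \<Rightarrow> nat \<Rightarrow> real \<Rightarrow> real" where
  "site_map b b' L E = E - jac b E L / jac b E (Suc L) - jac b' E L / jac b' E (Suc L)"

text \<open>The derivative collects the squared norm of the eigenvector, left of the centre, at it
  and right of it, relative to the value at the centre. It is the reciprocal of the Feynman-Hellmann
  formula for the change of an eigenvalue with the central potential.\<close>

lemma site_map_at_eigenvalue: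
  fixes b :: "nat \<Rightarrow> real" and L :: nat
  defines "N \<equiv> Suc (2 * L)"
  defines "b' \<equiv> \<lambda>i. b (Suc N - i)"
  assumes E: "E \<in> box_spectrum b N" and nz: "jac b E (Suc L) \<noteq> 0"
  shows "site_map b b' L E = b (Suc L)"
    and "(site_map b b' L has_real_derivative box_norm b N E / (jac b E (Suc L))\<^sup>2) (at E)"
proof -
  have N: "N \<ge> 1" by (simp add: N_def)
  have qN: "jac b E N \<noteq> 0"
    using jac_consecutive_nonzero[of b E N] E by (auto simp: box_spectrum_def)
  have rev: "jac b E (Suc N - i) = jac b E N * jac b' E i" if "i \<le> Suc N" for i
    unfolding b'_def by (rule jac_reverse[OF E that])
  have r1: "jac b E (Suc L) = jac b E N * jac b' E (Suc L)" using rev[of "Suc L"] by (simp add: N_def)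
  have r2: "jac b E (Suc (Suc L)) = jac b E N * jac b' E L" using rev[of L] by (simp add: N_def Suc_diff_le)
  have nz': "jac b' E (Suc L) \<noteq> 0" using r1 nz by auto
  have ratio: "jac b' E L / jac b' E (Suc L) = jac b E (Suc (Suc L)) / jac b E (Suc L)"
    unfolding r1 r2 using qN by simp
  show "site_map b b' L E = b (Suc L)"
    unfolding site_map_def ratio using nz by (simp add: field_simps)
  have split: "box_norm b N E = box_norm b L E + (jac b E (Suc L))\<^sup>2 + (jac b E N)\<^sup>2 * box_norm b' L E"
  proof -
    have "{1..N} = {1..L} \<union> {Suc L} \<union> {Suc (Suc L)..N}" by (auto simp: N_def)
    then have "box_norm b N E = box_norm b L E + (jac b E (Suc L))\<^sup>2 + (\<Sum>i=Suc (Suc L)..N. (jac b E i)\<^sup>2)"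
      unfolding box_norm_def by (simp only:) (subst sum.union_disjoint; auto)+
    also have "(\<Sum>i=Suc (Suc L)..N. (jac b E i)\<^sup>2) = (\<Sum>i=1..L. (jac b E N * jac b' E i)\<^sup>2)"
      by (rule sum.reindex_bij_witness[of _ "\<lambda>i. Suc N - i" "\<lambda>i. Suc N - i"])
         (auto simp: N_def rev[unfolded N_def, symmetric])
    finally show ?thesis by (simp add: box_norm_def power_mult_distrib sum_distrib_left)
  qed
  have "(site_map b b' L has_real_derivative 1 - - box_norm b L E / (jac b E (Suc L))\<^sup>2 - - box_norm b' L E / (jac b' E (Suc L))\<^sup>2) (at E)"
    unfolding site_map_def[abs_def]
    by (intro derivative_intros jac_ratio_deriv nz nz')
  also have "1 - - box_norm b L E / (jac b E (Suc L))\<^sup>2 - - box_norm b' L E / (jac b' E (Suc L))\<^sup>2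
     = box_norm b N E / (jac b E (Suc L))\<^sup>2"
    unfolding split using nz nz' qN unfolding r1 by (simp add: field_simps power_mult_distrib del: jac.simps)
  finally show "(site_map b b' L has_real_derivative box_norm b N E / (jac b E (Suc L))\<^sup>2) (at E)" .
qed

section \<open>Spectral averaging\<close>

text \<open>A one-sided area formula: near a simple solution \<open>E\<close> of \<open>v x = y\<close>, the set where \<open>v\<close> is within \<open>\<epsilon>\<close> of \<open>y\<close>
  contains an interval of length about \<open>2 * \<epsilon> / v' E\<close>.\<close>

lemma sum_over_level_set_le_liminf:
  fixes v g :: "real \<Rightarrow> real"
  assumes Z: "finite Z" and g0: "\<And>x. g x \<ge> 0" and U: "open U" "Z \<subseteq> U"
    and vE: "\<And>E. E \<in> Z \<Longrightarrow> v E = y" and dv: "\<And>E. E \<in> Z \<Longrightarrow> (v has_real_derivative D E) (at E)"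
    and D: "\<And>E. E \<in> Z \<Longrightarrow> D E > 0" and cg: "\<And>E. E \<in> Z \<Longrightarrow> isCont g E"
  shows "ennreal (\<Sum>E\<in>Z. g E / D E)
    \<le> liminf (\<lambda>n. ennreal (real (Suc n) / 2) *
         (\<integral>\<^sup>+x\<in>U. ennreal (g x) * indicator {x. \<bar>v x - y\<bar> < 1 / real (Suc n)} x \<partial>lborel))"
    (is "_ \<le> liminf ?I")
proof -
  have null: "(\<lambda>n. 1 / real (Suc n)) \<longlonglongrightarrow> 0"
    using LIMSEQ_inverse_real_of_nat by (simp add: inverse_eq_divide)
  \<comment> \<open>A version with slack \<eta> in both the value of \<open>g\<close> and the slope
    of \<open>v\<close>, to be removed at the end; the positive part is taken because
    \<open>g E - \<eta>\<close> may be negative.\<close>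
  define f where "f \<eta> = (\<Sum>E\<in>Z. max 0 (g E - \<eta>) / (D E + \<eta>))" for \<eta>
  have bound: "ennreal (f \<eta>) \<le> liminf ?I" if \<eta>: "\<eta> > 0" for \<eta>
  proof (rule Liminf_bounded)
    \<comment> \<open>Near \<open>E\<close> the difference quotient of \<open>v\<close> is at most
      \<open>D E + \<eta>\<close>, so on this radius \<open>v\<close> stays within
      \<open>1 / (n + 1)\<close> of \<open>y\<close>; the length \<open>2 * r n E\<close> cancels
      the prefactor.\<close>
    define r where "r n E = 1 / real (Suc n) / (D E + \<eta>)" for n E
    have r0: "(\<lambda>n. r n E) \<longlonglongrightarrow> 0" if "E \<in> Z" for E
      unfolding r_def using tendsto_divide[OF null tendsto_const, of "D E + \<eta>"] D[OF that] \<eta> by simp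
    have local: "eventually (\<lambda>n. \<forall>x. \<bar>x - E\<bar> < r n E \<longrightarrow>
        x \<in> U \<and> g E - \<eta> \<le> g x \<and> \<bar>v x - y\<bar> < 1 / real (Suc n)) sequentially" if E: "E \<in> Z" for E
    proof -
      have "((\<lambda>x. (v x - v E) / (x - E)) \<longlongrightarrow> D E) (at E)"
        using dv[OF E] by (simp add: has_field_derivative_iff)
      then have "eventually (\<lambda>x. dist ((v x - v E) / (x - E)) (D E) < \<eta>) (at E)"
        using \<eta> by (rule tendstoD)
      then obtain d1 where d1: "d1 > 0" "\<And>x. x \<noteq> E \<Longrightarrow> dist x E < d1 \<Longrightarrow> dist ((v x - v E) / (x - E)) (D E) < \<eta>"
        unfolding eventually_at by auto
      have "(g \<longlongrightarrow> g E) (nhds E)" using cg[OF E] by (simp add: isCont_def tendsto_at_iff_tendsto_nhds)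
      then have "eventually (\<lambda>x. g E - \<eta> < g x) (nhds E)" using \<eta> by (intro order_tendstoD) auto
      moreover have "eventually (\<lambda>x. x \<in> U) (nhds E)" using U E by (intro eventually_nhds_in_open) auto
      ultimately have "eventually (\<lambda>x. g E - \<eta> < g x \<and> x \<in> U) (nhds E)" by eventually_elim auto
      then obtain d2 where d2: "d2 > 0" "\<And>x. dist x E < d2 \<Longrightarrow> g E - \<eta> < g x \<and> x \<in> U"
        unfolding eventually_nhds_metric by auto
      have "eventually (\<lambda>n. r n E < min d1 d2) sequentially"
        using r0[OF E] d1 d2 by (intro order_tendstoD) auto
      then show ?thesis
      proof eventually_elim
        fix n assume n: "r n E < min d1 d2"
        show "\<forall>x. \<bar>x - E\<bar> < r n E \<longrightarrow> x \<in> U \<and> g E - \<eta> \<le> g x \<and> \<bar>v x - y\<bar> < 1 / real (Suc n)"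
        proof (intro allI impI)
          fix x assume x: "\<bar>x - E\<bar> < r n E"
          have "\<bar>v x - y\<bar> < 1 / real (Suc n)"
          proof (cases "x = E")
            case False
            have "dist x E < d1" using x n by (simp add: dist_real_def)
            from d1(2)[OF False this] have "\<bar>(v x - v E) / (x - E)\<bar> \<le> D E + \<eta>"
              unfolding dist_real_def using D[OF E] by linarith
            then have "\<bar>v x - v E\<bar> \<le> (D E + \<eta>) * \<bar>x - E\<bar>"
              using False by (simp add: abs_divide divide_le_eq)
            also have "\<dots> < (D E + \<eta>) * r n E"
              using x D[OF E] \<eta> by (intro mult_strict_left_mono) auto
            also have "\<dots> = 1 / real (Suc n)" unfolding r_def using D[OF E] \<eta> by simp
            finally show ?thesis using vE[OF E] by simp
          qed (use vE[OF E] in simp)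
          then show "x \<in> U \<and> g E - \<eta> \<le> g x \<and> \<bar>v x - y\<bar> < 1 / real (Suc n)"
            using d2(2)[of x] x n by (auto simp: dist_real_def)
        qed
      qed
    qed
    have sep: "eventually (\<lambda>n. r n E + r n E' < \<bar>E - E'\<bar>) sequentially" if "E \<in> Z" "E' \<in> Z" "E \<noteq> E'" for E E'
      using tendsto_add[OF r0[OF that(1)] r0[OF that(2)]] that by (intro order_tendstoD) auto
    have "eventually (\<lambda>n. \<forall>E\<in>Z. \<forall>x. \<bar>x - E\<bar> < r n E \<longrightarrow>
        x \<in> U \<and> g E - \<eta> \<le> g x \<and> \<bar>v x - y\<bar> < 1 / real (Suc n)) sequentially"
      by (rule eventually_ball_finite[OF Z]) (use local in blast)
    moreover have "eventually (\<lambda>n. \<forall>E\<in>Z. \<forall>E'\<in>Z. E \<noteq> E' \<longrightarrow> r n E + r n E' < \<bar>E - E'\<bar>) sequentially"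
    proof (intro eventually_ball_finite Z ballI)
      fix E E' assume "E \<in> Z" "E' \<in> Z"
      then show "eventually (\<lambda>n. E \<noteq> E' \<longrightarrow> r n E + r n E' < \<bar>E - E'\<bar>) sequentially"
        using sep[of E E'] by (cases "E = E'") auto
    qed
    ultimately show "eventually (\<lambda>n. ennreal (f \<eta>) \<le> ?I n) sequentially"
    proof eventually_elim
      fix n assume loc: "\<forall>E\<in>Z. \<forall>x. \<bar>x - E\<bar> < r n E \<longrightarrow>
          x \<in> U \<and> g E - \<eta> \<le> g x \<and> \<bar>v x - y\<bar> < 1 / real (Suc n)"
        and sp: "\<forall>E\<in>Z. \<forall>E'\<in>Z. E \<noteq> E' \<longrightarrow> r n E + r n E' < \<bar>E - E'\<bar>"
      have rp: "r n E > 0" if "E \<in> Z" for E using D[OF that] \<eta> by (simp add: r_def)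
      define J where "J E = ball E (r n E)" for E
      have [measurable]: "J E \<in> sets borel" for E by (simp add: J_def)
      have J: "x \<in> J E \<longleftrightarrow> \<bar>x - E\<bar> < r n E" for x E by (simp add: J_def dist_real_def abs_minus_commute)
      have pt: "(\<Sum>E\<in>Z. ennreal (max 0 (g E - \<eta>)) * indicator (J E) x)
         \<le> ennreal (g x) * indicator {x. \<bar>v x - y\<bar> < 1 / real (Suc n)} x * indicator U x" for x
      proof (cases "\<exists>E\<in>Z. x \<in> J E")
        case True
        then obtain E where E: "E \<in> Z" "\<bar>x - E\<bar> < r n E" by (auto simp: J)
        have other: "x \<notin> J E'" if "E' \<in> Z" "E' \<noteq> E" for E'
        proof
          assume "x \<in> J E'"
          then have "\<bar>x - E'\<bar> < r n E'" by (simp add: J)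
          moreover have "r n E + r n E' < \<bar>E - E'\<bar>" using sp that E by auto
          ultimately show False using E(2) by linarith
        qed
        define h where "h E' = ennreal (max 0 (g E' - \<eta>)) * indicator (J E') x" for E'
        have "(\<Sum>E'\<in>Z. h E') = (\<Sum>E'\<in>{E}. h E')"
          by (rule sum.mono_neutral_right) (use Z E other in \<open>auto simp: h_def\<close>)
        also have "(\<Sum>E'\<in>{E}. h E') = h E" by simp
        also have "h E \<le> ennreal (max 0 (g E - \<eta>))" by (simp add: h_def split: split_indicator)
        also have "\<dots> \<le> ennreal (g x)" using loc E g0[of x] by (intro ennreal_leI) auto
        finally show ?thesis unfolding h_def using loc E by auto
      next
        case False
        then have "(\<Sum>E\<in>Z. ennreal (max 0 (g E - \<eta>)) * indicator (J E) x) = 0"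
          by (intro sum.neutral) auto
        then show ?thesis by simp
      qed
      have "(\<Sum>E\<in>Z. ennreal (max 0 (g E - \<eta>)) * ennreal (2 * r n E))
         = (\<Sum>E\<in>Z. \<integral>\<^sup>+x. ennreal (max 0 (g E - \<eta>)) * indicator (J E) x \<partial>lborel)"
      proof (rule sum.cong[OF refl])
        fix E assume "E \<in> Z"
        then have em: "emeasure lborel (J E) = ennreal (2 * r n E)"
          using rp[of E] by (simp add: J_def ball_eq_greaterThanLessThan)
        show "ennreal (max 0 (g E - \<eta>)) * ennreal (2 * r n E)
           = (\<integral>\<^sup>+x. ennreal (max 0 (g E - \<eta>)) * indicator (J E) x \<partial>lborel)"
          unfolding em[symmetric] by (rule nn_integral_cmult_indicator[symmetric]) (simp add: J_def)
      qed
      also have "\<dots> = (\<integral>\<^sup>+x. (\<Sum>E\<in>Z. ennreal (max 0 (g E - \<eta>)) * indicator (J E) x) \<partial>lborel)"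
        by (rule nn_integral_sum[symmetric]) measurable
      finally have e1: "(\<Sum>E\<in>Z. ennreal (max 0 (g E - \<eta>)) * ennreal (2 * r n E))
         = (\<integral>\<^sup>+x. (\<Sum>E\<in>Z. ennreal (max 0 (g E - \<eta>)) * indicator (J E) x) \<partial>lborel)" .
      have "ennreal (f \<eta>) = ennreal (real (Suc n) / 2) * (\<Sum>E\<in>Z. ennreal (max 0 (g E - \<eta>)) * ennreal (2 * r n E))"
      proof -
        have "(\<Sum>E\<in>Z. ennreal (max 0 (g E - \<eta>)) * ennreal (2 * r n E)) = ennreal (\<Sum>E\<in>Z. max 0 (g E - \<eta>) * (2 * r n E))"
          using rp by (subst sum_ennreal[symmetric]) (auto intro!: sum.cong simp: ennreal_mult less_imp_le)
        also have "ennreal (real (Suc n) / 2) * \<dots> = ennreal (real (Suc n) / 2 * (\<Sum>E\<in>Z. max 0 (g E - \<eta>) * (2 * r n E)))"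
          using rp by (intro ennreal_mult[symmetric] sum_nonneg) (auto simp: less_imp_le)
        also have "real (Suc n) / 2 * (\<Sum>E\<in>Z. max 0 (g E - \<eta>) * (2 * r n E)) = f \<eta>"
          unfolding f_def sum_distrib_left
        proof (rule sum.cong[OF refl])
          have *: "N / 2 * (m * (2 * (1 / N / d))) = m / d" if "N \<noteq> 0" for N m d :: real
            using that by simp
          fix E
          show "real (Suc n) / 2 * (max 0 (g E - \<eta>) * (2 * r n E)) = max 0 (g E - \<eta>) / (D E + \<eta>)"
            unfolding r_def by (rule *) simp
        qed
        finally show ?thesis by (rule sym)
      qed
      also have "\<dots> \<le> ?I n" unfolding e1
        by (intro mult_left_mono nn_integral_mono pt) auto
      finally show "ennreal (f \<eta>) \<le> ?I n" .
    qed
  qed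
  have "(\<lambda>k. f (1 / real (Suc k))) \<longlonglongrightarrow> (\<Sum>E\<in>Z. max 0 (g E - 0) / (D E + 0))"
    unfolding f_def using D by (intro tendsto_sum tendsto_divide tendsto_max tendsto_diff tendsto_add tendsto_const null) force
  then have "(\<lambda>k. ennreal (f (1 / real (Suc k)))) \<longlonglongrightarrow> ennreal (\<Sum>E\<in>Z. g E / D E)"
    using g0 by (intro tendsto_ennrealI) (simp add: max_def)
  then show ?thesis
    by (rule LIMSEQ_le_const2) (auto intro!: bound simp del: of_nat_Suc)
qed

lemma jac_measurable:
  assumes "\<And>i. (\<lambda>x. b x i) \<in> borel_measurable N" "e \<in> borel_measurable N"
  shows "(\<lambda>x. jac (b x) (e x) n :: real) \<in> borel_measurable N"
proof (induction n rule: less_induct)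
  case (less n)
  note [measurable] = assms
  consider "n = 0" | "n = Suc 0" | k where "n = Suc (Suc k)" by (metis not0_implies_Suc)
  then show ?case
  proof cases
    case (3 k)
    have [measurable]: "(\<lambda>x. jac (b x) (e x) k) \<in> borel_measurable N" "(\<lambda>x. jac (b x) (e x) (Suc k)) \<in> borel_measurable N"
      using less[of k] less[of "Suc k"] 3 by auto
    show ?thesis unfolding 3 jac.simps(3) by measurable
  qed simp_all
qed

section \<open>Solutions compared with their size at the centre\<close>

definition jac_vec :: "(nat \<Rightarrow> real) \<Rightarrow> real \<Rightarrow> nat \<Rightarrow> real \<times> real" where
  "jac_vec b E n = (jac b E (Suc n), jac b E n)"

lemma jac_vec_Suc: "jac_vec b E (Suc n) = tm E (b (Suc n)) (jac_vec b E n)"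
  by (simp add: jac_vec_def tm_def)

lemma jac_vec_nonzero [simp]: "jac_vec b E n \<noteq> 0"
  using jac_consecutive_nonzero[of b E n] by (auto simp: jac_vec_def zero_prod_def)

lemma jac_vec_measurable:
  assumes "\<And>i. (\<lambda>x. b x i) \<in> borel_measurable N" "e \<in> borel_measurable N"
  shows "(\<lambda>x. jac_vec (b x) (e x) n) \<in> borel_measurable N"
  unfolding jac_vec_def by (intro borel_measurable_Pair jac_measurable assms)

lemma jac_vec_cong: "(\<And>i. 1 \<le> i \<Longrightarrow> i \<le> n \<Longrightarrow> b i = b' i) \<Longrightarrow> jac_vec b E n = jac_vec b' E n"
  unfolding jac_vec_def by (intro arg_cong2[of _ _ _ _ Pair] jac_cong) auto

text \<open>Here \<open>b\<close> enumerates the potential from an end of the box towards its centre \<open>L + 1\<close>, so these ratios compare a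
  solution at distance \<open>n\<close> from the centre with its size at the centre.\<close>

definition end_ratio :: "real \<Rightarrow> (nat \<Rightarrow> real) \<Rightarrow> nat \<Rightarrow> nat \<Rightarrow> real \<Rightarrow> real" where
  "end_ratio s b L i E = (\<bar>jac b E i\<bar> / norm (jac_vec b E L)) powr s"

text \<open>A bound on this one number, uniform in \<open>L\<close>, amounts to decay at rate \<rho>
  for the powers of the solution at all distances from the centre.\<close>

definition weighted_ratio :: "real \<Rightarrow> real \<Rightarrow> (nat \<Rightarrow> real) \<Rightarrow> nat \<Rightarrow> real \<Rightarrow> real" where
  "weighted_ratio s \<rho> b L E = (\<Sum>n=1..L. (1 / \<rho>) ^ n * end_ratio s b L (Suc L - n) E)"

lemma weighted_ratio_nonneg: "\<rho> > 0 \<Longrightarrow> weighted_ratio s \<rho> b L E \<ge> 0"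
  unfolding weighted_ratio_def end_ratio_def by (intro sum_nonneg) auto

lemma weighted_ratio_measurable:
  assumes "\<And>i. (\<lambda>x. b x i) \<in> borel_measurable N" "e \<in> borel_measurable N"
  shows "(\<lambda>x. weighted_ratio s \<rho> (b x) L (e x)) \<in> borel_measurable N"
proof -
  have [measurable]: "(\<lambda>x. jac (b x) (e x) i) \<in> borel_measurable N" for i by (rule jac_measurable[OF assms])
  have [measurable]: "(\<lambda>x. jac_vec (b x) (e x) i) \<in> borel_measurable N" for i by (rule jac_vec_measurable[OF assms])
  show ?thesis unfolding weighted_ratio_def end_ratio_def by measurable
qed

lemma isCont_jac: "isCont (\<lambda>E. jac b E n :: real) E"
  using poly_isCont[of E "jac_poly b n"] by simp

lemma isCont_weighted_ratio:
  assumes "s > 0"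
  shows "isCont (weighted_ratio s \<rho> b L) E"
proof -
  have c: "continuous_on UNIV (\<lambda>E. jac b E n)" for n
    by (intro continuous_at_imp_continuous_on ballI isCont_jac)
  have n0: "norm (jac b E (Suc L), jac b E L) \<noteq> 0" for E
    using jac_vec_nonzero[of b E L] unfolding jac_vec_def by simp
  have "continuous_on UNIV (weighted_ratio s \<rho> b L)"
    unfolding weighted_ratio_def end_ratio_def jac_vec_def
    by (intro continuous_on_sum continuous_on_mult continuous_on_const continuous_on_powr' continuous_on_divide
      continuous_on_norm continuous_on_Pair c continuous_on_rabs) (use assms n0 in auto)
  then show ?thesis by (simp add: continuous_on_eq_continuous_at)
qed

lemma weighted_ratio_cong:
  "(\<And>i. 1 \<le> i \<Longrightarrow> i \<le> L \<Longrightarrow> b i = b' i) \<Longrightarrow> weighted_ratio s \<rho> b L E = weighted_ratio s \<rho> b' L E"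
  unfolding weighted_ratio_def end_ratio_def
  by (intro sum.cong refl arg_cong2[of _ _ _ _ "(*)"] arg_cong2[of _ _ _ _ "(powr)"] arg_cong2[of _ _ _ _ "(/)"]
      arg_cong[of _ _ abs] arg_cong[of _ _ norm] jac_cong jac_vec_cong) auto

text \<open>\<open>M\<close> stands for \<nu> restricted to its support, whose product is the
  disorder measure: there every sample value obeys the bound \<open>R\<close>. Integrals are carried
  over to \<nu> on the whole line through \<open>distr_M\<close>.\<close>

locale product_site = single_site +
  fixes M :: "real measure"
  assumes prob_M: "prob_space M" and id_M: "(\<lambda>x. x) \<in> borel_measurable M" and distr_M: "distr M borel (\<lambda>x. x) = \<nu>"
    and space_M: "\<And>x. x \<in> space M \<Longrightarrow> \<bar>x\<bar> \<le> R"
begin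

section \<open>Independence as resampling of one coordinate\<close>

abbreviation \<Omega> :: "(int \<Rightarrow> real) measure" where "\<Omega> \<equiv> Pi\<^sub>M UNIV (\<lambda>_. M)"

sublocale P: prob_space \<Omega> by (rule prob_space_PiM) (rule prob_M)

lemma nn_integral_M:
  assumes "h \<in> borel_measurable borel"
  shows "(\<integral>\<^sup>+x. h x \<partial>M) = (\<integral>\<^sup>+x. h x \<partial>\<nu>)"
  unfolding distr_M[symmetric] using assms id_M by (subst nn_integral_distr) auto

lemma nn_integral_M_transfer:
  assumes [measurable]: "F \<in> borel_measurable borel"
  shows "(\<integral>\<^sup>+x. a * F (tm E x w) \<partial>M) = a * transfer E F w"
proof -
  have "(\<integral>\<^sup>+x. a * F (tm E x w) \<partial>M) = (\<integral>\<^sup>+x. a * F (tm E x w) \<partial>\<nu>)"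
    by (rule nn_integral_M) measurable
  also have "\<dots> = a * transfer E F w"
    unfolding transfer_def by (rule nn_integral_cmult) measurable
  finally show ?thesis .
qed

lemma coordinate_measurable [measurable]: "(\<lambda>\<omega>. \<omega> i) \<in> borel_measurable \<Omega>"
  by (rule measurable_compose[OF measurable_component_singleton[of i UNIV "\<lambda>_. M"] id_M]) simp

text \<open>Replacing a coordinate by an independent copy preserves the product measure. This takes
  the place of conditional expectations given all other coordinates.\<close>

lemma nn_integral_resample:
  assumes [measurable]: "f \<in> borel_measurable \<Omega>"
  shows "(\<integral>\<^sup>+\<omega>. f \<omega> \<partial>\<Omega>) = (\<integral>\<^sup>+\<omega>. \<integral>\<^sup>+x. f (fun_upd \<omega> i x) \<partial>M \<partial>\<Omega>)"
proof -
  interpret M: prob_space M by (rule prob_M)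
  interpret pair_sigma_finite M \<Omega> ..
  have m: "(\<lambda>(x, X). fun_upd X i x) \<in> measurable (M \<Otimes>\<^sub>M \<Omega>) \<Omega>"
    unfolding split_beta' by (rule measurable_fun_upd[where J=UNIV]) auto
  have "\<Omega> = distr (M \<Otimes>\<^sub>M \<Omega>) \<Omega> (\<lambda>(x, X). fun_upd X i x)"
    using distr_pair_PiM_eq_PiM[of UNIV "\<lambda>_. M" i] prob_M by simp
  then have "(\<integral>\<^sup>+\<omega>. f \<omega> \<partial>\<Omega>) = (\<integral>\<^sup>+\<omega>. f \<omega> \<partial>distr (M \<Otimes>\<^sub>M \<Omega>) \<Omega> (\<lambda>(x, X). fun_upd X i x))"
    by simp
  also have "\<dots> = (\<integral>\<^sup>+z. f ((\<lambda>(x, X). fun_upd X i x) z) \<partial>(M \<Otimes>\<^sub>M \<Omega>))"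
    by (rule nn_integral_distr[OF m]) measurable
  also have "\<dots> = (\<integral>\<^sup>+\<omega>. \<integral>\<^sup>+x. f ((\<lambda>(x, X). fun_upd X i x) (x, \<omega>)) \<partial>M \<partial>\<Omega>)"
    by (rule nn_integral_snd[symmetric], rule measurable_compose[OF m]) measurable
  finally show ?thesis by simp
qed

text \<open>The sites \<open>i + k\<close>, ..., \<open>i + 1\<close> are integrated out one at a
  time, last first. The final vector depends on the last site through a single step, and by
  injectivity of \<open>c\<close> the earlier vectors do not involve that site.\<close>

lemma moment_transfer:
  assumes inj: "inj_on c {1..i + k}" and [measurable]: "a \<in> borel_measurable borel" "F \<in> borel_measurable borel"
  shows "(\<integral>\<^sup>+\<omega>. a (jac_vec (\<lambda>j. \<omega> (c j)) E i) * F (jac_vec (\<lambda>j. \<omega> (c j)) E (i + k)) \<partial>\<Omega>)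
    = (\<integral>\<^sup>+\<omega>. a (jac_vec (\<lambda>j. \<omega> (c j)) E i) * (transfer E ^^ k) F (jac_vec (\<lambda>j. \<omega> (c j)) E i) \<partial>\<Omega>)"
  using assms(1,3)
proof (induction k arbitrary: F)
  case (Suc k)
  note [measurable] = \<open>F \<in> borel_measurable borel\<close>
  let ?v = "\<lambda>\<omega>. jac_vec (\<lambda>j. \<omega> (c j)) E"
  have [measurable]: "(\<lambda>\<omega>. ?v \<omega> n) \<in> borel_measurable \<Omega>" for n by (rule jac_vec_measurable) measurable
  let ?s = "c (i + Suc k)"
  have upd: "?v (fun_upd \<omega> ?s x) n = ?v \<omega> n" if "n \<le> i + k" for \<omega> x n
    using that inj_onD[OF Suc.prems(1)] by (intro jac_vec_cong) fastforce
  have upd': "?v (fun_upd \<omega> ?s x) (i + Suc k) = tm E x (?v \<omega> (i + k))" for \<omega> x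
    using upd[of "i + k" \<omega> x] by (simp add: jac_vec_Suc)
  have "(\<integral>\<^sup>+\<omega>. a (?v \<omega> i) * F (?v \<omega> (i + Suc k)) \<partial>\<Omega>)
     = (\<integral>\<^sup>+\<omega>. \<integral>\<^sup>+x. a (?v \<omega> i) * F (tm E x (?v \<omega> (i + k))) \<partial>M \<partial>\<Omega>)"
    by (subst nn_integral_resample[of _ ?s]) (auto simp only: upd upd' le_add1 intro!: measurable, measurable)
  also have "\<dots> = (\<integral>\<^sup>+\<omega>. a (?v \<omega> i) * transfer E F (?v \<omega> (i + k)) \<partial>\<Omega>)"
    by (simp add: nn_integral_M_transfer)
  also have "\<dots> = (\<integral>\<^sup>+\<omega>. a (?v \<omega> i) * (transfer E ^^ k) (transfer E F) (?v \<omega> i) \<partial>\<Omega>)"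
    by (rule Suc.IH) (use Suc.prems in \<open>auto intro: inj_on_subset\<close>)
  finally show ?case by (simp add: funpow_swap1)
qed simp

end

text \<open>The sites \<open>a - L\<close>, ..., \<open>a + L\<close> are numbered from 1 to
  \<open>2 * L + 1\<close>, so the centre \<open>a\<close> has index \<open>L + 1\<close>.\<close>

definition box_potential :: "int \<Rightarrow> nat \<Rightarrow> (int \<Rightarrow> real) \<Rightarrow> nat \<Rightarrow> real" where
  "box_potential a L \<omega> i = \<omega> (a - int (Suc L) + int i)"

definition box_potential_rev :: "int \<Rightarrow> nat \<Rightarrow> (int \<Rightarrow> real) \<Rightarrow> nat \<Rightarrow> real" where
  "box_potential_rev a L \<omega> i = box_potential a L \<omega> (Suc (Suc (2 * L)) - i)"

definition decay_weight :: "real \<Rightarrow> real \<Rightarrow> int \<Rightarrow> nat \<Rightarrow> (int \<Rightarrow> real) \<Rightarrow> real \<Rightarrow> real" where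
  "decay_weight s \<rho> a L \<omega> E =
     weighted_ratio s \<rho> (box_potential a L \<omega>) L E + weighted_ratio s \<rho> (box_potential_rev a L \<omega>) L E"

text \<open>The quotients are the spectral weights of the unit vector at \<open>a\<close> in the
  box, which sum to 1; the correlator is the mean of \<open>decay_weight\<close> under the spectral
  measure at \<open>a\<close>.\<close>

definition box_correlator :: "real \<Rightarrow> real \<Rightarrow> int \<Rightarrow> nat \<Rightarrow> (int \<Rightarrow> real) \<Rightarrow> real" where
  "box_correlator s \<rho> a L \<omega> =
     (let b = box_potential a L \<omega>; N = Suc (2 * L) in
      \<Sum>E\<in>box_spectrum b N. (jac b E (Suc L))\<^sup>2 / box_norm b N E * decay_weight s \<rho> a L \<omega> E)"

text \<open>An approximate delta function of height \<open>(n + 1) / 2\<close> replaces the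
  eigenvalue condition \<open>site_map E = \<omega> a\<close>, so that \<omega> can be integrated at
  fixed \<open>E\<close>.\<close>

definition smeared_correlator :: "real \<Rightarrow> real \<Rightarrow> real \<Rightarrow> int \<Rightarrow> nat \<Rightarrow> (int \<Rightarrow> real) \<Rightarrow> nat \<Rightarrow> ennreal" where
  "smeared_correlator s \<rho> Q a L \<omega> n = ennreal (real (Suc n) / 2) *
     (\<integral>\<^sup>+E. ennreal (decay_weight s \<rho> a L \<omega> E) *
        indicator {t. \<bar>t\<bar> < 1 / real (Suc n)} (site_map (box_potential a L \<omega>) (box_potential_rev a L \<omega>) L E - \<omega> a) *
        indicator {-Q<..<Q} E \<partial>lborel)"

lemma box_potential_center [simp]: "box_potential a L \<omega> (Suc L) = \<omega> a"
  by (simp add: box_potential_def)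

lemma decay_weight_nonneg: "\<rho> > 0 \<Longrightarrow> decay_weight s \<rho> a L \<omega> E \<ge> 0"
  unfolding decay_weight_def by (intro add_nonneg_nonneg weighted_ratio_nonneg)

lemma box_correlator_le_smeared:
  assumes s: "s > 0" and \<rho>: "\<rho> > 0" and \<omega>: "\<And>i. \<bar>\<omega> i\<bar> \<le> R" and Q: "R + 2 < Q"
  shows "ennreal (box_correlator s \<rho> a L \<omega>) \<le> liminf (smeared_correlator s \<rho> Q a L \<omega>)"
proof -
  define b where "b = box_potential a L \<omega>"
  define b' where "b' = box_potential_rev a L \<omega>"
  define N where "N = Suc (2 * L)"
  \<comment> \<open>Eigenvalues whose eigenvector vanishes at \<open>a\<close> carry no weight in
    the correlator, and \<open>site_map\<close> may have a pole there. On the others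
    \<open>1 / D E\<close> is the spectral weight.\<close>
  define Z where "Z = {E \<in> box_spectrum b N. jac b E (Suc L) \<noteq> 0}"
  define g where "g = decay_weight s \<rho> a L \<omega>"
  define D where "D E = box_norm b N E / (jac b E (Suc L))\<^sup>2" for E
  have b'_eq: "b' = (\<lambda>i. b (Suc N - i))"
    by (simp add: fun_eq_iff b'_def b_def box_potential_rev_def N_def)
  have N: "N \<ge> 1" by (simp add: N_def)
  have fin: "finite (box_spectrum b N)" by (rule card_box_spectrum(1)[OF N])
  have at: "site_map b b' L E = \<omega> a" "(site_map b b' L has_real_derivative D E) (at E)" if "E \<in> Z" for E
  proof -
    have E: "E \<in> box_spectrum b (Suc (2 * L))" "jac b E (Suc L) \<noteq> 0" using that by (auto simp: Z_def N_def)
    show "site_map b b' L E = \<omega> a"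
      using site_map_at_eigenvalue(1)[OF E] unfolding b'_eq N_def by (simp add: b_def)
    show "(site_map b b' L has_real_derivative D E) (at E)"
      using site_map_at_eigenvalue(2)[OF E] unfolding b'_eq N_def D_def .
  qed
  have "ennreal (\<Sum>E\<in>Z. g E / D E) \<le> liminf (\<lambda>n. ennreal (real (Suc n) / 2) *
      (\<integral>\<^sup>+E\<in>{-Q<..<Q}. ennreal (g E) * indicator {x. \<bar>site_map b b' L x - \<omega> a\<bar> < 1 / real (Suc n)} E \<partial>lborel))"
  proof (rule sum_over_level_set_le_liminf)
    show "finite Z" using fin by (simp add: Z_def)
    show "Z \<subseteq> {-Q<..<Q}"
    proof
      fix E assume "E \<in> Z"
      then have "\<bar>E\<bar> \<le> R + 2"
        using N \<omega> by (intro box_spectrum_bound[of E b N]) (auto simp: Z_def b_def box_potential_def)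
      then show "E \<in> {-Q<..<Q}" using Q by auto
    qed
    show "g x \<ge> 0" for x unfolding g_def by (rule decay_weight_nonneg[OF \<rho>])
    show "D E > 0" if "E \<in> Z" for E using that box_norm_pos[OF N, of b E] by (simp add: D_def Z_def)
    show "isCont g E" for E unfolding g_def decay_weight_def by (intro continuous_intros isCont_weighted_ratio s)
  qed (use at in auto)
  moreover have "(\<Sum>E\<in>Z. g E / D E) = box_correlator s \<rho> a L \<omega>"
    unfolding box_correlator_def Let_def Z_def N_def[symmetric] b_def[symmetric] g_def[symmetric]
    by (rule sum.mono_neutral_cong_left) (auto simp: fin D_def mult.commute)
  moreover have "indicator {x. \<bar>site_map b b' L x - \<omega> a\<bar> < r} E = (indicator {t. \<bar>t\<bar> < r} (site_map b b' L E - \<omega> a) :: ennreal)" for r E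
    by (simp split: split_indicator)
  ultimately show ?thesis
    unfolding smeared_correlator_def[abs_def] g_def b_def b'_def by simp
qed

lemma sum_powers_le:
  fixes r :: real
  assumes "0 < r" "r < 1"
  shows "(\<Sum>n=1..L. r ^ n) \<le> 1 / (1 - r)"
proof -
  have "(1 - r) * (\<Sum>n=1..L. r ^ n) = r - r ^ Suc L"
  proof (induction L)
    case (Suc L)
    have "(1 - r) * (\<Sum>n=1..Suc L. r ^ n) = (1 - r) * (\<Sum>n=1..L. r ^ n) + (1 - r) * r ^ Suc L"
      by (simp add: distrib_left)
    also have "\<dots> = r - r ^ Suc (Suc L)" unfolding Suc by (simp add: left_diff_distrib)
    finally show ?case .
  qed simp
  also have "\<dots> \<le> 1" using assms by (simp add: less_imp_le add_increasing2 diff_le_eq)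
  finally show ?thesis using assms by (simp add: pos_le_divide_eq mult.commute)
qed

section \<open>Expectations of the correlator\<close>

context product_site
begin

text \<open>The rate is written as \<rho> squared: one factor \<rho> pays for the weight in
  \<open>weighted_ratio\<close>, the other leaves a convergent geometric series.\<close>

definition decay_constants :: "real \<Rightarrow> real \<Rightarrow> real \<Rightarrow> real \<Rightarrow> bool" where
  "decay_constants Q s C \<rho> \<longleftrightarrow> 0 < s \<and> 0 \<le> C \<and> 0 < \<rho> \<and> \<rho> < 1 \<and>
     (\<forall>E m v. \<bar>E\<bar> \<le> Q \<longrightarrow> v \<noteq> 0 \<longrightarrow> (transfer E ^^ m) (pow_norm s) v \<le> ennreal (C * (\<rho>\<^sup>2) ^ m * norm v powr - s))"

lemma decay_constants_exist:
  assumes "Q \<ge> 0"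
  obtains s C \<rho> where "decay_constants Q s C \<rho>"
proof -
  obtain s C c where *: "0 < s" "0 \<le> C" "0 < c" "c < 1"
    "\<And>E m v. \<bar>E\<bar> \<le> Q \<Longrightarrow> v \<noteq> 0 \<Longrightarrow> (transfer E ^^ m) (pow_norm s) v \<le> ennreal (C * c ^ m * norm v powr - s)"
    by (rule fractional_moment_decay[OF assms]) blast
  have "decay_constants Q s C (sqrt c)"
    unfolding decay_constants_def using * by (auto simp del: split_paired_All)
  then show thesis by (rule that)
qed

text \<open>Each ratio pairs the vector \<open>n\<close> steps before the centre with an inverse
  power of the norm at the centre. Integrating out the sites between leaves
  \<open>\<bar>fst w\<bar> powr s * norm w powr - s\<close>, at most 1, so the unknown size of the
  solution drops out.\<close>

lemma weighted_ratio_integral: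
  assumes dc: "decay_constants Q s C \<rho>" and E: "\<bar>E\<bar> \<le> Q" and inj: "inj_on p {1..L}"
  shows "(\<integral>\<^sup>+\<omega>. ennreal (weighted_ratio s \<rho> (\<lambda>j. \<omega> (p j)) L E) \<partial>\<Omega>) \<le> ennreal (C / (1 - \<rho>))"
proof -
  note dc' = dc[unfolded decay_constants_def]
  have s: "s > 0" and C: "C \<ge> 0" and \<rho>: "0 < \<rho>" "\<rho> < 1" using dc' by auto
  let ?v = "\<lambda>\<omega>. jac_vec (\<lambda>j. \<omega> (p j)) E"
  have vm: "(\<lambda>\<omega>. ?v \<omega> n) \<in> borel_measurable \<Omega>" for n by (rule jac_vec_measurable) measurable
  have jm: "(\<lambda>\<omega>. jac (\<lambda>j. \<omega> (p j)) E n) \<in> borel_measurable \<Omega>" for n by (rule jac_measurable) measurable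
  have moment: "(\<integral>\<^sup>+\<omega>. ennreal (end_ratio s (\<lambda>j. \<omega> (p j)) L (Suc L - n) E) \<partial>\<Omega>) \<le> ennreal (C * (\<rho>\<^sup>2) ^ n)"
    if n: "n \<in> {1..L}" for n
  proof -
    define i where "i = L - n"
    have i: "Suc L - n = Suc i" "L = i + n" using n by (auto simp: i_def)
    define f :: "real \<times> real \<Rightarrow> ennreal" where "f w = ennreal (\<bar>fst w\<bar> powr s)" for w
    have fm: "f \<in> borel_measurable borel" unfolding f_def[abs_def] by measurable
    have "ennreal (end_ratio s (\<lambda>j. \<omega> (p j)) L (Suc L - n) E) = f (?v \<omega> i) * pow_norm s (?v \<omega> (i + n))" for \<omega>
    proof -
      have pd: "(x / y) powr s = x powr s * y powr - s" if "x \<ge> 0" "y > 0" for x y :: real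
        using that by (simp add: powr_divide powr_minus divide_inverse[of "x powr s"])
      have "norm (?v \<omega> L) > 0" by simp
      from pd[OF abs_ge_zero this] show ?thesis
        unfolding end_ratio_def f_def i(1) i(2)[symmetric]
        by (simp add: jac_vec_def[of _ _ i] ennreal_mult[symmetric] del: jac.simps)
    qed
    then have "(\<integral>\<^sup>+\<omega>. ennreal (end_ratio s (\<lambda>j. \<omega> (p j)) L (Suc L - n) E) \<partial>\<Omega>)
      = (\<integral>\<^sup>+\<omega>. f (?v \<omega> i) * pow_norm s (?v \<omega> (i + n)) \<partial>\<Omega>)" by simp
    also have "\<dots> = (\<integral>\<^sup>+\<omega>. f (?v \<omega> i) * (transfer E ^^ n) (pow_norm s) (?v \<omega> i) \<partial>\<Omega>)"
      using inj fm unfolding i(2) by (intro moment_transfer) auto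
    also have "\<dots> \<le> (\<integral>\<^sup>+\<omega>. ennreal (C * (\<rho>\<^sup>2) ^ n) \<partial>\<Omega>)"
    proof (rule nn_integral_mono)
      fix \<omega>
      define w where "w = ?v \<omega> i"
      have w: "norm w > 0" by (simp add: w_def)
      have "f w * (transfer E ^^ n) (pow_norm s) w \<le> f w * ennreal (C * (\<rho>\<^sup>2) ^ n * norm w powr - s)"
        using dc' E w by (intro mult_left_mono) (auto simp del: split_paired_All)
      also have "\<dots> = ennreal (C * (\<rho>\<^sup>2) ^ n * (\<bar>fst w\<bar> powr s * norm w powr - s))"
        unfolding f_def using C by (simp add: ennreal_mult[symmetric] mult_ac)
      also have "\<dots> \<le> ennreal (C * (\<rho>\<^sup>2) ^ n * 1)"
      proof (intro ennreal_leI mult_left_mono)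
        have "\<bar>fst w\<bar> powr s \<le> norm w powr s"
          using s norm_fst_le[of "fst w" "snd w"] by (intro powr_mono2) auto
        then show "\<bar>fst w\<bar> powr s * norm w powr - s \<le> 1"
          using w by (simp add: powr_minus divide_inverse[symmetric] pos_divide_le_eq)
      qed (use C in auto)
      finally show "f (?v \<omega> i) * (transfer E ^^ n) (pow_norm s) (?v \<omega> i) \<le> ennreal (C * (\<rho>\<^sup>2) ^ n)"
        by (simp add: w_def)
    qed
    finally show ?thesis by (simp add: P.emeasure_space_1)
  qed
  have "(\<integral>\<^sup>+\<omega>. ennreal (weighted_ratio s \<rho> (\<lambda>j. \<omega> (p j)) L E) \<partial>\<Omega>)
     = (\<integral>\<^sup>+\<omega>. (\<Sum>n=1..L. ennreal ((1 / \<rho>) ^ n) * ennreal (end_ratio s (\<lambda>j. \<omega> (p j)) L (Suc L - n) E)) \<partial>\<Omega>)"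
  proof (rule nn_integral_cong)
    fix \<omega>
    show "ennreal (weighted_ratio s \<rho> (\<lambda>j. \<omega> (p j)) L E)
      = (\<Sum>n=1..L. ennreal ((1 / \<rho>) ^ n) * ennreal (end_ratio s (\<lambda>j. \<omega> (p j)) L (Suc L - n) E))"
      unfolding weighted_ratio_def using \<rho>
      by (subst sum_ennreal[symmetric]) (auto simp: end_ratio_def ennreal_mult)
  qed
  also have "\<dots> = (\<Sum>n=1..L. ennreal ((1 / \<rho>) ^ n) * (\<integral>\<^sup>+\<omega>. ennreal (end_ratio s (\<lambda>j. \<omega> (p j)) L (Suc L - n) E) \<partial>\<Omega>))"
  proof -
    note [measurable] = jm vm
    have [measurable]: "(\<lambda>\<omega>. end_ratio s (\<lambda>j. \<omega> (p j)) L n E) \<in> borel_measurable \<Omega>" for n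
      unfolding end_ratio_def by measurable
    show ?thesis by (subst nn_integral_sum) (auto intro!: sum.cong nn_integral_cmult)
  qed
  also have "\<dots> \<le> (\<Sum>n=1..L. ennreal ((1 / \<rho>) ^ n) * ennreal (C * (\<rho>\<^sup>2) ^ n))"
    by (intro sum_mono mult_left_mono moment) auto
  also have "\<dots> = ennreal (C * (\<Sum>n=1..L. \<rho> ^ n))"
  proof -
    have "ennreal ((1 / \<rho>) ^ n) * ennreal (C * (\<rho>\<^sup>2) ^ n) = ennreal (C * \<rho> ^ n)" for n
    proof -
      have "(1 / \<rho>) ^ n * (C * (\<rho>\<^sup>2) ^ n) = C * (1 / \<rho> * \<rho>\<^sup>2) ^ n" by (simp only: power_mult_distrib mult_ac)
      also have "1 / \<rho> * \<rho>\<^sup>2 = \<rho>" using \<rho> by (simp add: power2_eq_square)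
      finally show ?thesis using \<rho> C by (simp add: ennreal_mult[symmetric])
    qed
    then show ?thesis using C \<rho> by (simp add: sum_distrib_left)
  qed
  also have "\<dots> \<le> ennreal (C * (1 / (1 - \<rho>)))"
    using C \<rho> by (intro ennreal_leI mult_left_mono sum_powers_le) auto
  finally show ?thesis by simp
qed

lemma site_window_probability:
  assumes r: "r > 0"
  shows "(\<integral>\<^sup>+x. indicator A x * indicator {t. \<bar>t\<bar> < r} (y - x) \<partial>M) \<le> ennreal (K * (2 * r))"
proof -
  have i: "indicator {t. \<bar>t\<bar> < r} (y - x) = (indicator {y-r<..<y+r} x :: ennreal)" for x
    by (auto split: split_indicator)
  have "(\<integral>\<^sup>+x. indicator A x * indicator {t. \<bar>t\<bar> < r} (y - x) \<partial>M) = (\<integral>\<^sup>+x. indicator {y-r<..<y+r} x * indicator A x \<partial>\<nu>)"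
    unfolding i by (subst nn_integral_M) (auto simp: mult.commute)
  also have "\<dots> \<le> ennreal K * (\<integral>\<^sup>+x. indicator {y-r<..<y+r} x * indicator A x \<partial>lborel)"
    by (rule dominated_nn_integral) measurable
  also have "\<dots> \<le> ennreal K * (\<integral>\<^sup>+x. indicator {y-r<..<y+r} x \<partial>lborel)"
    by (intro mult_left_mono nn_integral_mono) (auto split: split_indicator)
  also have "\<dots> = ennreal (K * (2 * r))" using r K_pos by (simp add: ennreal_mult)
  finally show ?thesis .
qed

lemma smeared_correlator_measurable:
  "(\<lambda>\<omega>. smeared_correlator s \<rho> Q a L \<omega> n) \<in> borel_measurable \<Omega>"
  and smeared_integrand_measurable:
  "(\<lambda>(\<omega>, E). ennreal (decay_weight s \<rho> a L \<omega> E) *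
        indicator {t. \<bar>t\<bar> < 1 / real (Suc n)} (site_map (box_potential a L \<omega>) (box_potential_rev a L \<omega>) L E - \<omega> a) *
        indicator {-Q<..<Q} E) \<in> borel_measurable (\<Omega> \<Otimes>\<^sub>M lborel)"
proof -
  have c: "(\<lambda>z. fst z i) \<in> borel_measurable (\<Omega> \<Otimes>\<^sub>M lborel)" for i
    by (rule measurable_compose[OF measurable_fst coordinate_measurable])
  have 1: "(\<lambda>z. box_potential a L (fst z) i) \<in> borel_measurable (\<Omega> \<Otimes>\<^sub>M lborel)"
     "(\<lambda>z. box_potential_rev a L (fst z) i) \<in> borel_measurable (\<Omega> \<Otimes>\<^sub>M lborel)" for i
    unfolding box_potential_def box_potential_rev_def by (rule c)+
  have 2: "snd \<in> borel_measurable (\<Omega> \<Otimes>\<^sub>M lborel)" by measurable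
  note [measurable] = weighted_ratio_measurable[OF 1(1) 2, where s=s and \<rho>=\<rho> and L=L]
    weighted_ratio_measurable[OF 1(2) 2, where s=s and \<rho>=\<rho> and L=L]
    jac_measurable[OF 1(1) 2, where n=L] jac_measurable[OF 1(2) 2, where n=L]
    jac_measurable[OF 1(1) 2, where n="Suc L"] jac_measurable[OF 1(2) 2, where n="Suc L"] c 2
  show m: "(\<lambda>(\<omega>, E). ennreal (decay_weight s \<rho> a L \<omega> E) *
        indicator {t. \<bar>t\<bar> < 1 / real (Suc n)} (site_map (box_potential a L \<omega>) (box_potential_rev a L \<omega>) L E - \<omega> a) *
        indicator {-Q<..<Q} E) \<in> borel_measurable (\<Omega> \<Otimes>\<^sub>M lborel)"
    unfolding split_beta' decay_weight_def site_map_def by measurable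
  show "(\<lambda>\<omega>. smeared_correlator s \<rho> Q a L \<omega> n) \<in> borel_measurable \<Omega>"
    unfolding smeared_correlator_def
    by (intro borel_measurable_times_ennreal borel_measurable_const lborel.borel_measurable_nn_integral m)
qed

lemma decay_weight_integral:
  assumes dc: "decay_constants Q s C \<rho>" and E: "\<bar>E\<bar> \<le> Q"
  shows "(\<integral>\<^sup>+\<omega>. ennreal (decay_weight s \<rho> a L \<omega> E) \<partial>\<Omega>) \<le> ennreal (2 * (C / (1 - \<rho>)))"
proof -
  have \<rho>: "\<rho> > 0" "\<rho> < 1" and C: "C \<ge> 0" using dc by (auto simp: decay_constants_def)
  have m: "(\<lambda>\<omega>. weighted_ratio s \<rho> (\<lambda>j. \<omega> (p j)) L E) \<in> borel_measurable \<Omega>" for p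
    by (rule weighted_ratio_measurable) measurable
  let ?p = "\<lambda>i. a - int (Suc L) + int i" and ?p' = "\<lambda>i. a - int (Suc L) + int (Suc (Suc (2 * L)) - i)"
  have e: "box_potential a L \<omega> = (\<lambda>j. \<omega> (?p j))" "box_potential_rev a L \<omega> = (\<lambda>j. \<omega> (?p' j))" for \<omega>
    by (simp_all add: box_potential_def box_potential_rev_def fun_eq_iff)
  have inj: "inj_on ?p {1..L}" "inj_on ?p' {1..L}" by (auto simp: inj_on_def)
  have "(\<integral>\<^sup>+\<omega>. ennreal (decay_weight s \<rho> a L \<omega> E) \<partial>\<Omega>)
    = (\<integral>\<^sup>+\<omega>. ennreal (weighted_ratio s \<rho> (\<lambda>j. \<omega> (?p j)) L E) + ennreal (weighted_ratio s \<rho> (\<lambda>j. \<omega> (?p' j)) L E) \<partial>\<Omega>)"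
    unfolding decay_weight_def e by (intro nn_integral_cong ennreal_plus weighted_ratio_nonneg \<rho>)
  also have "\<dots> = (\<integral>\<^sup>+\<omega>. ennreal (weighted_ratio s \<rho> (\<lambda>j. \<omega> (?p j)) L E) \<partial>\<Omega>) +
     (\<integral>\<^sup>+\<omega>. ennreal (weighted_ratio s \<rho> (\<lambda>j. \<omega> (?p' j)) L E) \<partial>\<Omega>)"
    by (intro nn_integral_add measurable_compose[OF m measurable_ennreal])
  also have "\<dots> \<le> ennreal (C / (1 - \<rho>)) + ennreal (C / (1 - \<rho>))"
    by (intro add_mono weighted_ratio_integral[OF dc E] inj)
  also have "\<dots> = ennreal (2 * (C / (1 - \<rho>)))" using C \<rho> by (simp flip: ennreal_plus)
  finally show ?thesis .
qed

text \<open>At fixed \<open>E\<close> the value \<omega> at \<open>a\<close> enters only through the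
  window about \<open>site_map\<close>, so integrating it over \<open>A\<close> costs at most
  \<open>K * 2 / (n + 1)\<close>. The prefactor \<open>(n + 1) / 2\<close> cancels the window, which
  makes the bound uniform in \<open>n\<close> and \<open>L\<close>.\<close>

lemma smeared_correlator_integral:
  assumes dc: "decay_constants Q s C \<rho>" and Q: "Q > 0"
  shows "(\<integral>\<^sup>+\<omega>. indicator A (\<omega> a) * smeared_correlator s \<rho> Q a L \<omega> n \<partial>\<Omega>)
     \<le> ennreal (K * (2 * (C / (1 - \<rho>))) * (2 * Q))"
proof -
  interpret OL: pair_sigma_finite \<Omega> lborel ..
  have \<rho>: "\<rho> > 0" "\<rho> < 1" and C: "C \<ge> 0" using dc by (auto simp: decay_constants_def)
  define r where "r = 1 / real (Suc n)"
  have r: "r > 0" by (simp add: r_def)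
  let ?sm = "\<lambda>\<omega>. site_map (box_potential a L \<omega>) (box_potential_rev a L \<omega>) L"
  define f where "f \<omega> E = ennreal (decay_weight s \<rho> a L \<omega> E) * indicator {t. \<bar>t\<bar> < r} (?sm \<omega> E - \<omega> a) * indicator {-Q<..<Q} E" for \<omega> E
  have fm: "(\<lambda>(\<omega>, E). f \<omega> E) \<in> borel_measurable (\<Omega> \<Otimes>\<^sub>M lborel)"
    unfolding f_def r_def by (rule smeared_integrand_measurable)
  have am: "(\<lambda>\<omega>. indicator A (\<omega> a) :: ennreal) \<in> borel_measurable \<Omega>"
    by (rule measurable_compose[OF coordinate_measurable]) measurable
  have afm: "(\<lambda>(\<omega>, E). indicator A (\<omega> a) * f \<omega> E) \<in> borel_measurable (\<Omega> \<Otimes>\<^sub>M lborel)"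
    using measurable_compose[OF measurable_fst am, of lborel] fm
    unfolding split_beta' by (rule borel_measurable_times_ennreal)
  have f2: "(\<lambda>E. f \<omega> E) \<in> borel_measurable lborel" if "\<omega> \<in> space \<Omega>" for \<omega>
    using measurable_Pair2[OF fm that] by simp
  have f1: "(\<lambda>\<omega>. f \<omega> E) \<in> borel_measurable \<Omega>" for E
    using measurable_Pair1[OF fm, of E] by simp
  have slice: "(\<integral>\<^sup>+\<omega>. indicator A (\<omega> a) * f \<omega> E \<partial>\<Omega>) \<le> ennreal (K * (2 * r)) * ennreal (2 * (C / (1 - \<rho>))) * indicator {-Q<..<Q} E" for E
  proof (cases "E \<in> {-Q<..<Q}")
    case True
    \<comment> \<open>Both \<open>weighted_ratio\<close> and \<open>site_map\<close> use the
      recursion only up to index \<open>L + 1\<close>, hence potential values up to index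
      \<open>L\<close>, which excludes the centre from either side.\<close>
    have upd: "box_potential a L (fun_upd \<omega> a x) i = box_potential a L \<omega> i"
       "box_potential_rev a L (fun_upd \<omega> a x) i = box_potential_rev a L \<omega> i" if "i \<le> L" for \<omega> x i
      using that by (auto simp: box_potential_def box_potential_rev_def)
    have dw: "decay_weight s \<rho> a L (fun_upd \<omega> a x) E = decay_weight s \<rho> a L \<omega> E" for \<omega> x
      unfolding decay_weight_def by (intro arg_cong2[of _ _ _ _ "(+)"] weighted_ratio_cong upd)
    have sm: "?sm (fun_upd \<omega> a x) E = ?sm \<omega> E" for \<omega> x
    proof -
      have "jac (box_potential a L (fun_upd \<omega> a x)) E n = jac (box_potential a L \<omega>) E n"
        "jac (box_potential_rev a L (fun_upd \<omega> a x)) E n = jac (box_potential_rev a L \<omega>) E n" if "n \<le> Suc L" for n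
        using that by (auto intro!: jac_cong upd)
      then show ?thesis unfolding site_map_def by simp
    qed
    have "(\<integral>\<^sup>+\<omega>. indicator A (\<omega> a) * f \<omega> E \<partial>\<Omega>)
      = (\<integral>\<^sup>+\<omega>. \<integral>\<^sup>+x. indicator A (fun_upd \<omega> a x a) * f (fun_upd \<omega> a x) E \<partial>M \<partial>\<Omega>)"
      by (rule nn_integral_resample, rule borel_measurable_times_ennreal[OF am f1])
    also have "\<dots> \<le> (\<integral>\<^sup>+\<omega>. ennreal (decay_weight s \<rho> a L \<omega> E) * ennreal (K * (2 * r)) \<partial>\<Omega>)"
    proof (rule nn_integral_mono)
      fix \<omega>
      have "(\<integral>\<^sup>+x. indicator A (fun_upd \<omega> a x a) * f (fun_upd \<omega> a x) E \<partial>M)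
        = (\<integral>\<^sup>+x. ennreal (decay_weight s \<rho> a L \<omega> E) * (indicator A x * indicator {t. \<bar>t\<bar> < r} (?sm \<omega> E - x)) \<partial>M)"
        unfolding f_def dw sm using True by (intro nn_integral_cong) (simp add: mult_ac)
      also have "\<dots> = ennreal (decay_weight s \<rho> a L \<omega> E) * (\<integral>\<^sup>+x. indicator A x * indicator {t. \<bar>t\<bar> < r} (?sm \<omega> E - x) \<partial>M)"
      proof (rule nn_integral_cmult)
        have "(\<lambda>x. indicator A x * indicator {t. \<bar>t\<bar> < r} (?sm \<omega> E - x) :: ennreal) \<in> borel_measurable borel"
          by measurable
        then show "(\<lambda>x. indicator A x * indicator {t. \<bar>t\<bar> < r} (?sm \<omega> E - x) :: ennreal) \<in> borel_measurable M"
          by (rule measurable_compose[OF id_M])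
      qed
      also have "\<dots> \<le> ennreal (decay_weight s \<rho> a L \<omega> E) * ennreal (K * (2 * r))"
        by (intro mult_left_mono site_window_probability r) simp
      finally show "(\<integral>\<^sup>+x. indicator A (fun_upd \<omega> a x a) * f (fun_upd \<omega> a x) E \<partial>M)
        \<le> ennreal (decay_weight s \<rho> a L \<omega> E) * ennreal (K * (2 * r))" .
    qed
    also have "\<dots> = (\<integral>\<^sup>+\<omega>. ennreal (decay_weight s \<rho> a L \<omega> E) \<partial>\<Omega>) * ennreal (K * (2 * r))"
    proof (rule nn_integral_multc, rule measurable_compose[OF _ measurable_ennreal])
      show "(\<lambda>\<omega>. decay_weight s \<rho> a L \<omega> E) \<in> borel_measurable \<Omega>"
        unfolding decay_weight_def box_potential_def box_potential_rev_def
        by (intro borel_measurable_add weighted_ratio_measurable coordinate_measurable borel_measurable_const)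
    qed
    also have "\<dots> \<le> ennreal (2 * (C / (1 - \<rho>))) * ennreal (K * (2 * r))"
      using True by (intro mult_right_mono decay_weight_integral[OF dc]) auto
    finally show ?thesis using True by (simp add: mult.commute)
  qed (simp add: f_def)
  have "(\<integral>\<^sup>+\<omega>. indicator A (\<omega> a) * smeared_correlator s \<rho> Q a L \<omega> n \<partial>\<Omega>)
     = (\<integral>\<^sup>+\<omega>. ennreal (real (Suc n) / 2) * (\<integral>\<^sup>+E. indicator A (\<omega> a) * f \<omega> E \<partial>lborel) \<partial>\<Omega>)"
  proof (rule nn_integral_cong)
    fix \<omega> assume "\<omega> \<in> space \<Omega>"
    then have "(\<integral>\<^sup>+E. indicator A (\<omega> a) * f \<omega> E \<partial>lborel) = indicator A (\<omega> a) * (\<integral>\<^sup>+E. f \<omega> E \<partial>lborel)"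
      by (intro nn_integral_cmult f2)
    then show "indicator A (\<omega> a) * smeared_correlator s \<rho> Q a L \<omega> n
       = ennreal (real (Suc n) / 2) * (\<integral>\<^sup>+E. indicator A (\<omega> a) * f \<omega> E \<partial>lborel)"
      unfolding smeared_correlator_def f_def r_def by (simp only: mult_ac)
  qed
  also have "\<dots> = ennreal (real (Suc n) / 2) * (\<integral>\<^sup>+\<omega>. (\<integral>\<^sup>+E. indicator A (\<omega> a) * f \<omega> E \<partial>lborel) \<partial>\<Omega>)"
    by (rule nn_integral_cmult) (rule lborel.borel_measurable_nn_integral[OF afm])
  also have "(\<integral>\<^sup>+\<omega>. (\<integral>\<^sup>+E. indicator A (\<omega> a) * f \<omega> E \<partial>lborel) \<partial>\<Omega>) = (\<integral>\<^sup>+E. (\<integral>\<^sup>+\<omega>. indicator A (\<omega> a) * f \<omega> E \<partial>\<Omega>) \<partial>lborel)"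
    by (rule OL.Fubini'[OF afm, symmetric])
  also have "\<dots> \<le> (\<integral>\<^sup>+E. ennreal (K * (2 * r)) * ennreal (2 * (C / (1 - \<rho>))) * indicator {-Q<..<Q} E \<partial>lborel)"
    by (rule nn_integral_mono) (rule slice)
  also have "\<dots> = ennreal (K * (2 * r)) * ennreal (2 * (C / (1 - \<rho>))) * ennreal (2 * Q)"
    using Q by (subst nn_integral_cmult_indicator) auto
  also have "\<dots> = ennreal (K * (2 * r) * (2 * (C / (1 - \<rho>))) * (2 * Q))"
  proof -
    have "ennreal x * ennreal y * ennreal z = ennreal (x * y * z)" if "x \<ge> 0" "y \<ge> 0" "z \<ge> 0" for x y z
      using that by (simp add: ennreal_mult)
    from this[of "K * (2 * r)" "2 * (C / (1 - \<rho>))" "2 * Q"] show ?thesis using K_pos r C \<rho> Q by simp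
  qed
  finally have "(\<integral>\<^sup>+\<omega>. indicator A (\<omega> a) * smeared_correlator s \<rho> Q a L \<omega> n \<partial>\<Omega>)
     \<le> ennreal (real (Suc n) / 2) * ennreal (K * (2 * r) * (2 * (C / (1 - \<rho>))) * (2 * Q))"
    by (simp add: mult_left_mono)
  also have "\<dots> = ennreal (real (Suc n) / 2 * (K * (2 * r) * (2 * (C / (1 - \<rho>))) * (2 * Q)))"
    using K_pos r C \<rho> Q by (intro ennreal_mult[symmetric]) auto
  also have "real (Suc n) / 2 * (K * (2 * r) * (2 * (C / (1 - \<rho>))) * (2 * Q)) = K * (2 * (C / (1 - \<rho>))) * (2 * Q)"
    unfolding r_def by (simp del: of_nat_Suc)
  finally show ?thesis .
qed

text \<open>Fatou's lemma is applied twice, for the window width and for the box size. It bounds a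
  lower limit, hence the correlator for infinitely many \<open>L\<close>, which is what the
  compactness argument consumes.\<close>

theorem correlator_bounded_frequently:
  assumes dc: "decay_constants Q s C \<rho>" and Q: "R + 2 < Q"
  shows "AE \<omega> in \<Omega>. \<omega> a \<in> A \<longrightarrow> (\<exists>B. \<exists>\<^sub>F L in sequentially. box_correlator s \<rho> a L \<omega> \<le> B)"
proof -
  have s: "s > 0" and \<rho>: "\<rho> > 0" using dc by (auto simp: decay_constants_def)
  have Q0: "Q > 0" using Q R_pos by simp
  define F where "F L \<omega> = liminf (smeared_correlator s \<rho> Q a L \<omega>)" for L \<omega>
  define C' where "C' = ennreal (K * (2 * (C / (1 - \<rho>))) * (2 * Q))"
  have am: "(\<lambda>\<omega>. indicator A (\<omega> a) :: ennreal) \<in> borel_measurable \<Omega>"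
    by (rule measurable_compose[OF coordinate_measurable]) measurable
  have Fm: "F L \<in> borel_measurable \<Omega>" for L
    unfolding F_def[abs_def] by (intro borel_measurable_liminf smeared_correlator_measurable)
  have ind_liminf: "indicator A (\<omega> a) * liminf X = liminf (\<lambda>n. indicator A (\<omega> a) * X n)" for \<omega> and X :: "nat \<Rightarrow> ennreal"
    by (cases "\<omega> a \<in> A") (simp_all add: Liminf_const)
  have FL: "(\<integral>\<^sup>+\<omega>. indicator A (\<omega> a) * F L \<omega> \<partial>\<Omega>) \<le> C'" for L
  proof -
    have "(\<integral>\<^sup>+\<omega>. indicator A (\<omega> a) * F L \<omega> \<partial>\<Omega>)
      = (\<integral>\<^sup>+\<omega>. liminf (\<lambda>n. indicator A (\<omega> a) * smeared_correlator s \<rho> Q a L \<omega> n) \<partial>\<Omega>)"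
      unfolding F_def ind_liminf ..
    also have "\<dots> \<le> liminf (\<lambda>n. \<integral>\<^sup>+\<omega>. indicator A (\<omega> a) * smeared_correlator s \<rho> Q a L \<omega> n \<partial>\<Omega>)"
      by (rule nn_integral_liminf, rule borel_measurable_times_ennreal[OF am smeared_correlator_measurable])
    also have "\<dots> \<le> liminf (\<lambda>n. C')"
      unfolding C'_def by (intro Liminf_mono always_eventually allI smeared_correlator_integral[OF dc Q0])
    also have "\<dots> = C'" by (simp add: Liminf_const)
    finally show ?thesis .
  qed
  have "(\<integral>\<^sup>+\<omega>. liminf (\<lambda>L. indicator A (\<omega> a) * F L \<omega>) \<partial>\<Omega>) \<le> liminf (\<lambda>L. \<integral>\<^sup>+\<omega>. indicator A (\<omega> a) * F L \<omega> \<partial>\<Omega>)"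
    by (rule nn_integral_liminf, rule borel_measurable_times_ennreal[OF am Fm])
  also have "\<dots> \<le> liminf (\<lambda>L. C')"
    by (intro Liminf_mono always_eventually allI FL)
  also have "\<dots> < \<infinity>" by (simp add: Liminf_const C'_def)
  finally have "AE \<omega> in \<Omega>. liminf (\<lambda>L. indicator A (\<omega> a) * F L \<omega>) \<noteq> \<infinity>"
    by (intro nn_integral_PInf_AE borel_measurable_liminf borel_measurable_times_ennreal[OF am Fm]) auto
  then show ?thesis
  proof (rule AE_mp, intro AE_I2 impI)
    fix \<omega> assume \<omega>: "\<omega> \<in> space \<Omega>" and fin: "liminf (\<lambda>L. indicator A (\<omega> a) * F L \<omega>) \<noteq> \<infinity>" and "\<omega> a \<in> A"
    then have "liminf (\<lambda>L. F L \<omega>) < \<infinity>" by (simp add: less_top)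
    then obtain B where B: "liminf (\<lambda>L. F L \<omega>) < ennreal B"
      by (metis ennreal_cases infinity_ennreal_def less_top dense)
    have \<omega>R: "\<bar>\<omega> i\<bar> \<le> R" for i using \<omega> by (intro space_M) (auto simp: space_PiM PiE_iff)
    have le: "ennreal (box_correlator s \<rho> a L \<omega>) \<le> F L \<omega>" for L
      unfolding F_def by (rule box_correlator_le_smeared[OF s \<rho> \<omega>R Q])
    have "\<exists>\<^sub>F L in sequentially. F L \<omega> < ennreal B"
    proof (rule ccontr)
      assume "\<not> ?thesis"
      then have "eventually (\<lambda>L. ennreal B \<le> F L \<omega>) sequentially" by (simp add: not_frequently not_less)
      then have "ennreal B \<le> liminf (\<lambda>L. F L \<omega>)" by (rule Liminf_bounded)
      then show False using B by simp
    qed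
    then have "\<exists>\<^sub>F L in sequentially. box_correlator s \<rho> a L \<omega> \<le> max 0 B"
    proof (rule frequently_mono[rotated], intro allI impI)
      fix L assume "F L \<omega> < ennreal B"
      with le[of L] have "ennreal (box_correlator s \<rho> a L \<omega>) < ennreal B" by (rule le_less_trans)
      then show "box_correlator s \<rho> a L \<omega> \<le> max 0 B"
        by (metis ennreal_leI leI le_max_iff_disj less_imp_le not_less)
    qed
    then show "\<exists>B. \<exists>\<^sub>F L in sequentially. box_correlator s \<rho> a L \<omega> \<le> B" by blast
  qed
qed

end

section \<open>Closed spans of localized eigenvectors\<close>

text \<open>A norm bound through finite sums carries square summability with it, which
  \<open>ell2_norm\<close> alone does not, being 0 on non-summable families.\<close>

definition l2_le :: "(int \<Rightarrow> complex) \<Rightarrow> real \<Rightarrow> bool" where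
  "l2_le f e \<longleftrightarrow> (\<forall>F. finite F \<longrightarrow> L2_set (\<lambda>n. norm (f n)) F \<le> e)"

lemma l2_le_ell2:
  assumes "l2_le f e"
  shows "f \<in> ell2" "ell2_norm f \<le> e"
proof -
  have e: "0 \<le> e" using assms unfolding l2_le_def by (metis L2_set_empty finite.emptyI)
  have sq: "(\<Sum>n\<in>F. (norm (f n))\<^sup>2) \<le> e\<^sup>2" if "finite F" for F
  proof -
    have "sqrt (\<Sum>n\<in>F. (norm (f n))\<^sup>2) \<le> e" using assms that by (simp add: l2_le_def L2_set_def)
    then show ?thesis by (rule real_sqrt_le_iff[THEN iffD1, OF order_trans]) (use e in simp)
  qed
  have s: "(\<lambda>n. (norm (f n))\<^sup>2) summable_on UNIV"
    by (rule nonneg_bdd_above_summable_on) (auto intro!: bdd_aboveI[of _ "e\<^sup>2"] sq)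
  then show "f \<in> ell2" by (simp add: ell2_def)
  have "(\<Sum>\<^sub>\<infinity>n. (norm (f n))\<^sup>2) \<le> e\<^sup>2" by (rule infsum_le_finite_sums[OF s]) (use sq in auto)
  then show "ell2_norm f \<le> e" unfolding ell2_norm_def using e by (simp add: real_le_lsqrt infsum_nonneg)
qed

lemma ell2_tail:
  assumes "f \<in> ell2" "\<epsilon> > 0"
  obtains F0 where "finite F0" "\<And>F. finite F \<Longrightarrow> F \<inter> F0 = {} \<Longrightarrow> (\<Sum>n\<in>F. (norm (f n))\<^sup>2) \<le> \<epsilon>"
proof -
  let ?g = "\<lambda>n. (norm (f n))\<^sup>2"
  have s: "?g summable_on UNIV" using assms by (simp add: ell2_def)
  then have "(?g has_sum infsum ?g UNIV) UNIV" by (rule has_sum_infsum)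
  then obtain F0 where F0: "finite F0" "dist (sum ?g F0) (infsum ?g UNIV) \<le> \<epsilon>"
    using has_sum_finite_approximation[OF _ assms(2)] by blast
  show thesis
  proof (rule that[OF F0(1)])
    fix F :: "int set" assume F: "finite F" "F \<inter> F0 = {}"
    have "sum ?g F + sum ?g F0 = sum ?g (F \<union> F0)" using F F0 by (intro sum.union_disjoint[symmetric]) auto
    also have "\<dots> \<le> infsum ?g UNIV" using F F0 by (intro finite_sum_le_infsum[OF s]) auto
    finally show "sum ?g F \<le> \<epsilon>" using F0(2) by (simp add: dist_real_def)
  qed
qed

lemma l2_le_mono: "l2_le f a \<Longrightarrow> a \<le> b \<Longrightarrow> l2_le f b"
  unfolding l2_le_def by (meson order_trans)

lemma l2_le_add:
  assumes "l2_le f a" "l2_le g b"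
  shows "l2_le (\<lambda>n. f n + g n) (a + b)"
  unfolding l2_le_def
proof (intro allI impI)
  fix F :: "int set" assume F: "finite F"
  have "L2_set (\<lambda>n. norm (f n + g n)) F \<le> L2_set (\<lambda>n. norm (f n) + norm (g n)) F"
    by (intro L2_set_mono norm_triangle_ineq) auto
  also have "\<dots> \<le> L2_set (\<lambda>n. norm (f n)) F + L2_set (\<lambda>n. norm (g n)) F" by (rule L2_set_triangle_ineq)
  also have "\<dots> \<le> a + b" using assms F by (intro add_mono) (auto simp: l2_le_def)
  finally show "L2_set (\<lambda>n. norm (f n + g n)) F \<le> a + b" .
qed

lemma l2_le_dominated:
  assumes "l2_le f a" "\<And>n. norm (g n) \<le> C * norm (f n)" "C \<ge> 0"
  shows "l2_le g (C * a)"
  unfolding l2_le_def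
proof (intro allI impI)
  fix F :: "int set" assume F: "finite F"
  have "L2_set (\<lambda>n. norm (g n)) F \<le> L2_set (\<lambda>n. C * norm (f n)) F"
    by (intro L2_set_mono assms(2)) auto
  also have "\<dots> = C * L2_set (\<lambda>n. norm (f n)) F" using assms(3) by (simp add: L2_set_right_distrib)
  also have "\<dots> \<le> C * a" using assms F by (intro mult_left_mono) (auto simp: l2_le_def)
  finally show "L2_set (\<lambda>n. norm (g n)) F \<le> C * a" .
qed

lemma l2_le_scale: "l2_le f a \<Longrightarrow> l2_le (\<lambda>n. c * f n) (norm c * a)"
  by (rule l2_le_dominated) (auto simp: norm_mult)

lemma l2_le_shift:
  assumes "l2_le f a"
  shows "l2_le (\<lambda>n. f (n + k)) a"
  unfolding l2_le_def
proof (intro allI impI)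
  fix F :: "int set" assume F: "finite F"
  have "L2_set (\<lambda>n. norm (f (n + k))) F = L2_set (\<lambda>n. norm (f n)) ((\<lambda>n. n + k) ` F)"
    unfolding L2_set_def by (subst sum.reindex) (auto simp: o_def)
  also have "\<dots> \<le> a" using assms F by (simp add: l2_le_def)
  finally show "L2_set (\<lambda>n. norm (f (n + k))) F \<le> a" .
qed

lemma l2_le_anderson:
  assumes "l2_le f a" "\<And>n. \<bar>\<omega> n\<bar> \<le> R"
  shows "l2_le (anderson \<omega> f) ((2 + R) * a)"
proof -
  have R: "0 \<le> R" using assms(2)[of 0] by simp
  have "l2_le (\<lambda>n. (f (n + 1) + f (n + (-1))) + complex_of_real (\<omega> n) * f n) ((a + a) + R * a)"
  proof (intro l2_le_add l2_le_shift assms(1) l2_le_dominated[where C=R and f=f])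
    show "norm (complex_of_real (\<omega> n) * f n) \<le> R * norm (f n)" for n
      using assms(2)[of n] by (simp add: norm_mult mult_right_mono)
  qed (use R in auto)
  then show ?thesis by (simp add: anderson_def algebra_simps)
qed

lemma l2_le_sum:
  assumes "finite I" "\<And>i. i \<in> I \<Longrightarrow> l2_le (f i) (a i)"
  shows "l2_le (\<lambda>n. \<Sum>i\<in>I. f i n) (\<Sum>i\<in>I. a i)"
  using assms
proof (induction I rule: finite_induct)
  case empty
  then show ?case by (simp add: l2_le_def L2_set_def)
next
  case (insert i I)
  have "l2_le (\<lambda>n. f i n + (\<Sum>i\<in>I. f i n)) (a i + (\<Sum>i\<in>I. a i))"
    using insert by (intro l2_le_add) auto
  then show ?case using insert by simp
qed

section \<open>Finite combinations and their closure\<close>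

inductive_set lspan :: "(int \<Rightarrow> complex) set \<Rightarrow> (int \<Rightarrow> complex) set" for X where
  zero: "(\<lambda>_. 0) \<in> lspan X"
| add: "f \<in> lspan X \<Longrightarrow> \<psi> \<in> X \<Longrightarrow> (\<lambda>n. f n + c * \<psi> n) \<in> lspan X"

lemma lspan_plus:
  assumes "g \<in> lspan X" "f \<in> lspan X"
  shows "(\<lambda>n. f n + g n) \<in> lspan X"
  using assms
proof (induction rule: lspan.induct)
  case (add g \<psi> c)
  have "(\<lambda>n. (f n + g n) + c * \<psi> n) \<in> lspan X" using add by (intro lspan.add) auto
  then show ?case by (simp add: add.assoc)
qed simp

lemma lspan_scale:
  assumes "f \<in> lspan X"
  shows "(\<lambda>n. d * f n) \<in> lspan X"
  using assms
proof (induction rule: lspan.induct)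
  case (add f \<psi> c)
  have "(\<lambda>n. d * f n + (d * c) * \<psi> n) \<in> lspan X" using add by (intro lspan.add) auto
  then show ?case by (simp add: algebra_simps)
qed (simp add: lspan.zero)

lemma lspan_sum:
  assumes "finite I" "\<And>i. i \<in> I \<Longrightarrow> f i \<in> lspan X"
  shows "(\<lambda>n. \<Sum>i\<in>I. c i * f i n) \<in> lspan X"
  using assms
proof (induction I rule: finite_induct)
  case (insert i I)
  have "(\<lambda>n. (c i * f i n) + (\<Sum>i\<in>I. c i * f i n)) \<in> lspan X"
    using insert by (intro lspan_plus lspan_scale) auto
  then show ?case using insert by simp
qed (simp add: lspan.zero)

lemma lspan_base: "\<psi> \<in> X \<Longrightarrow> \<psi> \<in> lspan X"
  using lspan.add[OF lspan.zero, of \<psi> X 1] by simp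

lemma lspan_mono: "X \<subseteq> Y \<Longrightarrow> f \<in> lspan X \<Longrightarrow> f \<in> lspan Y"
  by (rotate_tac, induction rule: lspan.induct) (auto intro: lspan.intros)

lemma lspan_finite:
  assumes "f \<in> lspan X"
  shows "\<exists>T\<subseteq>X. finite T \<and> f \<in> lspan T"
  using assms
proof (induction rule: lspan.induct)
  case (add f \<psi> c)
  then obtain T where T: "T \<subseteq> X" "finite T" "f \<in> lspan T" by blast
  have "(\<lambda>n. f n + c * \<psi> n) \<in> lspan (insert \<psi> T)"
    by (rule lspan.add[OF lspan_mono[OF subset_insertI T(3)] insertI1])
  then show ?case using T add by (intro exI[of _ "insert \<psi> T"]) auto
qed (auto intro: lspan.zero)

lemma lspan_range:
  assumes "f \<in> lspan (range \<psi>)"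
  shows "\<exists>(m::nat) c. f = (\<lambda>n. \<Sum>k<m. c k * \<psi> k n)"
  using assms
proof (induction rule: lspan.induct)
  case zero
  show ?case by (intro exI[of _ 0]) simp
next
  case (add f \<phi> d)
  then obtain m c j where f: "f = (\<lambda>n. \<Sum>k<m. c k * \<psi> k n)" and j: "\<phi> = \<psi> j" by auto
  define m' where "m' = max m (Suc j)"
  define c' where "c' k = (if k < m then c k else 0) + (if k = j then d else 0)" for k
  have "(\<Sum>k<m'. c' k * \<psi> k n) = f n + d * \<phi> n" for n
  proof -
    have "(\<Sum>k<m'. c' k * \<psi> k n) = (\<Sum>k<m'. if k < m then c k * \<psi> k n else 0) + (\<Sum>k<m'. if k = j then d * \<psi> k n else 0)"
      unfolding sum.distrib[symmetric] by (intro sum.cong) (auto simp: c'_def distrib_right)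
    also have "(\<Sum>k<m'. if k < m then c k * \<psi> k n else 0) = (\<Sum>k<m. c k * \<psi> k n)"
      by (rule sum.mono_neutral_cong_right) (auto simp: m'_def)
    also have "(\<Sum>k<m'. if k = j then d * \<psi> k n else 0) = d * \<psi> j n"
      by (subst sum.delta) (auto simp: m'_def)
    finally show ?thesis by (simp add: f j)
  qed
  then show ?case by (intro exI[of _ m'] exI[of _ c']) auto
qed

definition approximable :: "(int \<Rightarrow> complex) set \<Rightarrow> (int \<Rightarrow> complex) \<Rightarrow> bool" where
  "approximable X \<phi> \<longleftrightarrow> (\<forall>\<epsilon>>0. \<exists>f\<in>lspan X. l2_le (\<lambda>n. \<phi> n - f n) \<epsilon>)"

lemma approximable_add:
  assumes "approximable X \<phi>" "approximable X \<phi>'"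
  shows "approximable X (\<lambda>n. \<phi> n + \<phi>' n)"
  unfolding approximable_def
proof (intro allI impI)
  fix \<epsilon> :: real assume "\<epsilon> > 0"
  then obtain f f' where f: "f \<in> lspan X" "l2_le (\<lambda>n. \<phi> n - f n) (\<epsilon>/2)"
    and f': "f' \<in> lspan X" "l2_le (\<lambda>n. \<phi>' n - f' n) (\<epsilon>/2)"
    using assms unfolding approximable_def by (meson half_gt_zero)
  have "l2_le (\<lambda>n. \<phi> n + \<phi>' n - (f n + f' n)) \<epsilon>"
    using l2_le_add[OF f(2) f'(2)] by (simp add: algebra_simps)
  then show "\<exists>f\<in>lspan X. l2_le (\<lambda>n. \<phi> n + \<phi>' n - f n) \<epsilon>"
    using lspan_plus[OF f'(1) f(1)] by (intro bexI[of _ "\<lambda>n. f n + f' n"])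
qed

lemma approximable_scale:
  assumes "approximable X \<phi>"
  shows "approximable X (\<lambda>n. c * \<phi> n)"
  unfolding approximable_def
proof (intro allI impI)
  fix \<epsilon> :: real assume \<epsilon>: "\<epsilon> > 0"
  then have "\<epsilon> / (norm c + 1) > 0" by (simp add: add_nonneg_pos)
  then obtain f where f: "f \<in> lspan X" "l2_le (\<lambda>n. \<phi> n - f n) (\<epsilon> / (norm c + 1))"
    using assms unfolding approximable_def by blast
  have "l2_le (\<lambda>n. c * (\<phi> n - f n)) (norm c * (\<epsilon> / (norm c + 1)))" by (rule l2_le_scale[OF f(2)])
  moreover have "norm c * (\<epsilon> / (norm c + 1)) \<le> \<epsilon>"
  proof -
    have p: "norm c + 1 > 0" by (simp add: add_nonneg_pos)
    have "norm c * (\<epsilon> / (norm c + 1)) \<le> (norm c + 1) * (\<epsilon> / (norm c + 1))"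
      using p \<epsilon> by (intro mult_right_mono) auto
    also have "\<dots> = \<epsilon>" using p by simp
    finally show ?thesis .
  qed
  ultimately have "l2_le (\<lambda>n. c * \<phi> n - c * f n) \<epsilon>"
    by (simp add: right_diff_distrib) (rule l2_le_mono)
  then show "\<exists>g\<in>lspan X. l2_le (\<lambda>n. c * \<phi> n - g n) \<epsilon>"
    using lspan_scale[OF f(1)] by (intro bexI[of _ "\<lambda>n. c * f n"])
qed

lemma approximable_zero: "approximable X (\<lambda>_. 0)"
  unfolding approximable_def using lspan.zero[of X] by (auto simp: l2_le_def L2_set_def intro!: bexI[of _ "\<lambda>_. 0"])

definition unit_vector :: "int \<Rightarrow> int \<Rightarrow> complex" where
  "unit_vector a n = (if n = a then 1 else 0)"

lemma approximable_ell2: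
  assumes X: "\<And>a. approximable X (unit_vector a)" and \<phi>: "\<phi> \<in> ell2"
  shows "approximable X \<phi>"
  unfolding approximable_def
proof (intro allI impI)
  fix \<epsilon> :: real assume \<epsilon>: "\<epsilon> > 0"
  obtain F0 where F0: "finite F0" and tail: "\<And>F. finite F \<Longrightarrow> F \<inter> F0 = {} \<Longrightarrow> (\<Sum>n\<in>F. (norm (\<phi> n))\<^sup>2) \<le> (\<epsilon>/2)\<^sup>2"
    by (rule ell2_tail[OF \<phi>, of "(\<epsilon>/2)\<^sup>2"]) (use \<epsilon> in auto)
  define h where "h n = (\<Sum>a\<in>F0. \<phi> a * unit_vector a n)" for n
  have fin: "approximable X (\<lambda>n. \<Sum>a\<in>F. \<phi> a * unit_vector a n)" if "finite F" for F
    using that by (induction F rule: finite_induct)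
      (auto intro!: approximable_zero approximable_add approximable_scale X)
  then obtain f where f: "f \<in> lspan X" "l2_le (\<lambda>n. h n - f n) (\<epsilon>/2)"
    using fin[OF F0] \<epsilon> unfolding approximable_def h_def by (meson half_gt_zero)
  have h: "h n = (if n \<in> F0 then \<phi> n else 0)" for n
    using F0 by (simp add: h_def unit_vector_def if_distrib[of "(*) _"] sum.delta cong: if_cong)
  have "l2_le (\<lambda>n. \<phi> n - h n) (\<epsilon>/2)"
    unfolding l2_le_def
  proof (intro allI impI)
    fix F :: "int set" assume F: "finite F"
    have "(\<Sum>n\<in>F. (norm (\<phi> n - h n))\<^sup>2) = (\<Sum>n\<in>F - F0. (norm (\<phi> n))\<^sup>2)"
      by (rule sum.mono_neutral_cong_right) (use F in \<open>auto simp: h\<close>)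
    also have "\<dots> \<le> (\<epsilon>/2)\<^sup>2" using F by (intro tail) auto
    finally show "L2_set (\<lambda>n. norm (\<phi> n - h n)) F \<le> \<epsilon>/2"
      unfolding L2_set_def using \<epsilon> by (intro real_le_lsqrt) auto
  qed
  from l2_le_add[OF this f(2)] show "\<exists>f\<in>lspan X. l2_le (\<lambda>n. \<phi> n - f n) \<epsilon>"
    using f(1) by auto
qed

section \<open>Localized eigenvectors with dense span\<close>

definition localized_eigenvectors :: "(int \<Rightarrow> real) \<Rightarrow> (int \<Rightarrow> complex) set" where
  "localized_eigenvectors \<omega> = {\<psi>. \<psi> \<in> ell2 \<and> \<psi> \<noteq> (\<lambda>_. 0) \<and> exponentially_decaying \<psi> \<and>
     (\<exists>E::real. anderson \<omega> \<psi> = (\<lambda>n. complex_of_real E * \<psi> n))}"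

text \<open>The span of eigenvectors is invariant, and boundedness of the operator by
  \<open>2 + R\<close> extends this to the closure.\<close>

lemma approximable_anderson:
  assumes \<omega>: "\<And>n. \<bar>\<omega> n\<bar> \<le> R" and \<phi>: "approximable (localized_eigenvectors \<omega>) \<phi>"
  shows "approximable (localized_eigenvectors \<omega>) (anderson \<omega> \<phi>)"
proof -
  let ?X = "localized_eigenvectors \<omega>"
  have inv: "anderson \<omega> f \<in> lspan ?X" if "f \<in> lspan ?X" for f
    using that
  proof (induction rule: lspan.induct)
    case zero
    then show ?case by (simp add: anderson_def lspan.zero)
  next
    case (add f \<psi> c)
    then obtain E :: real where E: "anderson \<omega> \<psi> = (\<lambda>n. complex_of_real E * \<psi> n)"
      by (auto simp: localized_eigenvectors_def)
    have "anderson \<omega> (\<lambda>n. f n + c * \<psi> n) = (\<lambda>n. anderson \<omega> f n + c * anderson \<omega> \<psi> n)"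
      by (simp add: anderson_def algebra_simps)
    also have "\<dots> = (\<lambda>n. anderson \<omega> f n + (c * complex_of_real E) * \<psi> n)"
      unfolding E by (simp add: mult.assoc)
    finally show ?case using add by (simp add: lspan.add)
  qed
  have R: "0 \<le> R" using \<omega>[of 0] by simp
  show ?thesis unfolding approximable_def
  proof (intro allI impI)
    fix \<epsilon> :: real assume \<epsilon>: "\<epsilon> > 0"
    then have "\<epsilon> / (2 + R) > 0" using R by simp
    then obtain f where f: "f \<in> lspan ?X" "l2_le (\<lambda>n. \<phi> n - f n) (\<epsilon> / (2 + R))"
      using \<phi> unfolding approximable_def by blast
    have "l2_le (anderson \<omega> (\<lambda>n. \<phi> n - f n)) ((2 + R) * (\<epsilon> / (2 + R)))"
      by (rule l2_le_anderson[OF f(2) \<omega>])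
    moreover have "(2 + R) * (\<epsilon> / (2 + R)) = \<epsilon>" using R by simp
    moreover have "anderson \<omega> (\<lambda>n. \<phi> n - f n) = (\<lambda>n. anderson \<omega> \<phi> n - anderson \<omega> f n)"
      by (simp add: anderson_def fun_eq_iff algebra_simps)
    ultimately have "l2_le (\<lambda>n. anderson \<omega> \<phi> n - anderson \<omega> f n) \<epsilon>" by simp
    then show "\<exists>g\<in>lspan ?X. l2_le (\<lambda>n. anderson \<omega> \<phi> n - g n) \<epsilon>"
      using inv[OF f(1)] by blast
  qed
qed

lemma anderson_unit_vector:
  "anderson \<omega> (unit_vector a) = (\<lambda>n. unit_vector (a + 1) n + unit_vector (a - 1) n + complex_of_real (\<omega> a) * unit_vector a n)"
  by (auto simp: anderson_def unit_vector_def fun_eq_iff)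

text \<open>The operator maps the unit vector at \<open>b\<close> to the sum of both neighbours plus
  a multiple of itself. Two adjacent unit vectors therefore generate the next one in either
  direction, whereas the first step from a single one yields only the symmetric sum of its
  neighbours.\<close>

lemma all_unit_vectors_approximable:
  assumes \<omega>: "\<And>n. \<bar>\<omega> n\<bar> \<le> R"
    and a: "approximable (localized_eigenvectors \<omega>) (unit_vector a)"
    and a1: "approximable (localized_eigenvectors \<omega>) (unit_vector (a + 1))"
  shows "approximable (localized_eigenvectors \<omega>) (unit_vector n)"
proof -
  let ?P = "\<lambda>a. approximable (localized_eigenvectors \<omega>) (unit_vector a)"
  have H: "approximable (localized_eigenvectors \<omega>)
      (\<lambda>n. anderson \<omega> (unit_vector b) n + (-1) * unit_vector c n + (- complex_of_real (\<omega> b)) * unit_vector b n)"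
    if "?P b" "?P c" for b c
    using that by (intro approximable_add approximable_scale approximable_anderson[OF \<omega>])
  have up: "?P (b + 1)" if "?P b" "?P (b - 1)" for b
    using H[OF that] unfolding anderson_unit_vector by simp
  have down: "?P (b - 1)" if "?P b" "?P (b + 1)" for b
    using H[OF that] unfolding anderson_unit_vector by simp
  have U: "?P (a + int k) \<and> ?P (a + int k + 1)" for k
  proof (induction k)
    case (Suc k)
    then show ?case using up[of "a + int k + 1"] by (simp add: algebra_simps)
  qed (use a a1 in simp)
  have D: "?P (a - int k) \<and> ?P (a - int k + 1)" for k
  proof (induction k)
    case (Suc k)
    then show ?case using down[of "a - int k"] by (simp add: algebra_simps)
  qed (use a a1 in simp)
  show ?thesis
  proof (cases "n \<ge> a")
    case True
    then show ?thesis using U[of "nat (n - a)"] by simp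
  next
    case False
    then show ?thesis using D[of "nat (a - n)"] by simp
  qed
qed

text \<open>The set of all localized eigenvectors is not given as a sequence. For each site and each
  accuracy \<open>1 / (j + 1)\<close> a finite subset suffices; their union is countable, still has
  dense span, and can be enumerated.\<close>

lemma spectrally_localizedI:
  assumes P: "\<And>a. approximable (localized_eigenvectors \<omega>) (unit_vector a)"
  shows "spectrally_localized (anderson \<omega>)"
proof -
  let ?X = "localized_eigenvectors \<omega>"
  have ex: "\<exists>T. T \<subseteq> ?X \<and> finite T \<and> (\<exists>f\<in>lspan T. l2_le (\<lambda>n. unit_vector a n - f n) (1 / real (Suc j)))" for a j
  proof -
    obtain f where f: "f \<in> lspan ?X" "l2_le (\<lambda>n. unit_vector a n - f n) (1 / real (Suc j))"
      using P[of a] unfolding approximable_def by (metis of_nat_0_less_iff zero_less_Suc zero_less_divide_1_iff)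
    then show ?thesis using lspan_finite[OF f(1)] by blast
  qed
  define T where "T a j = (SOME T. T \<subseteq> ?X \<and> finite T \<and>
     (\<exists>f\<in>lspan T. l2_le (\<lambda>n. unit_vector a n - f n) (1 / real (Suc j))))" for a j
  have T: "T a j \<subseteq> ?X" "finite (T a j)" "\<exists>f\<in>lspan (T a j). l2_le (\<lambda>n. unit_vector a n - f n) (1 / real (Suc j))" for a j
    using someI_ex[OF ex[of a j]] unfolding T_def by blast+
  define D where "D = (\<Union>a j. T a j)"
  have D: "D \<subseteq> ?X" unfolding D_def using T by auto
  have cD: "countable D" unfolding D_def by (intro countable_UN countable_finite T countableI_type)
  have PD: "approximable D (unit_vector a)" for a
    unfolding approximable_def
  proof (intro allI impI)
    fix \<epsilon> :: real assume "\<epsilon> > 0"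
    then obtain j where j: "1 / real (Suc j) < \<epsilon>" by (metis nat_approx_posE)
    obtain f where "f \<in> lspan (T a j)" "l2_le (\<lambda>n. unit_vector a n - f n) (1 / real (Suc j))" using T by blast
    then show "\<exists>f\<in>lspan D. l2_le (\<lambda>n. unit_vector a n - f n) \<epsilon>"
      using j by (intro bexI[of _ f]) (auto intro: l2_le_mono lspan_mono[of "T a j"] simp: D_def)
  qed
  have "D \<noteq> {}"
  proof
    assume "D = {}"
    obtain f where f: "f \<in> lspan D" "l2_le (\<lambda>n. unit_vector 0 n - f n) (1/2)"
      using PD[of 0] unfolding approximable_def by (metis half_gt_zero zero_less_one)
    from f(1) have "f = (\<lambda>_. 0)" unfolding \<open>D = {}\<close> by cases auto
    with f(2) have "l2_le (unit_vector 0) (1/2)" by simp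
    then have "L2_set (\<lambda>n. norm (unit_vector 0 n)) {0} \<le> 1/2" by (simp only: l2_le_def finite.intros)
    then show False by (simp add: L2_set_def unit_vector_def)
  qed
  define \<psi> where "\<psi> = from_nat_into D"
  have range: "range \<psi> = D" unfolding \<psi>_def using cD \<open>D \<noteq> {}\<close> by (intro range_from_nat_into)
  then have "\<forall>k. \<psi> k \<in> ?X" using D by auto
  then have eig: "\<forall>k. \<psi> k \<in> ell2 \<and> \<psi> k \<noteq> (\<lambda>_. 0) \<and> exponentially_decaying (\<psi> k)"
    and "\<forall>k. \<exists>E::real. anderson \<omega> (\<psi> k) = (\<lambda>n. complex_of_real E * \<psi> k n)"
    by (auto simp: localized_eigenvectors_def)
  then obtain E :: "nat \<Rightarrow> real" where E: "\<And>k. anderson \<omega> (\<psi> k) = (\<lambda>n. complex_of_real (E k) * \<psi> k n)"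
    by metis
  have "finite_combinations_dense \<psi>"
    unfolding finite_combinations_dense_def
  proof (intro ballI allI impI)
    fix \<phi> and \<epsilon> :: real assume \<phi>: "\<phi> \<in> ell2" and \<epsilon>: "\<epsilon> > 0"
    obtain f where f: "f \<in> lspan (range \<psi>)" "l2_le (\<lambda>n. \<phi> n - f n) (\<epsilon>/2)"
      using approximable_ell2[OF PD \<phi>] \<epsilon> unfolding approximable_def range by (meson half_gt_zero)
    obtain m c where "f = (\<lambda>n. \<Sum>k<m. c k * \<psi> k n)" using lspan_range[OF f(1)] by blast
    then have "ell2_norm (\<lambda>n. \<phi> n - (\<Sum>k<m. c k * \<psi> k n)) < \<epsilon>"
      using l2_le_ell2(2)[OF f(2)] \<epsilon> by simp
    then show "\<exists>m c. ell2_norm (\<lambda>n. \<phi> n - (\<Sum>k<m. c k * \<psi> k n)) < \<epsilon>" by blast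
  qed
  then show ?thesis unfolding spectrally_localized_def using eig E by blast
qed

section \<open>From boxes to the line\<close>

definition solution_on :: "(int \<Rightarrow> real) \<Rightarrow> real \<Rightarrow> int set \<Rightarrow> (int \<Rightarrow> real) \<Rightarrow> bool" where
  "solution_on \<omega> E S u \<longleftrightarrow> (\<forall>n\<in>S. u (n + 1) + u (n - 1) + \<omega> n * u n = E * u n)"

text \<open>The normalization near \<open>a\<close> keeps limits from vanishing. It involves both
  neighbours because decay to the right is measured against the pair at \<open>a\<close>,
  \<open>a + 1\<close>, and decay to the left against the pair at \<open>a\<close>,
  \<open>a - 1\<close>.\<close>

definition normalized_decaying :: "int \<Rightarrow> real \<Rightarrow> real \<Rightarrow> (int \<Rightarrow> real) \<Rightarrow> bool" where
  "normalized_decaying a C \<tau> u \<longleftrightarrow>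
     (u (a - 1))\<^sup>2 + (u a)\<^sup>2 + (u (a + 1))\<^sup>2 = 1 \<and> (\<forall>n. \<bar>u n\<bar> \<le> C * \<tau> ^ nat \<bar>n - a\<bar>)"

lemma summable_on_exponential_int:
  fixes x :: real
  assumes "0 \<le> x" "x < 1"
  shows "(\<lambda>n::int. x ^ nat \<bar>n - a\<bar>) summable_on UNIV"
proof -
  have s: "(\<lambda>n::nat. x ^ n) summable_on UNIV"
    using assms by (intro norm_summable_imp_summable_on) (simp add: summable_geometric)
  have 1: "(\<lambda>n::int. x ^ nat \<bar>n - a\<bar>) summable_on range (\<lambda>k. a + int k)"
    using s by (subst summable_on_reindex) (auto simp: inj_on_def o_def)
  have 2: "(\<lambda>n::int. x ^ nat \<bar>n - a\<bar>) summable_on range (\<lambda>k. a - int k)"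
    using s by (subst summable_on_reindex) (auto simp: inj_on_def o_def)
  have "range (\<lambda>k. a + int k) \<union> range (\<lambda>k. a - int k) = UNIV"
  proof (intro equalityI subsetI UNIV_I)
    fix n :: int
    show "n \<in> range (\<lambda>k. a + int k) \<union> range (\<lambda>k. a - int k)"
    proof (cases "n \<ge> a")
      case True
      then have "n = a + int (nat (n - a))" by simp
      then show ?thesis by blast
    next
      case False
      then have "n = a - int (nat (a - n))" by simp
      then show ?thesis by blast
    qed
  qed
  moreover have "(\<lambda>n::int. x ^ nat \<bar>n - a\<bar>) summable_on (range (\<lambda>k. a + int k) \<union> (range (\<lambda>k. a - int k) - range (\<lambda>k. a + int k)))"
    by (intro summable_on_Un_disjoint 1 summable_on_subset_banach[OF 2]) auto
  ultimately show ?thesis by (simp add: Un_Diff_cancel)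
qed

lemma exponential_in_ell2:
  assumes \<tau>: "0 < \<tau>" "\<tau> < 1" and f: "\<And>n. norm (f n) \<le> C * \<tau> ^ nat \<bar>n - a\<bar>"
  shows "f \<in> ell2"
proof -
  have "(\<lambda>n. C\<^sup>2 * (\<tau>\<^sup>2) ^ nat \<bar>n - a\<bar>) summable_on UNIV"
    using \<tau> by (intro summable_on_cmult_right summable_on_exponential_int) (auto simp: power_less_one_iff)
  then show ?thesis unfolding ell2_def mem_Collect_eq
  proof (rule summable_on_comparison_test)
    fix n
    have "(norm (f n))\<^sup>2 \<le> (C * \<tau> ^ nat \<bar>n - a\<bar>)\<^sup>2" using f by (intro power_mono) auto
    then show "(norm (f n))\<^sup>2 \<le> C\<^sup>2 * (\<tau>\<^sup>2) ^ nat \<bar>n - a\<bar>"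
      by (simp add: power_mult_distrib power_mult[symmetric] mult.commute)
  qed auto
qed

lemma localized_eigenvectorI:
  assumes \<tau>: "0 < \<tau>" "\<tau> < 1" and sol: "solution_on \<omega> E UNIV v" and v: "normalized_decaying a C \<tau> v"
  shows "(\<lambda>n. complex_of_real (v n)) \<in> localized_eigenvectors \<omega>"
proof -
  have dec: "\<bar>v n\<bar> \<le> C * \<tau> ^ nat \<bar>n - a\<bar>" for n using v by (simp add: normalized_decaying_def)
  have C: "C \<ge> 0" using dec[of a] by simp
  have "(\<lambda>n. complex_of_real (v n)) \<in> ell2"
    by (rule exponential_in_ell2[OF \<tau>, of _ C a]) (simp add: dec)
  moreover have "(\<lambda>n. complex_of_real (v n)) \<noteq> (\<lambda>_. 0)"
  proof
    assume "(\<lambda>n. complex_of_real (v n)) = (\<lambda>_. 0)"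
    then have "v n = 0" for n by (metis of_real_eq_0_iff)
    then show False using v by (simp add: normalized_decaying_def)
  qed
  moreover have "exponentially_decaying (\<lambda>n. complex_of_real (v n))"
    unfolding exponentially_decaying_def
  proof (intro exI conjI allI)
    show "C + 1 > 0" "- ln \<tau> > 0" using C \<tau> by auto
    fix n
    have "\<tau> ^ nat \<bar>n - a\<bar> = exp (ln \<tau>) ^ nat \<bar>n - a\<bar>" using \<tau> by simp
    also have "\<dots> = exp (real (nat \<bar>n - a\<bar>) * ln \<tau>)" by (rule exp_of_nat_mult[symmetric])
    finally have eq: "\<tau> ^ nat \<bar>n - a\<bar> = exp (- (- ln \<tau>) * of_int \<bar>n - a\<bar>)" by (simp add: mult.commute)
    have "C * \<tau> ^ nat \<bar>n - a\<bar> \<le> (C + 1) * \<tau> ^ nat \<bar>n - a\<bar>" using \<tau> by (intro mult_right_mono) auto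
    then have "\<bar>v n\<bar> \<le> (C + 1) * \<tau> ^ nat \<bar>n - a\<bar>" using dec[of n] by linarith
    then show "norm (complex_of_real (v n)) \<le> (C + 1) * exp (- (- ln \<tau>) * of_int \<bar>n - a\<bar>)"
      unfolding eq norm_of_real .
  qed
  moreover have "anderson \<omega> (\<lambda>n. complex_of_real (v n)) = (\<lambda>n. complex_of_real E * complex_of_real (v n))"
    using sol unfolding anderson_def solution_on_def
    by (auto simp flip: of_real_add of_real_mult)
  ultimately show ?thesis by (auto simp: localized_eigenvectors_def)
qed

text \<open>Dominated convergence in l2: the common exponential majorant makes the tails uniformly
  small, and only finitely many sites remain.\<close>

lemma dominated_pointwise_limit_l2:
  assumes \<tau>: "0 < \<tau>" "\<tau> < 1" and \<epsilon>: "\<epsilon> > 0"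
    and u: "\<And>k n. \<bar>u k n\<bar> \<le> C * \<tau> ^ nat \<bar>n - a\<bar>" and lim: "\<And>n. (\<lambda>k. u k n) \<longlonglongrightarrow> v n"
  shows "\<forall>\<^sub>F k in sequentially. l2_le (\<lambda>n. complex_of_real (u k n - v n)) \<epsilon>"
proof -
  have v: "\<bar>v n\<bar> \<le> C * \<tau> ^ nat \<bar>n - a\<bar>" for n
    by (rule LIMSEQ_le_const2[OF tendsto_rabs[OF lim]]) (use u in auto)
  define g where "g n = complex_of_real (2 * C * \<tau> ^ nat \<bar>n - a\<bar>)" for n
  have C: "C \<ge> 0" using v[of a] by simp
  have "g \<in> ell2" by (rule exponential_in_ell2[OF \<tau>, of _ "2 * C" a]) (use C \<tau> in \<open>simp add: g_def norm_mult norm_power\<close>)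
  then obtain F0 where F0: "finite F0" and tail: "\<And>F. finite F \<Longrightarrow> F \<inter> F0 = {} \<Longrightarrow> (\<Sum>n\<in>F. (norm (g n))\<^sup>2) \<le> \<epsilon>\<^sup>2 / 2"
    by (rule ell2_tail[of g "\<epsilon>\<^sup>2 / 2"]) (use \<epsilon> in auto)
  have "(\<lambda>k. \<Sum>n\<in>F0. (u k n - v n)\<^sup>2) \<longlonglongrightarrow> (\<Sum>n\<in>F0. (v n - v n)\<^sup>2)"
    by (intro tendsto_intros lim)
  then have "(\<lambda>k. \<Sum>n\<in>F0. (u k n - v n)\<^sup>2) \<longlonglongrightarrow> 0" by simp
  then have "\<forall>\<^sub>F k in sequentially. (\<Sum>n\<in>F0. (u k n - v n)\<^sup>2) < \<epsilon>\<^sup>2 / 2"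
    using \<epsilon> by (intro order_tendstoD(2)) auto
  then show ?thesis
  proof eventually_elim
    fix k assume k: "(\<Sum>n\<in>F0. (u k n - v n)\<^sup>2) < \<epsilon>\<^sup>2 / 2"
    show "l2_le (\<lambda>n. complex_of_real (u k n - v n)) \<epsilon>"
      unfolding l2_le_def
    proof (intro allI impI)
      fix F :: "int set" assume F: "finite F"
      have "(\<Sum>n\<in>F. (u k n - v n)\<^sup>2) = (\<Sum>n\<in>F \<inter> F0. (u k n - v n)\<^sup>2) + (\<Sum>n\<in>F - F0. (u k n - v n)\<^sup>2)"
        using F by (subst sum.union_disjoint[symmetric]) (auto intro!: sum.cong)
      also have "(\<Sum>n\<in>F \<inter> F0. (u k n - v n)\<^sup>2) \<le> (\<Sum>n\<in>F0. (u k n - v n)\<^sup>2)"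
        using F0 by (intro sum_mono2) auto
      also have "(\<Sum>n\<in>F - F0. (u k n - v n)\<^sup>2) \<le> (\<Sum>n\<in>F - F0. (norm (g n))\<^sup>2)"
      proof (rule sum_mono)
        fix n
        have "\<bar>u k n - v n\<bar> \<le> 2 * C * \<tau> ^ nat \<bar>n - a\<bar>" using u[of k n] v[of n] by linarith
        also have "\<dots> \<le> norm (g n)" unfolding g_def norm_of_real by (rule abs_ge_self)
        finally show "(u k n - v n)\<^sup>2 \<le> (norm (g n))\<^sup>2" by (metis abs_ge_zero power2_abs power_mono)
      qed
      also have "\<dots> \<le> \<epsilon>\<^sup>2 / 2" using F by (intro tail) auto
      finally have "(\<Sum>n\<in>F. (u k n - v n)\<^sup>2) \<le> \<epsilon>\<^sup>2" using k by linarith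
      then show "L2_set (\<lambda>n. norm (complex_of_real (u k n - v n))) F \<le> \<epsilon>"
        unfolding L2_set_def norm_of_real power2_abs using \<epsilon> by (intro real_le_lsqrt) (auto intro: sum_nonneg)
    qed
  qed
qed

text \<open>A solution is determined by its energy and its values at two neighbouring sites, so sequences of
  approximate solutions have convergent subsequences by compactness in \<open>\<real>\<^sup>3\<close>.\<close>

lemma solution_compactness:
  assumes \<tau>: "0 < \<tau>" "\<tau> < 1" and \<epsilon>: "\<epsilon> > 0"
  shows "\<exists>L0. \<forall>L\<ge>L0. \<forall>E u. \<bar>E\<bar> \<le> Q \<longrightarrow> solution_on \<omega> E {a - int L..a + int L} u \<longrightarrow> normalized_decaying a C \<tau> u \<longrightarrow>
     (\<exists>v. (\<lambda>n. complex_of_real (v n)) \<in> localized_eigenvectors \<omega> \<and> l2_le (\<lambda>n. complex_of_real (u n - v n)) \<epsilon>)"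
proof (rule ccontr)
  assume "\<not> ?thesis"
  then have "\<forall>k. \<exists>L E u. L \<ge> k \<and> \<bar>E\<bar> \<le> Q \<and> solution_on \<omega> E {a - int L..a + int L} u \<and> normalized_decaying a C \<tau> u \<and>
     \<not> (\<exists>v. (\<lambda>n. complex_of_real (v n)) \<in> localized_eigenvectors \<omega> \<and> l2_le (\<lambda>n. complex_of_real (u n - v n)) \<epsilon>)"
    by blast
  then obtain L E u where L: "\<And>k::nat. L k \<ge> k" and E: "\<And>k. \<bar>E k\<bar> \<le> Q"
    and sol: "\<And>k. solution_on \<omega> (E k) {a - int (L k)..a + int (L k)} (u k)" and nd: "\<And>k. normalized_decaying a C \<tau> (u k)"
    and bad: "\<And>k. \<not> (\<exists>v. (\<lambda>n. complex_of_real (v n)) \<in> localized_eigenvectors \<omega> \<and> l2_le (\<lambda>n. complex_of_real (u k n - v n)) \<epsilon>)"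
    by metis
  have dec: "\<bar>u k n\<bar> \<le> C * \<tau> ^ nat \<bar>n - a\<bar>" for k n using nd[of k] by (simp add: normalized_decaying_def)
  have C: "C \<ge> 0" using dec[of 0 a] by simp
  define x where "x k = (E k, u k a, u k (a + 1))" for k
  have "norm (x k) \<le> Q + (C + C * \<tau>)" for k
  proof -
    have "norm (x k) \<le> \<bar>E k\<bar> + norm (u k a, u k (a + 1))" unfolding x_def using norm_Pair_le[of "E k"] by simp
    also have "norm (u k a, u k (a + 1)) \<le> \<bar>u k a\<bar> + \<bar>u k (a + 1)\<bar>" using norm_Pair_le[of "u k a" "u k (a + 1)"] by simp
    finally show ?thesis using E[of k] dec[of k a] dec[of k "a + 1"] by simp
  qed
  then have "bounded (range x)" by (auto simp: bounded_iff)
  then obtain l r where r: "strict_mono r" and l: "(x \<circ> r) \<longlonglongrightarrow> l"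
    using bounded_imp_convergent_subsequence by blast
  define E' where "E' = fst l"
  have limE: "(\<lambda>k. E (r k)) \<longlonglongrightarrow> E'" using tendsto_fst[OF l] by (simp add: x_def o_def E'_def)
  have lim0: "convergent (\<lambda>k. u (r k) a)" "convergent (\<lambda>k. u (r k) (a + 1))"
    using tendsto_fst[OF tendsto_snd[OF l]] tendsto_snd[OF tendsto_snd[OF l]]
    by (auto simp: x_def o_def convergent_def)
  \<comment> \<open>Every fixed site eventually lies in the boxes, as the \<open>k\<close>-th one
    has radius at least \<open>k\<close>; so the equation passes to the limit at all sites.\<close>
  have rec: "\<forall>\<^sub>F k in sequentially. u (r k) (n + 1) + u (r k) (n - 1) + \<omega> n * u (r k) n = E (r k) * u (r k) n" for n
    using eventually_ge_at_top[of "nat \<bar>n - a\<bar>"]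
  proof eventually_elim
    fix k assume "nat \<bar>n - a\<bar> \<le> k"
    then have "nat \<bar>n - a\<bar> \<le> L (r k)" using L[of "r k"] seq_suble[OF r, of k] by linarith
    then have "n \<in> {a - int (L (r k))..a + int (L (r k))}" by auto
    then show "u (r k) (n + 1) + u (r k) (n - 1) + \<omega> n * u (r k) n = E (r k) * u (r k) n"
      using sol[of "r k"] unfolding solution_on_def by blast
  qed
  have cE: "convergent (\<lambda>k. E (r k))" using limE by (auto simp: convergent_def)
  have up: "convergent (\<lambda>k. u (r k) (n + 1))" if "convergent (\<lambda>k. u (r k) n)" "convergent (\<lambda>k. u (r k) (n - 1))" for n
  proof -
    have "convergent (\<lambda>k. (E (r k) - \<omega> n) * u (r k) n - u (r k) (n - 1))"
      using that cE by (intro convergent_diff convergent_mult convergent_const)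
    then show ?thesis
      by (rule convergent_cong[THEN iffD1, rotated])
        (use rec[of n] in \<open>auto elim!: eventually_mono simp: algebra_simps\<close>)
  qed
  have down: "convergent (\<lambda>k. u (r k) (n - 1))" if "convergent (\<lambda>k. u (r k) n)" "convergent (\<lambda>k. u (r k) (n + 1))" for n
  proof -
    have "convergent (\<lambda>k. (E (r k) - \<omega> n) * u (r k) n - u (r k) (n + 1))"
      using that cE by (intro convergent_diff convergent_mult convergent_const)
    then show ?thesis
      by (rule convergent_cong[THEN iffD1, rotated])
        (use rec[of n] in \<open>auto elim!: eventually_mono simp: algebra_simps\<close>)
  qed
  have U: "convergent (\<lambda>k. u (r k) (a + int m)) \<and> convergent (\<lambda>k. u (r k) (a + int m + 1))" for m
  proof (induction m)
    case (Suc m)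
    then show ?case using up[of "a + int m + 1"] by (simp add: algebra_simps)
  qed (use lim0 in simp)
  have D: "convergent (\<lambda>k. u (r k) (a - int m)) \<and> convergent (\<lambda>k. u (r k) (a - int m + 1))" for m
  proof (induction m)
    case (Suc m)
    then show ?case using down[of "a - int m"] by (simp add: algebra_simps)
  qed (use lim0 in simp)
  have conv: "convergent (\<lambda>k. u (r k) n)" for n
  proof (cases "n \<ge> a")
    case True
    then show ?thesis using U[of "nat (n - a)"] by simp
  next
    case False
    then show ?thesis using D[of "nat (a - n)"] by simp
  qed
  define v where "v n = lim (\<lambda>k. u (r k) n)" for n
  have lim: "(\<lambda>k. u (r k) n) \<longlonglongrightarrow> v n" for n using conv[of n] unfolding v_def by (simp add: convergent_LIMSEQ_iff)
  have "solution_on \<omega> E' UNIV v"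
    unfolding solution_on_def
  proof
    fix n
    have "(\<lambda>k. u (r k) (n + 1) + u (r k) (n - 1) + \<omega> n * u (r k) n) \<longlonglongrightarrow> v (n + 1) + v (n - 1) + \<omega> n * v n"
      by (intro tendsto_intros lim)
    then have "(\<lambda>k. E (r k) * u (r k) n) \<longlonglongrightarrow> v (n + 1) + v (n - 1) + \<omega> n * v n"
      by (rule Lim_transform_eventually) (rule rec)
    moreover have "(\<lambda>k. E (r k) * u (r k) n) \<longlonglongrightarrow> E' * v n" by (intro tendsto_intros lim limE)
    ultimately show "v (n + 1) + v (n - 1) + \<omega> n * v n = E' * v n" by (rule LIMSEQ_unique)
  qed
  moreover have "normalized_decaying a C \<tau> v"
    unfolding normalized_decaying_def
  proof (intro conjI allI)
    have "(\<lambda>k. (u (r k) (a - 1))\<^sup>2 + (u (r k) a)\<^sup>2 + (u (r k) (a + 1))\<^sup>2) \<longlonglongrightarrow> (v (a - 1))\<^sup>2 + (v a)\<^sup>2 + (v (a + 1))\<^sup>2"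
      by (intro tendsto_intros lim)
    moreover have "(u (r k) (a - 1))\<^sup>2 + (u (r k) a)\<^sup>2 + (u (r k) (a + 1))\<^sup>2 = 1" for k
      using nd[of "r k"] by (simp add: normalized_decaying_def)
    ultimately have "(\<lambda>k. 1) \<longlonglongrightarrow> (v (a - 1))\<^sup>2 + (v a)\<^sup>2 + (v (a + 1))\<^sup>2" by simp
    then show "(v (a - 1))\<^sup>2 + (v a)\<^sup>2 + (v (a + 1))\<^sup>2 = 1" by (simp add: LIMSEQ_const_iff)
    show "\<bar>v n\<bar> \<le> C * \<tau> ^ nat \<bar>n - a\<bar>" for n
      by (rule LIMSEQ_le_const2[OF tendsto_rabs[OF lim]]) (use dec in auto)
  qed
  ultimately have "(\<lambda>n. complex_of_real (v n)) \<in> localized_eigenvectors \<omega>"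
    by (rule localized_eigenvectorI[OF \<tau>])
  moreover have "\<forall>\<^sub>F k in sequentially. l2_le (\<lambda>n. complex_of_real (u (r k) n - v n)) \<epsilon>"
    by (rule dominated_pointwise_limit_l2[OF \<tau> \<epsilon> dec lim])
  then obtain k where "l2_le (\<lambda>n. complex_of_real (u (r k) n - v n)) \<epsilon>"
    using eventually_happens by fastforce
  ultimately show False using bad by blast
qed

section \<open>Box eigenvectors on the line\<close>

definition box_vector :: "int \<Rightarrow> nat \<Rightarrow> (int \<Rightarrow> real) \<Rightarrow> real \<Rightarrow> int \<Rightarrow> real" where
  "box_vector a L \<omega> E n = (if \<bar>n - a\<bar> \<le> int L then jac (box_potential a L \<omega>) E (nat (n - a + int (Suc L))) else 0)"

text \<open>Extension by zero agrees with the recursion one site beyond the box: on the left by the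
  initial value, on the right because \<open>E\<close> is an eigenvalue. Hence the eigenvalue
  equation of the full operator holds up to the edges.\<close>

lemma box_vector_eq:
  assumes E: "E \<in> box_spectrum (box_potential a L \<omega>) (Suc (2 * L))" and n: "\<bar>n - a\<bar> \<le> int (Suc L)"
  shows "box_vector a L \<omega> E n = jac (box_potential a L \<omega>) E (nat (n - a + int (Suc L)))"
proof (cases "\<bar>n - a\<bar> \<le> int L")
  case False
  then have "n = a + int (Suc L) \<or> n = a - int (Suc L)" using n by linarith
  then show ?thesis
  proof
    assume "n = a + int (Suc L)"
    then have "nat (n - a + int (Suc L)) = Suc (Suc (2 * L))" by simp
    then show ?thesis using E False by (simp add: box_vector_def box_spectrum_def del: jac.simps)
  next
    assume "n = a - int (Suc L)"
    then have "nat (n - a + int (Suc L)) = 0" by simp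
    then show ?thesis using False by (simp add: box_vector_def)
  qed
qed (simp add: box_vector_def)

lemma box_vector_solution:
  assumes E: "E \<in> box_spectrum (box_potential a L \<omega>) (Suc (2 * L))"
  shows "solution_on \<omega> E {a - int L..a + int L} (box_vector a L \<omega> E)"
  unfolding solution_on_def
proof
  fix n assume n: "n \<in> {a - int L..a + int L}"
  define j where "j = nat (n - a + int L)"
  let ?b = "box_potential a L \<omega>"
  have j: "n = a - int L + int j" "nat (n + 1 - a + int (Suc L)) = Suc (Suc j)"
    "nat (n - 1 - a + int (Suc L)) = j" "nat (n - a + int (Suc L)) = Suc j"
    using n by (auto simp: j_def nat_eq_iff)
  have v: "box_vector a L \<omega> E (n + 1) = jac ?b E (Suc (Suc j))" "box_vector a L \<omega> E (n - 1) = jac ?b E j"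
    "box_vector a L \<omega> E n = jac ?b E (Suc j)"
    using n j by (subst box_vector_eq[OF E]; auto)+
  have "?b (Suc j) = \<omega> n" by (simp add: box_potential_def j(1) algebra_simps)
  then show "box_vector a L \<omega> E (n + 1) + box_vector a L \<omega> E (n - 1) + \<omega> n * box_vector a L \<omega> E n = E * box_vector a L \<omega> E n"
    unfolding v by (simp add: algebra_simps)
qed

lemma decay_of_weighted_power:
  fixes x :: real
  assumes "s > 0" "0 < \<rho>" "0 \<le> x" "(1 / \<rho>) ^ m * x powr s \<le> M0"
  shows "x \<le> M0 powr (1 / s) * (\<rho> powr (1 / s)) ^ m"
proof -
  have "x powr s \<le> M0 * \<rho> ^ m"
    using assms by (simp add: power_one_over field_simps)
  then have "(x powr s) powr (1 / s) \<le> (M0 * \<rho> ^ m) powr (1 / s)"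
    using assms by (intro powr_mono2) auto
  moreover have "(x powr s) powr (1 / s) = x" using assms by (simp add: powr_powr)
  moreover have "0 \<le> M0" using assms by (intro order_trans[OF _ assms(4)]) simp
  then have "(M0 * \<rho> ^ m) powr (1 / s) = M0 powr (1 / s) * (\<rho> powr (1 / s)) ^ m"
  proof -
    have "(\<rho> ^ m) powr (1 / s) = (\<rho> powr real m) powr (1 / s)" using assms by (simp only: powr_realpow)
    also have "\<dots> = (\<rho> powr (1 / s)) powr real m" by (simp only: powr_powr mult.commute)
    also have "\<dots> = (\<rho> powr (1 / s)) ^ m" using assms by (intro powr_realpow) simp
    finally show ?thesis using \<open>0 \<le> M0\<close> assms by (simp add: powr_mult)
  qed
  ultimately show ?thesis by simp
qed

lemma end_ratio_le_weighted_ratio: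
  assumes "\<rho> > 0" "m \<in> {1..L}"
  shows "(1 / \<rho>) ^ m * end_ratio s b L (Suc L - m) E \<le> weighted_ratio s \<rho> b L E"
  unfolding weighted_ratio_def using assms
  by (intro member_le_sum[where f="\<lambda>m. (1 / \<rho>) ^ m * end_ratio s b L (Suc L - m) E"]) (auto simp: end_ratio_def)

definition center_norm :: "int \<Rightarrow> nat \<Rightarrow> (int \<Rightarrow> real) \<Rightarrow> real \<Rightarrow> real" where
  "center_norm a L \<omega> E = sqrt ((box_vector a L \<omega> E (a - 1))\<^sup>2 + (box_vector a L \<omega> E a)\<^sup>2 + (box_vector a L \<omega> E (a + 1))\<^sup>2)"

text \<open>The left half is governed by the potential read from the left, the right half by the
  reversed one. Replacing the norm of a pair by the larger \<open>center_norm\<close> only decreases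
  the ratios, and the constant is at least 1 to cover the site \<open>a\<close>.\<close>

lemma box_vector_normalized_decaying:
  assumes E: "E \<in> box_spectrum (box_potential a L \<omega>) (Suc (2 * L))" and nz: "box_vector a L \<omega> E a \<noteq> 0"
    and g: "decay_weight s \<rho> a L \<omega> E \<le> M0" and s: "s > 0" and \<rho>: "0 < \<rho>" "\<rho> < 1"
  shows "normalized_decaying a (max 1 (M0 powr (1 / s))) (\<rho> powr (1 / s)) (\<lambda>n. box_vector a L \<omega> E n / center_norm a L \<omega> E)"
proof -
  define b where "b = box_potential a L \<omega>"
  define b' where "b' = box_potential_rev a L \<omega>"
  define \<phi> where "\<phi> = box_vector a L \<omega> E"
  define r where "r = center_norm a L \<omega> E"
  have r2: "r\<^sup>2 = (\<phi> (a - 1))\<^sup>2 + (\<phi> a)\<^sup>2 + (\<phi> (a + 1))\<^sup>2"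
    unfolding r_def center_norm_def \<phi>_def by (rule real_sqrt_pow2) simp
  have nz': "\<phi> a \<noteq> 0" using nz by (simp add: \<phi>_def)
  then have "r\<^sup>2 > 0" unfolding r2 by (simp add: add_pos_nonneg add_nonneg_pos)
  then have r: "r > 0" unfolding r_def center_norm_def by (simp add: r2)
  have E': "E \<in> box_spectrum b (Suc (2 * L))" using E by (simp add: b_def)
  have \<phi>: "\<phi> n = jac b E (nat (n - a + int (Suc L)))" if "\<bar>n - a\<bar> \<le> int (Suc L)" for n
    unfolding \<phi>_def b_def by (rule box_vector_eq[OF E that])
  have qN: "jac b E (Suc (2 * L)) \<noteq> 0"
    using jac_consecutive_nonzero[of b E "Suc (2 * L)"] E' by (auto simp: box_spectrum_def)
  have b'_eq: "b' = (\<lambda>i. b (Suc (Suc (2 * L)) - i))"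
    by (simp add: fun_eq_iff b'_def b_def box_potential_rev_def)
  have rev: "jac b E (Suc (Suc (2 * L)) - i) = jac b E (Suc (2 * L)) * jac b' E i" if "i \<le> Suc (Suc (2 * L))" for i
    unfolding b'_eq by (rule jac_reverse[OF E' that])
  have pair_le: "norm (x, y) \<le> r" if "x\<^sup>2 + y\<^sup>2 \<le> r\<^sup>2" for x y
    unfolding norm_Pair using that r by (intro real_le_lsqrt) auto
  have wn: "weighted_ratio s \<rho> b L E \<le> M0" "weighted_ratio s \<rho> b' L E \<le> M0"
    using g weighted_ratio_nonneg[of \<rho> s b L E] weighted_ratio_nonneg[of \<rho> s b' L E] \<rho>
    unfolding decay_weight_def b_def[symmetric] b'_def[symmetric] by linarith+
  have final: "\<bar>\<phi> n\<bar> / r \<le> M0 powr (1 / s) * (\<rho> powr (1 / s)) ^ m"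
    if "m \<in> {1..L}" "\<bar>\<phi> n\<bar> / r \<le> \<bar>jac c E (Suc L - m)\<bar> / norm (jac_vec c E L)" "weighted_ratio s \<rho> c L E \<le> M0" for n m c
  proof -
    have "(\<bar>\<phi> n\<bar> / r) powr s \<le> end_ratio s c L (Suc L - m) E"
      unfolding end_ratio_def using that r s by (intro powr_mono2) auto
    then have "(1 / \<rho>) ^ m * (\<bar>\<phi> n\<bar> / r) powr s \<le> (1 / \<rho>) ^ m * end_ratio s c L (Suc L - m) E"
      using \<rho> by (intro mult_left_mono) auto
    also have "\<dots> \<le> M0" using end_ratio_le_weighted_ratio[OF \<rho>(1) that(1)] that(3) by (rule order_trans)
    finally show ?thesis using s \<rho> r by (intro decay_of_weighted_power) auto
  qed
  have right: "\<bar>\<phi> (a + int m)\<bar> / r \<le> M0 powr (1 / s) * (\<rho> powr (1 / s)) ^ m" if m: "m \<in> {1..L}" for m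
  proof (rule final[OF m _ wn(2)])
    have i: "nat (a + int m - a + int (Suc L)) = Suc (Suc (2 * L)) - (Suc L - m)"
      "nat (a - a + int (Suc L)) = Suc (Suc (2 * L)) - Suc L" "nat (a + 1 - a + int (Suc L)) = Suc (Suc (2 * L)) - L"
      using m by auto
    have v: "\<phi> (a + int m) = jac b E (Suc (2 * L)) * jac b' E (Suc L - m)"
      "\<phi> a = jac b E (Suc (2 * L)) * jac b' E (Suc L)" "\<phi> (a + 1) = jac b E (Suc (2 * L)) * jac b' E L"
      using m by (subst \<phi>, simp, simp only: i, subst rev; simp)+
    have "norm (\<phi> a, \<phi> (a + 1)) = \<bar>jac b E (Suc (2 * L))\<bar> * norm (jac_vec b' E L)"
      unfolding jac_vec_def norm_Pair v
      by (simp add: power_mult_distrib distrib_left[symmetric] real_sqrt_mult del: jac.simps)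
    then have "\<bar>jac b' E (Suc L - m)\<bar> / norm (jac_vec b' E L) = \<bar>\<phi> (a + int m)\<bar> / norm (\<phi> a, \<phi> (a + 1))"
      unfolding v(1) using qN by (simp add: abs_mult del: jac.simps)
    moreover have "norm (\<phi> a, \<phi> (a + 1)) \<le> r" by (rule pair_le) (simp add: r2)
    moreover have "norm (\<phi> a, \<phi> (a + 1)) > 0" using nz' by (simp add: zero_prod_def)
    ultimately show "\<bar>\<phi> (a + int m)\<bar> / r \<le> \<bar>jac b' E (Suc L - m)\<bar> / norm (jac_vec b' E L)"
      using r by (simp add: divide_left_mono)
  qed
  have left: "\<bar>\<phi> (a - int m)\<bar> / r \<le> M0 powr (1 / s) * (\<rho> powr (1 / s)) ^ m" if m: "m \<in> {1..L}" for m
  proof (rule final[OF m _ wn(1)])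
    have i: "nat (a - int m - a + int (Suc L)) = Suc L - m"
      "nat (a - a + int (Suc L)) = Suc L" "nat (a - 1 - a + int (Suc L)) = L"
      using m by auto
    have v: "\<phi> (a - int m) = jac b E (Suc L - m)" "\<phi> a = jac b E (Suc L)" "\<phi> (a - 1) = jac b E L"
      using m by (subst \<phi>, simp, simp only: i)+
    have "norm (jac_vec b E L) = norm (\<phi> a, \<phi> (a - 1))" unfolding jac_vec_def v ..
    moreover have "norm (\<phi> a, \<phi> (a - 1)) \<le> r" by (rule pair_le) (simp add: r2)
    moreover have "norm (\<phi> a, \<phi> (a - 1)) > 0" using nz' by (simp add: zero_prod_def)
    ultimately show "\<bar>\<phi> (a - int m)\<bar> / r \<le> \<bar>jac b E (Suc L - m)\<bar> / norm (jac_vec b E L)"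
      using r unfolding v(1)[symmetric] by (simp add: divide_left_mono)
  qed
  have \<tau>: "0 \<le> (\<rho> powr (1 / s)) ^ m" for m by simp
  have "\<bar>\<phi> n / r\<bar> \<le> max 1 (M0 powr (1 / s)) * (\<rho> powr (1 / s)) ^ nat \<bar>n - a\<bar>" for n
  proof -
    consider "n = a" | "\<bar>n - a\<bar> > int L" | m where "m \<in> {1..L}" "n = a + int m" | m where "m \<in> {1..L}" "n = a - int m"
    proof (cases "n = a \<or> \<bar>n - a\<bar> > int L")
      case False
      then have "nat \<bar>n - a\<bar> \<in> {1..L}" "n = a + int (nat \<bar>n - a\<bar>) \<or> n = a - int (nat \<bar>n - a\<bar>)" by auto
      then show thesis using that(3,4) by blast
    qed (use that in blast)
    then show ?thesis
    proof cases
      case 1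
      have "(\<phi> a)\<^sup>2 \<le> r\<^sup>2" by (simp add: r2)
      then have "\<bar>\<phi> a\<bar> \<le> r" using r by (metis abs_le_square_iff abs_of_pos)
      then show ?thesis using 1 r by (simp add: abs_divide divide_le_eq le_max_iff_disj)
    next
      case 2
      then show ?thesis by (simp add: \<phi>_def box_vector_def le_max_iff_disj)
    next
      case (3 m)
      have "\<bar>\<phi> n / r\<bar> \<le> M0 powr (1 / s) * (\<rho> powr (1 / s)) ^ m"
        using right[OF 3(1)] 3 r by (simp add: abs_divide)
      also have "\<dots> \<le> max 1 (M0 powr (1 / s)) * (\<rho> powr (1 / s)) ^ m" by (intro mult_right_mono) auto
      finally show ?thesis using 3 by simp
    next
      case (4 m)
      have "\<bar>\<phi> n / r\<bar> \<le> M0 powr (1 / s) * (\<rho> powr (1 / s)) ^ m"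
        using left[OF 4(1)] 4 r by (simp add: abs_divide)
      also have "\<dots> \<le> max 1 (M0 powr (1 / s)) * (\<rho> powr (1 / s)) ^ m" by (intro mult_right_mono) auto
      finally show ?thesis using 4 by simp
    qed
  qed
  moreover have "(\<phi> (a - 1) / r)\<^sup>2 + (\<phi> a / r)\<^sup>2 + (\<phi> (a + 1) / r)\<^sup>2 = 1"
    using r unfolding power_divide add_divide_distrib[symmetric] r2[symmetric] by simp
  ultimately show ?thesis
    unfolding normalized_decaying_def \<phi>_def r_def by blast
qed

lemma solution_on_scale: "solution_on \<omega> E S u \<Longrightarrow> solution_on \<omega> E S (\<lambda>n. u n / c)"
  unfolding solution_on_def by (auto simp flip: add_divide_distrib)

lemma box_vector_complete:
  assumes "m \<in> {a - int L..a + int L}" "n \<in> {a - int L..a + int L}"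
  shows "(\<Sum>E\<in>box_spectrum (box_potential a L \<omega>) (Suc (2 * L)). box_vector a L \<omega> E m * box_vector a L \<omega> E n
      / box_norm (box_potential a L \<omega>) (Suc (2 * L)) E) = (if m = n then 1 else 0)"
proof -
  have "\<bar>m - a\<bar> \<le> int L" "\<bar>n - a\<bar> \<le> int L" using assms by auto
  moreover have "nat (m - a + int (Suc L)) \<in> {1..Suc (2 * L)}" "nat (n - a + int (Suc L)) \<in> {1..Suc (2 * L)}"
    using assms by auto
  moreover have "nat (m - a + int (Suc L)) = nat (n - a + int (Suc L)) \<longleftrightarrow> m = n" using assms by auto
  ultimately show ?thesis
    using box_complete[of "Suc (2 * L)" "nat (m - a + int (Suc L))" "nat (n - a + int (Suc L))" "box_potential a L \<omega>"]
    by (simp add: box_vector_def)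
qed

lemma box_vector_orthogonal:
  assumes "E \<in> box_spectrum (box_potential a L \<omega>) (Suc (2 * L))" "E' \<in> box_spectrum (box_potential a L \<omega>) (Suc (2 * L))"
  shows "(\<Sum>n=a - int L..a + int L. box_vector a L \<omega> E n * box_vector a L \<omega> E' n)
     = (if E = E' then box_norm (box_potential a L \<omega>) (Suc (2 * L)) E else 0)"
proof -
  let ?b = "box_potential a L \<omega>"
  have "(\<Sum>n=a - int L..a + int L. box_vector a L \<omega> E n * box_vector a L \<omega> E' n) = (\<Sum>i=1..Suc (2 * L). jac ?b E i * jac ?b E' i)"
    by (rule sum.reindex_bij_witness[of _ "\<lambda>i. a - int (Suc L) + int i" "\<lambda>n. nat (n - a + int (Suc L))"])
      (auto simp: box_vector_def simp del: jac.simps)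
  also have "\<dots> = (if E = E' then box_norm ?b (Suc (2 * L)) E else 0)"
    using box_orthogonal[OF assms] by (auto simp: box_norm_def power2_eq_square simp del: jac.simps)
  finally show ?thesis .
qed

text \<open>Markov's inequality for the spectral measure at \<open>a\<close>: eigenvalues with large
  \<open>decay_weight\<close> contribute little to the expansion of the unit vector. The other
  eigenvectors are replaced by localized ones at a total cost controlled by the sum of their
  coefficients.\<close>

theorem correlator_imp_approximable:
  assumes \<omega>: "\<And>n. \<bar>\<omega> n\<bar> \<le> R" and s: "s > 0" and \<rho>: "0 < \<rho>" "\<rho> < 1"
    and B: "\<exists>\<^sub>F L in sequentially. box_correlator s \<rho> a L \<omega> \<le> B"
  shows "approximable (localized_eigenvectors \<omega>) (unit_vector a)"
  unfolding approximable_def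
proof (intro allI impI)
  fix \<epsilon> :: real assume \<epsilon>: "\<epsilon> > 0"
  define \<eta> where "\<eta> = \<epsilon> / 2"
  define B' where "B' = max B 1"
  \<comment> \<open>With this threshold the discarded eigenvalues have weight at most
    \<open>\<eta>^2\<close>, so their part of the expansion has norm at most \<eta>. The decay
    constants depend on \<open>M0\<close> but not on the box, so \<open>L0\<close> can be fixed
    before \<open>L\<close>.\<close>
  define M0 where "M0 = B' / \<eta>\<^sup>2"
  define \<tau> where "\<tau> = \<rho> powr (1 / s)"
  have \<eta>: "\<eta> > 0" and B': "B' > 0" using \<epsilon> by (auto simp: \<eta>_def B'_def)
  then have M0: "M0 > 0" by (simp add: M0_def)
  have \<tau>: "0 < \<tau>" "\<tau> < 1" using \<rho> s powr_less_mono2[of "1 / s" \<rho> 1] by (auto simp: \<tau>_def)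
  have e4: "\<epsilon> / 4 > 0" using \<epsilon> by simp
  obtain L0 where L0: "\<And>L E u. L \<ge> L0 \<Longrightarrow> \<bar>E\<bar> \<le> R + 2 \<Longrightarrow> solution_on \<omega> E {a - int L..a + int L} u \<Longrightarrow>
     normalized_decaying a (max 1 (M0 powr (1 / s))) \<tau> u \<Longrightarrow>
     \<exists>v. (\<lambda>n. complex_of_real (v n)) \<in> localized_eigenvectors \<omega> \<and> l2_le (\<lambda>n. complex_of_real (u n - v n)) (\<epsilon> / 4)"
    using solution_compactness[OF \<tau> e4, of "R + 2" \<omega> a "max 1 (M0 powr (1 / s))"] by blast
  \<comment> \<open>Besides \<open>L0\<close>, the radius is at least 1, so that completeness of the
    box eigenvectors can be used at \<open>a - 1\<close> and \<open>a + 1\<close>.\<close>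
  have "\<exists>L. L \<ge> max L0 1 \<and> box_correlator s \<rho> a L \<omega> \<le> B"
    using B unfolding frequently_sequentially by blast
  then obtain L where L: "L \<ge> L0" "L \<ge> 1" and corr: "box_correlator s \<rho> a L \<omega> \<le> B'"
    by (auto simp: B'_def)
  define b where "b = box_potential a L \<omega>"
  define N where "N = Suc (2 * L)"
  define Z where "Z = box_spectrum b N"
  define \<phi> where "\<phi> = box_vector a L \<omega>"
  define r where "r = center_norm a L \<omega>"
  define S where "S = box_norm b N"
  define g where "g = decay_weight s \<rho> a L \<omega>"
  have N: "N \<ge> 1" by (simp add: N_def)
  have S: "S E > 0" for E unfolding S_def by (rule box_norm_pos[OF N])
  have fin: "finite Z" unfolding Z_def by (rule card_box_spectrum(1)[OF N])
  have complete: "(\<Sum>E\<in>Z. \<phi> E m * \<phi> E n / S E) = (if m = n then 1 else 0)"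
    if "m \<in> {a - int L..a + int L}" "n \<in> {a - int L..a + int L}" for m n
    using box_vector_complete[OF that, of \<omega>] by (simp add: Z_def \<phi>_def S_def b_def N_def)
  have orth: "(\<Sum>n=a - int L..a + int L. \<phi> E n * \<phi> E' n) = (if E = E' then S E else 0)" if "E \<in> Z" "E' \<in> Z" for E E'
    using box_vector_orthogonal[of E a L \<omega> E'] that by (simp add: Z_def \<phi>_def S_def b_def N_def)
  have \<phi>a: "\<phi> E a = jac b E (Suc L)" for E
    by (simp add: \<phi>_def box_vector_def b_def nat_add_distrib del: jac.simps)
  define G where "G = {E \<in> Z. \<phi> E a \<noteq> 0 \<and> g E \<le> M0}"
  define D where "D = Z - G"
  have GZ: "G \<subseteq> Z" and finG: "finite G" and finD: "finite D" using fin by (auto simp: G_def D_def)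
  have bad_mass: "(\<Sum>E\<in>D. (\<phi> E a)\<^sup>2 / S E) \<le> \<eta>\<^sup>2"
  proof -
    have g0: "g E \<ge> 0" for E unfolding g_def by (rule decay_weight_nonneg[OF \<rho>(1)])
    have "(\<Sum>E\<in>D. (\<phi> E a)\<^sup>2 / S E) * M0 \<le> (\<Sum>E\<in>D. (\<phi> E a)\<^sup>2 / S E * g E)"
      unfolding sum_distrib_right
    proof (rule sum_mono)
      fix E assume "E \<in> D"
      then have "\<phi> E a = 0 \<or> M0 \<le> g E" by (auto simp: D_def G_def)
      then show "(\<phi> E a)\<^sup>2 / S E * M0 \<le> (\<phi> E a)\<^sup>2 / S E * g E"
      proof
        assume "M0 \<le> g E"
        then show ?thesis by (rule mult_left_mono) (use S[of E] in simp)
      qed simp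
    qed
    also have "\<dots> \<le> (\<Sum>E\<in>Z. (\<phi> E a)\<^sup>2 / S E * g E)"
      using fin g0 S by (intro sum_mono2) (auto simp: D_def less_imp_le)
    also have "\<dots> = box_correlator s \<rho> a L \<omega>"
      by (simp add: box_correlator_def Let_def \<phi>a Z_def S_def g_def b_def N_def del: jac.simps)
    also have "\<dots> \<le> B'" by (rule corr)
    finally have "(\<Sum>E\<in>D. (\<phi> E a)\<^sup>2 / S E) \<le> B' / M0" using M0 by (simp add: pos_le_divide_eq)
    also have "B' / M0 = \<eta>\<^sup>2" using B' \<eta> by (simp add: M0_def)
    finally show ?thesis .
  qed
  define bad where "bad n = (\<Sum>E\<in>D. \<phi> E a * \<phi> E n / S E)" for n
  have bad: "l2_le (\<lambda>n. complex_of_real (bad n)) \<eta>"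
    unfolding l2_le_def
  proof (intro allI impI)
    fix F :: "int set" assume F: "finite F"
    have out: "bad n = 0" if "n \<notin> {a - int L..a + int L}" for n
      using that by (auto simp: bad_def \<phi>_def box_vector_def intro!: sum.neutral)
    have "(\<Sum>n\<in>F. (bad n)\<^sup>2) = (\<Sum>n\<in>F \<inter> {a - int L..a + int L}. (bad n)\<^sup>2)"
      by (rule sum.mono_neutral_right) (use F out in auto)
    also have "\<dots> \<le> (\<Sum>n=a - int L..a + int L. (bad n)\<^sup>2)" by (intro sum_mono2) auto
    also have "\<dots> = (\<Sum>n=a - int L..a + int L. \<Sum>E\<in>D. \<Sum>E'\<in>D. \<phi> E a / S E * (\<phi> E' a / S E') * (\<phi> E n * \<phi> E' n))"
      unfolding bad_def power2_eq_square sum_product by (intro sum.cong) auto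
    also have "\<dots> = (\<Sum>E\<in>D. \<Sum>E'\<in>D. \<phi> E a / S E * (\<phi> E' a / S E') * (\<Sum>n=a - int L..a + int L. \<phi> E n * \<phi> E' n))"
      by (subst sum.swap, rule sum.cong[OF refl], subst sum.swap) (simp add: sum_distrib_left)
    also have "\<dots> = (\<Sum>E\<in>D. \<Sum>E'\<in>D. if E = E' then (\<phi> E a)\<^sup>2 / S E else 0)"
    proof (intro sum.cong refl)
      fix E E' assume "E \<in> D" "E' \<in> D"
      then show "\<phi> E a / S E * (\<phi> E' a / S E') * (\<Sum>n=a - int L..a + int L. \<phi> E n * \<phi> E' n) = (if E = E' then (\<phi> E a)\<^sup>2 / S E else 0)"
        using S[of E] by (simp add: orth D_def power2_eq_square)
    qed
    also have "\<dots> = (\<Sum>E\<in>D. (\<phi> E a)\<^sup>2 / S E)" using finD by simp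
    also have "\<dots> \<le> \<eta>\<^sup>2" by (rule bad_mass)
    finally show "L2_set (\<lambda>n. norm (complex_of_real (bad n))) F \<le> \<eta>"
      unfolding L2_set_def norm_of_real power2_abs using \<eta> by (intro real_le_lsqrt) auto
  qed
  have "\<exists>v. (\<lambda>n. complex_of_real (v n)) \<in> localized_eigenvectors \<omega> \<and> l2_le (\<lambda>n. complex_of_real (\<phi> E n / r E - v n)) (\<epsilon> / 4)"
    if E: "E \<in> G" for E
  proof (rule L0[OF L(1), of E])
    have EZ: "E \<in> box_spectrum (box_potential a L \<omega>) (Suc (2 * L))" using E GZ by (auto simp: Z_def b_def N_def)
    show "\<bar>E\<bar> \<le> R + 2"
      using EZ \<omega> by (intro box_spectrum_bound) (auto simp: box_potential_def)
    show "solution_on \<omega> E {a - int L..a + int L} (\<lambda>n. \<phi> E n / r E)"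
      unfolding \<phi>_def by (rule solution_on_scale[OF box_vector_solution[OF EZ]])
    show "normalized_decaying a (max 1 (M0 powr (1 / s))) \<tau> (\<lambda>n. \<phi> E n / r E)"
      unfolding \<phi>_def r_def \<tau>_def
      by (rule box_vector_normalized_decaying[OF EZ _ _ s \<rho>]) (use E in \<open>auto simp: G_def \<phi>_def g_def\<close>)
  qed
  then obtain v where v: "\<And>E. E \<in> G \<Longrightarrow> (\<lambda>n. complex_of_real (v E n)) \<in> localized_eigenvectors \<omega>"
    and vd: "\<And>E. E \<in> G \<Longrightarrow> l2_le (\<lambda>n. complex_of_real (\<phi> E n / r E - v E n)) (\<epsilon> / 4)"
    by metis
  define c where "c E = \<phi> E a * r E / S E" for E
  define f where "f n = (\<Sum>E\<in>G. complex_of_real (c E) * complex_of_real (v E n))" for n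
  have f: "f \<in> lspan (localized_eigenvectors \<omega>)"
    unfolding f_def[abs_def] by (intro lspan_sum[where f="\<lambda>E n. complex_of_real (v E n)"] finG lspan_base v)
  have r2: "(r E)\<^sup>2 = (\<phi> E (a - 1))\<^sup>2 + (\<phi> E a)\<^sup>2 + (\<phi> E (a + 1))\<^sup>2" for E
    unfolding r_def center_norm_def \<phi>_def by (rule real_sqrt_pow2) simp
  \<comment> \<open>From \<open>2 * \<bar>\<phi> E a\<bar> * r E \<le> (\<phi> E a)^2 + (r
    E)^2\<close>: completeness at \<open>a\<close> counts twice and at each neighbour once, giving
    \<open>(2 + 1 + 1) / 2\<close>. Errors of \<open>\<epsilon> / 4\<close> per eigenvector then add
    up to at most \<open>\<epsilon> / 2\<close>.\<close>
  have sumc: "(\<Sum>E\<in>G. \<bar>c E\<bar>) \<le> 2"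
  proof -
    have r0: "r E \<ge> 0" for E by (simp add: r_def center_norm_def)
    have "(\<Sum>E\<in>G. \<bar>c E\<bar>) \<le> (\<Sum>E\<in>G. ((\<phi> E a)\<^sup>2 + (r E)\<^sup>2) / S E / 2)"
    proof (rule sum_mono)
      fix E
      have "2 * (\<bar>\<phi> E a\<bar> * r E) \<le> (\<phi> E a)\<^sup>2 + (r E)\<^sup>2"
        using sum_squares_bound[of "\<bar>\<phi> E a\<bar>" "r E"] by (simp add: mult.assoc)
      then have "2 * (\<bar>\<phi> E a\<bar> * r E) / S E \<le> ((\<phi> E a)\<^sup>2 + (r E)\<^sup>2) / S E"
        using S[of E] by (intro divide_right_mono) auto
      moreover have "\<bar>c E\<bar> = \<bar>\<phi> E a\<bar> * r E / S E" using S[of E] r0[of E] by (simp add: c_def abs_mult)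
      ultimately show "\<bar>c E\<bar> \<le> ((\<phi> E a)\<^sup>2 + (r E)\<^sup>2) / S E / 2" by simp
    qed
    also have "\<dots> \<le> (\<Sum>E\<in>Z. ((\<phi> E a)\<^sup>2 + (r E)\<^sup>2) / S E / 2)"
      using fin GZ S by (intro sum_mono2) (auto simp: less_imp_le)
    also have "\<dots> = (2 * (\<Sum>E\<in>Z. \<phi> E a * \<phi> E a / S E) + (\<Sum>E\<in>Z. \<phi> E (a - 1) * \<phi> E (a - 1) / S E)
        + (\<Sum>E\<in>Z. \<phi> E (a + 1) * \<phi> E (a + 1) / S E)) / 2"
      unfolding r2 sum_distrib_left sum.distrib[symmetric] sum_divide_distrib
      by (intro sum.cong refl) (simp add: power2_eq_square add_divide_distrib)
    also have "\<dots> = 2" using L(2) by (simp add: complete)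
    finally show ?thesis .
  qed
  have unit: "unit_vector a n = complex_of_real (bad n + (\<Sum>E\<in>G. c E * (\<phi> E n / r E)))" for n
  proof -
    have r0: "r E \<noteq> 0" if "E \<in> G" for E
    proof -
      have "(\<phi> E a)\<^sup>2 > 0" using that by (simp add: G_def)
      then have "(r E)\<^sup>2 > 0" unfolding r2 by (simp add: add_pos_nonneg add_nonneg_pos)
      then show ?thesis by auto
    qed
    have "bad n + (\<Sum>E\<in>G. c E * (\<phi> E n / r E)) = (\<Sum>E\<in>D. \<phi> E a * \<phi> E n / S E) + (\<Sum>E\<in>G. \<phi> E a * \<phi> E n / S E)"
      unfolding bad_def c_def using r0 by (intro arg_cong2[of _ _ _ _ "(+)"] sum.cong) auto
    also have "\<dots> = (\<Sum>E\<in>Z. \<phi> E a * \<phi> E n / S E)"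
      unfolding D_def using GZ fin by (simp add: sum.subset_diff)
    also have "\<dots> = (if n = a then 1 else 0)"
    proof (cases "n \<in> {a - int L..a + int L}")
      case False
      then have "\<phi> E n = 0" for E by (auto simp: \<phi>_def box_vector_def)
      then show ?thesis using False by auto
    qed (use complete[of a n] in auto)
    finally show ?thesis by (simp add: unit_vector_def)
  qed
  have "l2_le (\<lambda>n. complex_of_real (bad n) + (\<Sum>E\<in>G. complex_of_real (c E) * complex_of_real (\<phi> E n / r E - v E n)))
     (\<eta> + (\<Sum>E\<in>G. norm (complex_of_real (c E)) * (\<epsilon> / 4)))"
    by (intro l2_le_add bad l2_le_sum finG l2_le_scale vd)
  moreover have "\<eta> + (\<Sum>E\<in>G. norm (complex_of_real (c E)) * (\<epsilon> / 4)) \<le> \<epsilon>"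
  proof -
    have "(\<Sum>E\<in>G. norm (complex_of_real (c E)) * (\<epsilon> / 4)) = (\<Sum>E\<in>G. \<bar>c E\<bar>) * (\<epsilon> / 4)"
      by (simp add: sum_distrib_right)
    also have "\<dots> \<le> 2 * (\<epsilon> / 4)" using \<epsilon> by (intro mult_right_mono sumc) auto
    finally show ?thesis by (simp add: \<eta>_def)
  qed
  moreover have "complex_of_real (bad n) + (\<Sum>E\<in>G. complex_of_real (c E) * complex_of_real (\<phi> E n / r E - v E n))
     = unit_vector a n - f n" for n
    unfolding unit f_def by (simp add: sum_subtractf algebra_simps)
  ultimately have "l2_le (\<lambda>n. unit_vector a n - f n) \<epsilon>" by (simp add: l2_le_mono)
  then show "\<exists>f\<in>lspan (localized_eigenvectors \<omega>). l2_le (\<lambda>n. unit_vector a n - f n) \<epsilon>"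
    using f by blast
qed

section \<open>Almost sure localization\<close>

context product_site
begin

declare coordinate_measurable [measurable del]

text \<open>The disjoint pairs \<open>2 * k\<close>, \<open>2 * k + 1\<close> are independent, and
  each succeeds with probability \<open>p * p > 0\<close>; the probability that the first
  \<open>n\<close> pairs all fail is a power that tends to 0.\<close>

lemma adjacent_regular_sites: "AE \<omega> in \<Omega>. \<exists>a. \<omega> a \<in> A \<and> \<omega> (a + 1) \<in> A"
proof -
  interpret M: prob_space M by (rule prob_M)
  define h :: "real \<Rightarrow> real \<Rightarrow> ennreal" where "h x y = 1 - indicator A x * indicator A y" for x y
  have h_le: "h x y \<le> 1" for x y by (simp add: h_def)
  have hm: "(\<lambda>z. h (X z) (Y z)) \<in> borel_measurable N"
    if [measurable]: "X \<in> borel_measurable N" "Y \<in> borel_measurable N" for X Y and N :: "'z measure"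
    unfolding h_def by measurable
  define q where "q = (\<integral>\<^sup>+x. \<integral>\<^sup>+y. h x y \<partial>\<nu> \<partial>\<nu>)"
  define p where "p = measure \<nu> A"
  have q: "q + ennreal (p * p) = 1"
  proof -
    have iA: "(\<integral>\<^sup>+y. indicator A y \<partial>\<nu>) = ennreal p"
      by (simp add: sets_nu p_def emeasure_eq_measure)
    have "ennreal (p * p) = (\<integral>\<^sup>+x. indicator A x * ennreal p \<partial>\<nu>)"
    proof -
      have "(\<integral>\<^sup>+x. indicator A x * ennreal p \<partial>\<nu>) = (\<integral>\<^sup>+x. indicator A x \<partial>\<nu>) * ennreal p"
        by (rule nn_integral_multc) measurable
      then show ?thesis by (simp add: iA p_def ennreal_mult)
    qed
    also have "\<dots> = (\<integral>\<^sup>+x. \<integral>\<^sup>+y. indicator A x * indicator A y \<partial>\<nu> \<partial>\<nu>)"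
      by (intro nn_integral_cong) (simp add: nn_integral_cmult iA)
    finally have "q + ennreal (p * p) = (\<integral>\<^sup>+x. (\<integral>\<^sup>+y. h x y \<partial>\<nu>) + (\<integral>\<^sup>+y. indicator A x * indicator A y \<partial>\<nu>) \<partial>\<nu>)"
      unfolding q_def h_def by (simp add: nn_integral_add)
    also have "\<dots> = (\<integral>\<^sup>+x. \<integral>\<^sup>+y. h x y + indicator A x * indicator A y \<partial>\<nu> \<partial>\<nu>)"
      unfolding h_def by (intro nn_integral_cong nn_integral_add[symmetric]) measurable
    also have "\<dots> = (\<integral>\<^sup>+x. \<integral>\<^sup>+y. 1 \<partial>\<nu> \<partial>\<nu>)"
      by (intro nn_integral_cong) (auto simp: h_def split: split_indicator)
    finally show ?thesis by (simp add: emeasure_space_1)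
  qed
  then obtain c where c: "q = ennreal c" "0 \<le> c" by (cases q) auto
  have "c + p * p = 1" using q c by (simp add: p_def flip: ennreal_plus)
  moreover have "p * p > 0" using A_pos by (simp add: p_def)
  ultimately have c1: "c < 1" by linarith
  define F where "F n \<omega> = (\<Prod>k<n. h (\<omega> (2 * int k)) (\<omega> (2 * int k + 1)))" for n and \<omega> :: "int \<Rightarrow> real"
  have Fm: "F n \<in> borel_measurable \<Omega>" for n
    unfolding F_def[abs_def] by (intro borel_measurable_prod_ennreal hm coordinate_measurable)
  have int: "(\<integral>\<^sup>+\<omega>. F n \<omega> \<partial>\<Omega>) = q ^ n" for n
  proof (induction n)
    case 0
    then show ?case by (simp add: F_def P.emeasure_space_1)
  next
    case (Suc n)
    let ?i = "2 * int n" and ?j = "2 * int n + 1"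
    have F_upd: "F n (fun_upd \<omega> ?i x) = F n \<omega>" "F n (fun_upd \<omega> ?j x) = F n \<omega>" for \<omega> x
      unfolding F_def by (auto intro!: prod.cong)
    have F_Suc: "F (Suc n) \<omega> = F n \<omega> * h (\<omega> ?i) (\<omega> ?j)" for \<omega> by (simp add: F_def)
    have hM: "(\<integral>\<^sup>+y. c * h (f y) (g y) \<partial>M) = c * (\<integral>\<^sup>+y. h (f y) (g y) \<partial>\<nu>)"
      if "f \<in> borel_measurable borel" "g \<in> borel_measurable borel" for c and f g :: "real \<Rightarrow> real"
    proof -
      have m: "(\<lambda>y. h (f y) (g y)) \<in> borel_measurable borel" using that by (rule hm)
      have "(\<integral>\<^sup>+y. c * h (f y) (g y) \<partial>M) = c * (\<integral>\<^sup>+y. h (f y) (g y) \<partial>M)"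
        by (rule nn_integral_cmult) (rule measurable_compose[OF id_M m])
      then show ?thesis unfolding nn_integral_M[OF m] .
    qed
    have hm1: "(\<lambda>x. \<integral>\<^sup>+y. h x y \<partial>\<nu>) \<in> borel_measurable borel" unfolding h_def by measurable
    have inner: "(\<integral>\<^sup>+y. F (Suc n) (fun_upd \<omega> ?j y) \<partial>M) = F n \<omega> * (\<integral>\<^sup>+y. h (\<omega> ?i) y \<partial>\<nu>)" for \<omega>
    proof -
      have "F (Suc n) (fun_upd \<omega> ?j y) = F n \<omega> * h (\<omega> ?i) y" for y
      proof -
        have "(fun_upd \<omega> ?j y) ?i = \<omega> ?i" "(fun_upd \<omega> ?j y) ?j = y" by simp_all
        then show ?thesis using F_Suc[of "fun_upd \<omega> ?j y"] F_upd(2)[of \<omega> y] by (simp only:)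
      qed
      moreover have "(\<integral>\<^sup>+y. F n \<omega> * h (\<omega> ?i) y \<partial>M) = F n \<omega> * (\<integral>\<^sup>+y. h (\<omega> ?i) y \<partial>\<nu>)"
        by (rule hM) simp_all
      ultimately show ?thesis by (simp only:)
    qed
    have "(\<integral>\<^sup>+\<omega>. F (Suc n) \<omega> \<partial>\<Omega>) = (\<integral>\<^sup>+\<omega>. F n \<omega> * (\<integral>\<^sup>+y. h (\<omega> ?i) y \<partial>\<nu>) \<partial>\<Omega>)"
      by (subst nn_integral_resample[OF Fm, of _ ?j]) (simp only: inner)
    also have "\<dots> = (\<integral>\<^sup>+\<omega>. \<integral>\<^sup>+x. F n \<omega> * (\<integral>\<^sup>+y. h x y \<partial>\<nu>) \<partial>M \<partial>\<Omega>)"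
    proof (subst nn_integral_resample[of _ ?i])
      show "(\<lambda>\<omega>. F n \<omega> * (\<integral>\<^sup>+y. h (\<omega> ?i) y \<partial>\<nu>)) \<in> borel_measurable \<Omega>"
        by (intro borel_measurable_times_ennreal Fm measurable_compose[OF coordinate_measurable hm1])
    qed (simp only: F_upd fun_upd_same)
    also have "\<dots> = (\<integral>\<^sup>+\<omega>. F n \<omega> * q \<partial>\<Omega>)"
    proof (rule nn_integral_cong)
      fix \<omega>
      have "(\<integral>\<^sup>+x. F n \<omega> * (\<integral>\<^sup>+y. h x y \<partial>\<nu>) \<partial>M) = F n \<omega> * (\<integral>\<^sup>+x. (\<integral>\<^sup>+y. h x y \<partial>\<nu>) \<partial>M)"
        by (rule nn_integral_cmult) (rule measurable_compose[OF id_M hm1])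
      then show "(\<integral>\<^sup>+x. F n \<omega> * (\<integral>\<^sup>+y. h x y \<partial>\<nu>) \<partial>M) = F n \<omega> * q"
        unfolding nn_integral_M[OF hm1] q_def .
    qed
    also have "\<dots> = q ^ Suc n" unfolding nn_integral_multc[OF Fm] Suc by (simp add: mult.commute)
    finally show ?case .
  qed
  let ?good = "\<lambda>\<omega>. \<exists>k. \<omega> (2 * int k) \<in> A \<and> \<omega> (2 * int k + 1) \<in> A"
  have Bm [measurable]: "{\<omega> \<in> space \<Omega>. \<not> ?good \<omega>} \<in> sets \<Omega>"
  proof -
    have [measurable]: "{\<omega> \<in> space \<Omega>. \<omega> i \<in> A} \<in> sets \<Omega>" for i
      using measurable_sets[OF coordinate_measurable A_sets, of i] by (simp add: vimage_def Int_def conj_commute)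
    show ?thesis by measurable
  qed
  have small: "emeasure \<Omega> {\<omega> \<in> space \<Omega>. \<not> ?good \<omega>} \<le> ennreal (c ^ n)" for n
  proof -
    have "emeasure \<Omega> {\<omega> \<in> space \<Omega>. \<not> ?good \<omega>} = (\<integral>\<^sup>+\<omega>. indicator {\<omega> \<in> space \<Omega>. \<not> ?good \<omega>} \<omega> \<partial>\<Omega>)"
      by (rule nn_integral_indicator[symmetric]) measurable
    also have "\<dots> \<le> (\<integral>\<^sup>+\<omega>. F n \<omega> \<partial>\<Omega>)"
    proof (rule nn_integral_mono)
      fix \<omega>
      show "indicator {\<omega> \<in> space \<Omega>. \<not> ?good \<omega>} \<omega> \<le> F n \<omega>"
      proof (cases "?good \<omega>")
        case False
        then have "h (\<omega> (2 * int k)) (\<omega> (2 * int k + 1)) = 1" for k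
          by (auto simp: h_def split: split_indicator)
        then have "F n \<omega> = 1" by (simp add: F_def)
        then show ?thesis by (simp split: split_indicator)
      qed simp
    qed
    also have "\<dots> = ennreal (c ^ n)" unfolding int c using c by (simp add: ennreal_power)
    finally show ?thesis .
  qed
  have "(\<lambda>n. ennreal (c ^ n)) \<longlonglongrightarrow> ennreal 0"
    using c c1 by (intro tendsto_ennrealI LIMSEQ_realpow_zero)
  then have "emeasure \<Omega> {\<omega> \<in> space \<Omega>. \<not> ?good \<omega>} \<le> ennreal 0"
    by (rule LIMSEQ_le_const) (use small in auto)
  then have B0: "emeasure \<Omega> {\<omega> \<in> space \<Omega>. \<not> ?good \<omega>} = 0" by simp
  have "AE \<omega> in \<Omega>. ?good \<omega>" by (rule AE_I[OF subset_refl B0 Bm])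
  then show ?thesis by eventually_elim blast
qed

theorem AE_spectrally_localized: "AE \<omega> in \<Omega>. spectrally_localized (anderson \<omega>)"
proof -
  have "R + 3 \<ge> 0" using R_pos by simp
  \<comment> \<open>The open energy window of radius \<open>R + 3\<close> contains all box spectra,
    which lie within \<open>R + 2\<close>.\<close>
  then obtain s C \<rho> where dc: "decay_constants (R + 3) s C \<rho>" by (rule decay_constants_exist)
  then have s: "s > 0" and \<rho>: "0 < \<rho>" "\<rho> < 1" by (auto simp: decay_constants_def)
  have "AE \<omega> in \<Omega>. \<forall>a. \<omega> a \<in> A \<longrightarrow> (\<exists>B. \<exists>\<^sub>F L in sequentially. box_correlator s \<rho> a L \<omega> \<le> B)"
    unfolding AE_all_countable by (intro allI correlator_bounded_frequently[OF dc]) simp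
  with adjacent_regular_sites AE_space show ?thesis
  proof eventually_elim
    fix \<omega> assume adj: "\<exists>a. \<omega> a \<in> A \<and> \<omega> (a + 1) \<in> A" and sp: "\<omega> \<in> space \<Omega>"
      and bd: "\<forall>a. \<omega> a \<in> A \<longrightarrow> (\<exists>B. \<exists>\<^sub>F L in sequentially. box_correlator s \<rho> a L \<omega> \<le> B)"
    have \<omega>: "\<bar>\<omega> i\<bar> \<le> R" for i using sp by (intro space_M) (auto simp: space_PiM PiE_iff)
    have app: "approximable (localized_eigenvectors \<omega>) (unit_vector a)" if "\<omega> a \<in> A" for a
      using bd that correlator_imp_approximable[where \<omega>=\<omega>, OF \<omega> s \<rho>] by blast
    show "spectrally_localized (anderson \<omega>)"
      using adj app all_unit_vectors_approximable[where \<omega>=\<omega>, OF \<omega>] by (intro spectrally_localizedI) blast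
  qed
qed

end

text \<open>The complement is the union of all open null sets, and by Lindelof's theorem countably
  many of them suffice.\<close>

lemma emeasure_compl_measure_support:
  fixes M :: "'a::second_countable_topology measure"
  assumes sets: "sets M = sets borel"
  shows "emeasure M (- measure_support M) = 0"
proof -
  define \<F> where "\<F> = {U. open U \<and> emeasure M U = 0}"
  have "\<And>U. U \<in> \<F> \<Longrightarrow> open U" by (simp add: \<F>_def)
  then obtain \<F>' where F': "\<F>' \<subseteq> \<F>" "countable \<F>'" "\<Union>\<F>' = \<Union>\<F>" by (rule Lindelof)
  have "- measure_support M = \<Union>\<F>"
    by (auto simp: measure_support_def \<F>_def zero_less_iff_neq_zero)
  moreover have "\<Union>\<F>' \<in> null_sets M"
    using F' by (intro null_sets_UN'[of \<F>' "\<lambda>U. U", simplified]) (auto simp: \<F>_def sets null_setsI)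
  ultimately show ?thesis using F'(3) by auto
qed

text \<open>Off the null set \<open>N\<close> that carries the singular part, \<nu> has the density
  \<open>f\<close>. The sublevel sets of \<open>f\<close> outside \<open>N\<close> exhaust the line
  up to null sets of the absolutely continuous part, so one of them has positive mass.\<close>

lemma lebesgue_decomposition_dominated_part:
  assumes "prob_space \<nu>" and sets: "sets \<nu> = sets borel"
    and dec: "lebesgue_decomposition \<nu> \<nu>_ac \<nu>_s" and nz: "\<nu>_ac \<noteq> null_measure borel"
  obtains A and K :: real where "A \<in> sets borel" "K > 0" "measure \<nu> A > 0"
    "\<And>B. B \<in> sets borel \<Longrightarrow> B \<subseteq> A \<Longrightarrow> emeasure \<nu> B \<le> ennreal K * emeasure lborel B"
proof -
  interpret prob_space \<nu> by fact
  have s_ac[measurable_cong]: "sets \<nu>_ac = sets borel" and s_s: "sets \<nu>_s = sets borel"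
    and sum: "\<And>B. B \<in> sets borel \<Longrightarrow> emeasure \<nu> B = emeasure \<nu>_ac B + emeasure \<nu>_s B"
    and ac: "absolutely_continuous lborel \<nu>_ac"
    using dec by (auto simp: lebesgue_decomposition_def)
  obtain N where N[measurable]: "N \<in> sets borel" and N0: "emeasure lborel N = 0" and sN: "emeasure \<nu>_s (UNIV - N) = 0"
    using dec by (auto simp: lebesgue_decomposition_def)
  obtain f where f[measurable]: "f \<in> borel_measurable borel" and dens: "density lborel f = \<nu>_ac"
    using sigma_finite_measure.Radon_Nikodym[OF sigma_finite_lborel ac] s_ac by auto
  have f_int: "emeasure \<nu>_ac B = (\<integral>\<^sup>+x. f x * indicator B x \<partial>lborel)" if "B \<in> sets borel" for B
    unfolding dens[symmetric] using that by (subst emeasure_density) auto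
  define A where "A k = {x. x \<notin> N \<and> f x \<le> ennreal (real (Suc k))}" for k
  have Am[measurable]: "A k \<in> sets borel" for k unfolding A_def by measurable
  have dom: "emeasure \<nu> B \<le> ennreal (real (Suc k)) * emeasure lborel B" if B: "B \<in> sets borel" "B \<subseteq> A k" for B k
  proof -
    have "emeasure \<nu>_s B \<le> emeasure \<nu>_s (UNIV - N)"
      using B by (intro emeasure_mono) (auto simp: A_def s_s)
    then have "emeasure \<nu> B = emeasure \<nu>_ac B" using sum[OF B(1)] sN by simp
    also have "\<dots> \<le> (\<integral>\<^sup>+x. ennreal (real (Suc k)) * indicator B x \<partial>lborel)"
      unfolding f_int[OF B(1)] using B(2) by (intro nn_integral_mono) (auto simp: A_def split: split_indicator)
    also have "\<dots> = ennreal (real (Suc k)) * emeasure lborel B"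
      using B(1) by (intro nn_integral_cmult_indicator) simp
    finally show ?thesis .
  qed
  have "\<exists>k. measure \<nu> (A k) > 0"
  proof (rule ccontr)
    assume "\<not> ?thesis"
    then have "emeasure \<nu> (A k) = 0" for k by (simp add: emeasure_eq_measure zero_less_measure_iff)
    then have "emeasure \<nu>_ac (A k) = 0" for k using sum[OF Am, of k] by simp
    then have U: "(\<Union>k. A k) \<in> null_sets \<nu>_ac" by (intro null_sets_UN null_setsI) (auto simp: s_ac)
    have "emeasure \<nu>_ac UNIV \<le> emeasure \<nu> UNIV" using sum[of UNIV] by simp
    also have "\<dots> < \<infinity>" by (simp add: emeasure_eq_measure)
    finally have "(\<integral>\<^sup>+x. f x \<partial>lborel) \<noteq> \<infinity>" using f_int[of UNIV] by simp
    then have "AE x in lborel. f x \<noteq> \<infinity>" by (intro nn_integral_PInf_AE) auto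
    then have "{x. f x = \<infinity>} \<in> null_sets lborel" by (subst (asm) AE_iff_null) auto
    then have I: "{x. f x = \<infinity>} \<in> null_sets \<nu>_ac" using ac by (auto simp: absolutely_continuous_def)
    have "N \<in> null_sets lborel" using N0 by (intro null_setsI) auto
    then have N': "N \<in> null_sets \<nu>_ac" using ac by (auto simp: absolutely_continuous_def)
    have "UNIV \<subseteq> (\<Union>k. A k) \<union> {x. f x = \<infinity>} \<union> N"
    proof
      fix x
      show "x \<in> (\<Union>k. A k) \<union> {x. f x = \<infinity>} \<union> N"
      proof (cases "f x")
        case (real r)
        obtain k where "r \<le> real k" using real_arch_simple by blast
        then have "f x \<le> ennreal (real (Suc k))" unfolding real by (intro ennreal_leI) simp
        then show ?thesis by (auto simp: A_def)
      qed auto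
    qed
    then have "UNIV \<in> null_sets \<nu>_ac"
      using null_sets.Un[OF null_sets.Un[OF U I] N'] by (metis top.extremum_unique)
    then have "emeasure \<nu>_ac UNIV = 0" by auto
    then have "emeasure \<nu>_ac B = 0" for B
      by (metis emeasure_mono emeasure_notin_sets le_zero_eq s_ac subset_UNIV UNIV_I sets.top space_borel)
    then have "\<nu>_ac = null_measure borel" by (intro measure_eqI) (auto simp: s_ac)
    then show False using nz by simp
  qed
  then obtain k where "measure \<nu> (A k) > 0" by blast
  then show thesis by (intro that[of "A k" "real (Suc k)"] Am dom) auto
qed

theorem theorem3p3:
  fixes \<nu> \<nu>_ac \<nu>_s :: "real measure"
  assumes "prob_space \<nu>" and "sets \<nu> = sets borel"
    and "compact (measure_support \<nu>)"
    and "lebesgue_decomposition \<nu> \<nu>_ac \<nu>_s"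
    and "\<nu>_ac \<noteq> null_measure borel"
  shows "AE \<omega> in disorder_measure \<nu>. spectrally_localized (anderson \<omega>)"
proof -
  interpret prob_space \<nu> by fact
  define S where "S = measure_support \<nu>"
  \<comment> \<open>The disorder measure is the product of copies of this restriction; as the
    complement of the support is null, its image on the line is \<nu> itself.\<close>
  define M where "M = restrict_space \<nu> S"
  have S[measurable]: "S \<in> sets borel" using assms(3) by (simp add: S_def borel_closed compact_imp_closed)
  have sp: "space \<nu> = UNIV" using sets_eq_imp_space_eq[OF assms(2)] by simp
  have S0: "emeasure \<nu> (- S) = 0" unfolding S_def by (rule emeasure_compl_measure_support[OF assms(2)])
  have AE_S: "AE x in \<nu>. x \<in> S"
    using S0 by (intro AE_I[where N="- S"]) (auto simp: assms(2))
  obtain R where R: "R > 0" "\<And>x. x \<in> S \<Longrightarrow> \<bar>x\<bar> \<le> R"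
    using compact_imp_bounded[OF assms(3)] unfolding bounded_pos S_def by auto
  obtain A K where A: "A \<in> sets borel" "K > 0" "measure \<nu> A > 0"
    "\<And>B. B \<in> sets borel \<Longrightarrow> B \<subseteq> A \<Longrightarrow> emeasure \<nu> B \<le> ennreal K * emeasure lborel B"
    by (rule lebesgue_decomposition_dominated_part[OF assms(1,2,4,5)]) blast
  have em: "emeasure M B = emeasure \<nu> B" if "B \<subseteq> S" for B
    unfolding M_def using that by (subst emeasure_restrict_space) (auto simp: sp assms(2))
  have inter: "emeasure \<nu> (B \<inter> S) = emeasure \<nu> B" if "B \<in> sets borel" for B
    using AE_S that by (intro emeasure_eq_AE) (auto simp: assms(2))
  have spM: "space M = S" by (simp add: M_def space_restrict_space sp)
  have id: "(\<lambda>x. x) \<in> borel_measurable M"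
    unfolding M_def by (intro measurable_restrict_space1) (simp add: assms(2) measurable_ident_sets)
  have pM: "prob_space M"
  proof (rule prob_spaceI)
    show "emeasure M (space M) = 1"
      using em[of S] inter[of UNIV] emeasure_space_1 by (simp add: spM sp)
  qed
  have dM: "distr M borel (\<lambda>x. x) = \<nu>"
  proof (rule measure_eqI)
    fix B assume "B \<in> sets (distr M borel (\<lambda>x. x))"
    then have B: "B \<in> sets borel" by simp
    have "emeasure (distr M borel (\<lambda>x. x)) B = emeasure M (B \<inter> S)"
      using B id by (subst emeasure_distr) (auto simp: spM)
    also have "\<dots> = emeasure \<nu> B" using em[of "B \<inter> S"] inter[OF B] by simp
    finally show "emeasure (distr M borel (\<lambda>x. x)) B = emeasure \<nu> B" .
  qed (simp add: assms(2))
  have bd: "AE V in \<nu>. \<bar>V\<bar> \<le> R" using AE_S by eventually_elim (rule R(2))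
  have bM: "\<And>x. x \<in> space M \<Longrightarrow> \<bar>x\<bar> \<le> R" unfolding spM by (rule R(2))
  interpret product_site \<nu> R K A M
    by (intro product_site.intro single_site.intro single_site_axioms.intro product_site_axioms.intro
        assms(1,2) bd A R(1) pM id dM bM)
  show ?thesis
    using AE_spectrally_localized unfolding disorder_measure_def M_def S_def .
qed

end
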